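(* Let $m\ge1$. Let $\overline Z$ be the unique formal power series in $t$ with constant term $0$ such that $t=\overline Z(1-\overline Z)^{m^2+2m}$, and $\overline U$ the unique formal power series in $t$ with coefficients in $\mathbb{Q}[x]$ such that \[ x=\frac{\overline U}{(1-\overline Z)^{m+2}}\left(1-\overline Z\,\frac{\overline U^{m+1}-1}{\overline U-1}\right). \] Then the generating function $\overline I$ of ordinary $m$-Tamari intervals of positive size, counted by size (variable $t$) and final descent length of the maximal element (variable $x$), satisfies \[ x^2\overline I=\frac{\overline Z\,\overline U^{m+2}}{(1-\overline Z)^{2m+4}}\left(1-\overline Z\sum_{e=0}^m\overline U^e(m+1-e)\right). \] In particular $1+\overline I(1)=\frac{1-(m+1)\overline Z}{(1-\overline Z)^{m+2}}$, so that the number of ordinary $m$-Tamari intervals in $\mathcal D_{m,n}$ is $\frac{m+1}{n(mn+1)}\binom{(m+1)^2n+m}{n-1}$ for $n\ge1$. Moreover \[ \overline J_m=\frac{x-1}{x}\cdot\frac{\overline Z\,\overline U^{m+1}}{\overline U-1+\overline Z}, \] and for $0\le i\le m+1$, \[ \frac{\overline J_i}{x^{m-i-1}}=\overline Z(1-\overline Z)^{(m+2)(m-i-1)}H_i(\overline Z;\overline U), \] where $H_{m+1}(z;u)=u^{m+2}\left(1-z\sum_{e=0}^m u^e(m+1-e)\right)$ and, for $0\le i\le m$, \[ H_i(z;u)=u^{i+1}\left(1+\sum_{k=1}^{i+1}(-z)^k\binom{i+1}{k}\sum_{e=0}^{m-i}\binom{e+k-1}{e}u^e+\sum_{k=1}^{i}(-z)^k\binom{m+k-i-1}{k-1}\sum_{e=0}^{i-k}\binom{e+k}{e}u^{m+1-k-e}\right).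 \]
   Context: An $m$-Dyck path of size $n$ is a word with $n$ letters $1$ (up steps $(+m,+m)$) and $mn$ letters $0$ (down steps $(+1,-1)$) whose lattice path from $(0,0)$ never goes strictly below the horizontal axis; $\mathcal D_{m,n}$ is the set of them, $\varnothing$ the empty path. The final descent length $d(w)$ is the length $k$ of the longest suffix $0^k$ of $w$. A valley is an occurrence of $01$; a Dyck factor is a factor which is itself an $m$-Dyck path. The ordinary $m$-Tamari order is generated by the cover relations $w\triangleleft w'$, one per valley of $w$, where $w'$ is obtained by swapping the down step of the valley with the shortest non-empty Dyck factor immediately following it. An interval $[v,w]$ is a pair of paths of the same size $n$ with $v\le w$, weighted by $t^nx^{d(w)}$ in generating functions; $F(1)$ denotes specialisation at $x=1$. $D(w_1,\dots,w_{m+1})$ denotes $1w_10\,w_20\cdots w_m0\,w_{m+1}$. For $0\le i\le m+1$, $\overline J_i$ is the generating function of ordinary $m$-Tamari intervals $[v,w]$ of positive size with $v=D(v_1,\dots,v_i,\varnothing,\dots,\varnothing)$ for some (possibly empty) $m$-Dyck paths $v_j$; $\overline J_{m+1}=\overline I$. *)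

theory Defs
  imports
    "HOL-Computational_Algebra.Formal_Power_Series"
    "HOL-Computational_Algebra.Polynomial_Factorial"
begin

unbundle fps_syntax

text \<open>Paths: the letter \<open>1\<close> is \<open>Up\<close> and the letter \<open>0\<close> is \<open>Down\<close>.\<close>

datatype step = Up | Down

definition height :: "nat \<Rightarrow> step list \<Rightarrow> int" where
  "height m w = int m * int (count_list w Up) - int (count_list w Down)"

definition dyck_paths :: "nat \<Rightarrow> nat \<Rightarrow> step list set" where
  "dyck_paths m n = {w. count_list w Up = n \<and> count_list w Down = m * n \<and>
     (\<forall>k\<le>length w. 0 \<le> height m (take k w))}"

definition is_dyck :: "nat \<Rightarrow> step list \<Rightarrow> bool" where
  "is_dyck m w \<longleftrightarrow> (\<exists>n. w \<in> dyck_paths m n)"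

definition final_descent :: "step list \<Rightarrow> nat" where
  "final_descent w = length (takeWhile (\<lambda>s. s = Down) (rev w))"

definition shortest_dyck_prefix :: "nat \<Rightarrow> step list \<Rightarrow> step list \<Rightarrow> bool" where
  "shortest_dyck_prefix m s c \<longleftrightarrow> s \<noteq> [] \<and> is_dyck m s \<and> (\<exists>b. c = s @ b) \<and>
     (\<forall>p b. c = p @ b \<longrightarrow> p \<noteq> [] \<longrightarrow> is_dyck m p \<longrightarrow> length s \<le> length p)"

text \<open>In \<open>w = a @ [Down] @ s @ b\<close> the displayed \<open>Down\<close> is the down step of a valley:
  the next letter of the path is \<open>Up\<close>.\<close>

definition tamari_cover :: "nat \<Rightarrow> step list \<Rightarrow> step list \<Rightarrow> bool" where
  "tamari_cover m w w' \<longleftrightarrow> is_dyck m w \<and>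
     (\<exists>a s b. w = a @ [Down] @ s @ b \<and> (\<exists>c. s @ b = Up # c) \<and>
        shortest_dyck_prefix m s (s @ b) \<and> w' = a @ s @ [Down] @ b)"

definition tamari_le :: "nat \<Rightarrow> step list \<Rightarrow> step list \<Rightarrow> bool" where
  "tamari_le m = (tamari_cover m)\<^sup>*\<^sup>*"

definition tamari_intervals :: "nat \<Rightarrow> nat \<Rightarrow> (step list \<times> step list) set" where
  "tamari_intervals m n =
     {(v, w). v \<in> dyck_paths m n \<and> w \<in> dyck_paths m n \<and> tamari_le m v w}"

text \<open>\<open>D_word [w\<^sub>1, \<dots>, w\<^sub>m\<^sub>+\<^sub>1]\<close> is \<open>1 w\<^sub>1 0 w\<^sub>2 0 \<dots> w\<^sub>m 0 w\<^sub>m\<^sub>+\<^sub>1\<close>.\<close>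

definition D_word :: "step list list \<Rightarrow> step list" where
  "D_word ws = Up # concat (map (\<lambda>u. u @ [Down]) (butlast ws)) @ last ws"

text \<open>Generating functions are power series in \<open>t\<close> whose coefficients are polynomials in \<open>x\<close>.\<close>

definition I_bar :: "nat \<Rightarrow> rat poly fps" where
  "I_bar m = Abs_fps (\<lambda>n. if n = 0 then 0
     else \<Sum>(v, w)\<in>tamari_intervals m n. monom 1 (final_descent w))"

definition J_bar :: "nat \<Rightarrow> nat \<Rightarrow> rat poly fps" where
  "J_bar m i = Abs_fps (\<lambda>n. if n = 0 then 0
     else \<Sum>(v, w)\<in>{(v, w) \<in> tamari_intervals m n.
              \<exists>vs. length vs = i \<and> (\<forall>u\<in>set vs. is_dyck m u) \<and>
                   v = D_word (vs @ replicate (m + 1 - i) [])}.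
            monom 1 (final_descent w))"

definition at_x_1 :: "rat poly fps \<Rightarrow> rat fps" where
  "at_x_1 F = Abs_fps (\<lambda>n. poly (F $ n) 1)"

text \<open>Division by \<open>x\<close>, by \<open>U - 1\<close> and by \<open>U - 1 + Z\<close> takes place in \<open>\<rat>(x)[[t]]\<close>, where
  these elements are units once \<open>U\<close> has constant term \<open>x\<close>; \<open>\<rat>[[t]]\<close> and \<open>\<rat>[x][[t]]\<close> are
  embedded in it coefficientwise. In \<open>U_eqn\<close> the quotient \<open>(u ^ (m + 1) - 1) / (u - 1)\<close> is exact
  for every \<open>u \<noteq> 1\<close>, and \<open>U = 1\<close>, where it becomes \<open>0 / 0 = 0\<close>, is not a solution.\<close>

type_synonym ratfun_fps = "rat poly fract fps"

definition emb_poly :: "rat poly fps \<Rightarrow> ratfun_fps" where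
  "emb_poly F = Abs_fps (\<lambda>n. to_fract (F $ n))"

definition emb_rat :: "rat fps \<Rightarrow> ratfun_fps" where
  "emb_rat F = Abs_fps (\<lambda>n. to_fract [:F $ n:])"

definition var_x :: ratfun_fps where
  "var_x = fps_const (to_fract [:0, 1:])"

definition Z_eqn :: "nat \<Rightarrow> rat fps \<Rightarrow> bool" where
  "Z_eqn m Z \<longleftrightarrow> Z $ 0 = 0 \<and> fps_X = Z * (1 - Z) ^ (m\<^sup>2 + 2 * m)"

definition U_eqn :: "nat \<Rightarrow> rat fps \<Rightarrow> rat poly fps \<Rightarrow> bool" where
  "U_eqn m Z U \<longleftrightarrow> (let z = emb_rat Z; u = emb_poly U in
     var_x = u / (1 - z) ^ (m + 2) * (1 - z * ((u ^ (m + 1) - 1) / (u - 1))))"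

text \<open>The polynomials \<open>H\<^sub>i(z; u)\<close>, \<open>0 \<le> i \<le> m + 1\<close>, evaluated in a commutative ring.
  For \<open>i\<close> and the summation indices in these ranges, no subtraction of naturals truncates.\<close>

definition H_poly :: "nat \<Rightarrow> nat \<Rightarrow> 'a::comm_ring_1 \<Rightarrow> 'a \<Rightarrow> 'a" where
  "H_poly m i z u =
     (if i = m + 1 then
        u ^ (m + 2) * (1 - z * (\<Sum>e=0..m. u ^ e * of_nat (m + 1 - e)))
      else
        u ^ (i + 1) *
          (1 + (\<Sum>k=1..i + 1. (- z) ^ k * of_nat ((i + 1) choose k) *
                  (\<Sum>e=0..m - i. of_nat ((e + k - 1) choose e) * u ^ e))
             + (\<Sum>k=1..i. (- z) ^ k * of_nat ((m + k - i - 1) choose (k - 1)) *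
                  (\<Sum>e=0..i - k. of_nat ((e + k) choose e) * u ^ (m + 1 - k - e)))))"

end

theory Submission
  imports Defs
begin

text \<open>Let \<open>[v, w]\<close> be an interval with \<open>v = D(v\<^sub>1, \<dots>, v\<^sub>i, \<emptyset>, \<dots>, \<emptyset>)\<close> and \<open>v\<^sub>i\<close> nonempty, put
  \<open>r = m + 1 - i\<close>, and let \<open>q\<close> be the last prime factor of \<open>v\<^sub>i\<close>, so that \<open>v = a q 0\<^sup>r\<close>. Then
  \<open>w = c p 0\<^sup>h\<close> with \<open>q \<le> p\<close>, \<open>a 0\<^sup>r \<le> c 0\<^sup>h\<close> and \<open>h \<ge> r\<close>, and every such choice occurs. Since prime
  paths are the \<open>D(v\<^sub>1, \<dots>, v\<^sub>m, \<emptyset>)\<close>, summing over \<open>r \<le> h \<le> d(c 0\<^sup>h)\<close> gives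
  \<open>(x - 1)(J\<^sub>i - J\<^sub>i\<^sub>-\<^sub>1) = J\<^sub>m (x J\<^sub>i - x\<^sup>r J\<^sub>i(1))\<close>, which with \<open>J\<^sub>0 = t x\<^sup>m\<close> determines all \<open>J\<^sub>i\<close>.
  At \<open>x = 1\<close> the series \<open>U\<close> becomes \<open>1 - Z\<close>, and the claimed solution satisfies the system because
  of the identity \<open>(u - 1) H\<^sub>i = u (u - 1 + z) H\<^sub>i\<^sub>-\<^sub>1 - z u\<^sup>m\<^sup>+\<^sup>2 H\<^sub>i\<^sub>-\<^sub>1(1)\<close>, whose value at \<open>u = 1 - z\<close> gives
  \<open>J\<^sub>i(1)\<close>. Lagrange inversion extracts the number of intervals.\<close>

section \<open>Prime paths and the Tamari order\<close>

text \<open>The equations involve \<open>J_i(1)\<close> besides \<open>J_i(x)\<close>, so they are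
  verified for a candidate rather than solved. This suffices because all constant terms in
  \<open>t\<close> vanish: the coefficient of \<open>t^n\<close> in the product on the right
  involves only smaller degrees. The obstacle is that setting \<open>x = 1\<close> needs polynomial
  coefficients, while the claimed formulas divide by \<open>x\<close> and by
  \<open>U - 1 + Z\<close>. The remedy is \<open>Y = U / (x (1 - Z)^(m+2))\<close>, which still has
  polynomial coefficients: with \<open>h_i = H_i / u^(i+1)\<close> the candidate becomes
  \<open>t x^m Y^(i+1) h_i\<close>, and the equation of \<open>U\<close> becomes
  \<open>Y h_0 = 1\<close>. A closed form of \<open>h_m\<close>, from the binomial theorem, then
  replaces the factor \<open>J_m\<close> and makes the equation for \<open>J_i\<close> linear. On
  the combinatorial side, Downs cross the inserted factor to the right but never back, so
  \<open>h\<close> is the only datum about \<open>w\<close> beyond the two smaller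
  intervals.\<close>

lemma height_Nil [simp]: "height m [] = 0"
  and height_append [simp]: "height m (a @ b) = height m a + height m b"
  and height_Up [simp]: "height m (Up # w) = int m + height m w"
  and height_Down [simp]: "height m (Down # w) = height m w - 1"
  by (auto simp: height_def algebra_simps)

lemma height_replicate_Down [simp]: "height m (replicate k Down) = - int k"
  by (induction k) auto

lemma is_dyck_iff:
  "is_dyck m w \<longleftrightarrow> height m w = 0 \<and> (\<forall>p s. w = p @ s \<longrightarrow> 0 \<le> height m p)"
proof -
  have "(\<forall>k\<le>length w. 0 \<le> height m (take k w)) \<longleftrightarrow> (\<forall>p s. w = p @ s \<longrightarrow> 0 \<le> height m p)"
    by (metis append_eq_conv_conj append_take_drop_id le_add1 length_append)
  moreover have "height m w = 0 \<longleftrightarrow> count_list w Down = m * count_list w Up"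
    unfolding height_def by (metis diff_eq_eq add_0 of_nat_mult of_nat_eq_iff)
  ultimately show ?thesis
    unfolding is_dyck_def dyck_paths_def by auto
qed

lemma dyck_paths_eq: "dyck_paths m n = {w. is_dyck m w \<and> count_list w Up = n}"
  unfolding is_dyck_def dyck_paths_def by auto

lemma is_dyckD: "is_dyck m w \<Longrightarrow> height m w = 0" "is_dyck m (p @ s) \<Longrightarrow> 0 \<le> height m p"
  by (auto simp: is_dyck_iff)

lemma is_dyck_Nil [simp]: "is_dyck m []"
  by (simp add: is_dyck_iff)

text \<open>A path that returns to height 0 only at its end. Positivity on proper prefixes already
  forces the Dyck property, and the condition concerns the factor alone, not what follows it as in
  \<open>shortest_dyck_prefix\<close>.\<close>

definition prime_dyck :: "nat \<Rightarrow> step list \<Rightarrow> bool" where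
  "prime_dyck m w \<longleftrightarrow> w \<noteq> [] \<and> height m w = 0 \<and>
     (\<forall>p s. w = p @ s \<longrightarrow> p \<noteq> [] \<longrightarrow> s \<noteq> [] \<longrightarrow> 0 < height m p)"

lemma prime_dyckD:
  assumes "prime_dyck m w"
  shows "w \<noteq> []" "height m w = 0" "\<And>p s. w = p @ s \<Longrightarrow> p \<noteq> [] \<Longrightarrow> s \<noteq> [] \<Longrightarrow> 0 < height m p"
  using assms unfolding prime_dyck_def by blast+

lemma prime_dyck_is_dyck: "prime_dyck m w \<Longrightarrow> is_dyck m w"
  unfolding is_dyck_iff prime_dyck_def
  by (metis append_self_conv height_Nil order.refl less_imp_le)

lemma prime_dyck_Cons:
  assumes "prime_dyck m s"
  obtains c where "s = Up # c"
proof (cases s)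
  case Nil
  then show ?thesis using assms by (simp add: prime_dyck_def)
next
  case (Cons x c)
  have "x \<noteq> Down"
  proof
    assume "x = Down"
    then have "0 \<le> height m [Down]"
      using is_dyckD(2)[of m "[Down]" c] prime_dyck_is_dyck[OF assms] Cons by simp
    then show False by simp
  qed
  then show ?thesis using that Cons by (cases x) auto
qed

lemma not_prime_prefix_Downs: "prime_dyck m s \<Longrightarrow> replicate h Down \<noteq> a @ s @ b"
proof
  assume "prime_dyck m s" and eq: "replicate h Down = a @ s @ b"
  then obtain c where "s = Up # c" by (elim prime_dyck_Cons)
  then have "Up \<in> set (replicate h Down)" using eq by simp
  then show False by simp
qed

text \<open>Otherwise the longer path would have the shorter as a proper prefix, of height 0 instead
  of positive. For suffixes the sign is reversed: a proper suffix of a prime path has negative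
  height.\<close>

lemma prime_dyck_prefix_unique:
  assumes "prime_dyck m s" "prime_dyck m p" "s @ b = p @ c"
  shows "s = p"
proof -
  have aux: "d = []" if "prime_dyck m p'" "prime_dyck m s'" "p' = s' @ d" for p' s' d
    using prime_dyckD(3)[OF that(1,3)] prime_dyckD(1,2)[OF that(2)] by auto
  from assms(3) consider d where "s = p @ d" | d where "p = s @ d"
    by (auto simp: append_eq_append_conv2)
  then show ?thesis
  proof cases
    case 1
    then show ?thesis using aux[OF assms(1,2)] by blast
  next
    case 2
    then show ?thesis using aux[OF assms(2,1)] by blast
  qed
qed

lemma prime_dyck_suffix_unique:
  assumes "prime_dyck m s" "prime_dyck m p" "b @ s = c @ p"
  shows "s = p" "b = c"
proof -
  have aux: "d = []" if "prime_dyck m p'" "prime_dyck m s'" "p' = d @ s'" for p' s' d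
    using prime_dyckD(3)[OF that(1,3)] prime_dyckD(1,2)[OF that(2)] prime_dyckD(2)[OF that(1)] that(3) by auto
  from assms(3) consider d where "s = d @ p" | d where "p = d @ s"
    by (auto simp: append_eq_append_conv2)
  then show "s = p"
  proof cases
    case 1
    then show ?thesis using aux[OF assms(1,2)] by auto
  next
    case 2
    then show ?thesis using aux[OF assms(2,1)] by auto
  qed
  then show "b = c" using assms(3) by simp
qed

text \<open>A shortest non-empty Dyck prefix cannot touch height 0 earlier, for the part up to that
  point would be a shorter one; a Dyck prefix shorter than \<open>s\<close> would conversely give
  such a point.\<close>

lemma shortest_dyck_prefix_iff:
  "shortest_dyck_prefix m s c \<longleftrightarrow> prime_dyck m s \<and> (\<exists>b. c = s @ b)"
proof
  assume sh: "shortest_dyck_prefix m s c"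
  then obtain b where b: "c = s @ b" and s: "s \<noteq> []" "is_dyck m s"
    and min: "\<And>p b. c = p @ b \<Longrightarrow> p \<noteq> [] \<Longrightarrow> is_dyck m p \<Longrightarrow> length s \<le> length p"
    unfolding shortest_dyck_prefix_def by blast
  have "0 < height m p" if p: "s = p @ d" "p \<noteq> []" "d \<noteq> []" for p d
  proof -
    have "0 \<le> height m p" using s p by (auto intro: is_dyckD)
    moreover have "height m p \<noteq> 0"
    proof
      assume "height m p = 0"
      then have "is_dyck m p" using s(2) p(1) by (auto simp: is_dyck_iff)
      then have "length s \<le> length p" using min[of p "d @ b"] b p by simp
      then show False using p by simp
    qed
    ultimately show ?thesis by simp
  qed
  then show "prime_dyck m s \<and> (\<exists>b. c = s @ b)"
    using s b by (auto simp: prime_dyck_def is_dyckD)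
next
  assume "prime_dyck m s \<and> (\<exists>b. c = s @ b)"
  then obtain b where s: "prime_dyck m s" and b: "c = s @ b" by blast
  have "length s \<le> length p" if p: "c = p @ d" "p \<noteq> []" "is_dyck m p" for p d
  proof (rule ccontr)
    assume "\<not> length s \<le> length p"
    then obtain e where "s = p @ e" "e \<noteq> []"
      using b p(1) by (auto simp: append_eq_append_conv2)
    then have "0 < height m p" using prime_dyckD(3)[OF s] p by blast
    then show False using p by (simp add: is_dyckD)
  qed
  then show "shortest_dyck_prefix m s c"
    unfolding shortest_dyck_prefix_def using s b prime_dyck_is_dyck prime_dyckD(1) by blast
qed

text \<open>The valley condition is absorbed, since a prime path starts with
  \<open>Up\<close>.\<close>

lemma tamari_cover_iff:
  "tamari_cover m w w' \<longleftrightarrow> is_dyck m w \<and>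
     (\<exists>a s b. w = a @ [Down] @ s @ b \<and> prime_dyck m s \<and> w' = a @ s @ [Down] @ b)"
  unfolding tamari_cover_def shortest_dyck_prefix_iff
  by (metis append_Cons prime_dyck_Cons)

lemma height_ge_take_Suc: "height m (take k s) - 1 \<le> height m (take (Suc k) s)"
proof (cases "k < length s")
  case True
  then show ?thesis by (cases "s ! k") (auto simp: take_Suc_conv_app_nth)
qed auto

text \<open>A cover raises the path weakly at every position; this is why the Dyck property,
  primality and later stems persist upwards.\<close>

lemma tamari_cover_height_take:
  assumes "tamari_cover m w w'"
  shows "height m (take k w) \<le> height m (take k w')"
proof -
  obtain a s b where w: "w = a @ [Down] @ s @ b" "w' = a @ s @ [Down] @ b"
    using assms unfolding tamari_cover_iff by blast
  consider "k \<le> length a" | j where "k = length a + Suc j" "j < length s"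
    | j where "k = length a + length s + Suc j"
    by (metis add.commute less_Suc_eq_le not_less_eq less_natE add_Suc_right group_cancel.add1 linorder_not_le less_iff_Suc_add add_less_cancel_left)
  then show ?thesis
  proof cases
    \<comment> \<open>At equal length the upper path has read one more letter of \<open>s\<close> in
      place of the \<open>Down\<close>, and a letter lowers the height by at most 1.\<close>
    case 2
    then show ?thesis using w height_ge_take_Suc[of m j s] by simp
  qed (auto simp: w)
qed

lemma tamari_cover_count:
  assumes "tamari_cover m w w'"
  shows "count_list w' c = count_list w c" "length w' = length w"
  using assms unfolding tamari_cover_iff by auto

lemma is_dyck_take: "is_dyck m w \<longleftrightarrow> height m w = 0 \<and> (\<forall>k. 0 \<le> height m (take k w))"
  unfolding is_dyck_iff by (metis append_eq_conv_conj append_take_drop_id)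

lemma tamari_cover_height: "tamari_cover m w w' \<Longrightarrow> height m w' = height m w"
  by (simp add: height_def tamari_cover_count)

lemma tamari_cover_is_dyck:
  assumes "tamari_cover m w w'"
  shows "is_dyck m w" "is_dyck m w'"
proof -
  show "is_dyck m w" using assms by (simp add: tamari_cover_iff)
  then show "is_dyck m w'"
    unfolding is_dyck_take using tamari_cover_height_take[OF assms] tamari_cover_height[OF assms]
    by (metis order_trans)
qed

lemma prime_dyck_take:
  "prime_dyck m w \<longleftrightarrow> w \<noteq> [] \<and> height m w = 0 \<and> (\<forall>k. 0 < k \<longrightarrow> k < length w \<longrightarrow> 0 < height m (take k w))"
proof -
  have "(\<forall>p s. w = p @ s \<longrightarrow> p \<noteq> [] \<longrightarrow> s \<noteq> [] \<longrightarrow> 0 < height m p) \<longleftrightarrow>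
        (\<forall>k. 0 < k \<longrightarrow> k < length w \<longrightarrow> 0 < height m (take k w))" (is "?L = ?R")
  proof
    assume ?L
    show ?R
    proof (intro allI impI)
      fix k assume "0 < k" "k < length w"
      moreover from this have "take k w \<noteq> []" by auto
      ultimately show "0 < height m (take k w)"
        using \<open>?L\<close>[rule_format, of "take k w" "drop k w"] by auto
    qed
  next
    assume ?R
    show ?L
    proof (intro allI impI)
      fix p s assume "w = p @ s" "p \<noteq> []" "s \<noteq> []"
      then show "0 < height m p" using \<open>?R\<close>[rule_format, of "length p"] by auto
    qed
  qed
  then show ?thesis unfolding prime_dyck_def by simp
qed

lemma tamari_cover_prime:
  assumes "tamari_cover m w w'" "prime_dyck m w"
  shows "prime_dyck m w'"
proof -
  have "length w' = length w" "height m w' = height m w"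
    using tamari_cover_count[OF assms(1)] tamari_cover_height[OF assms(1)] by auto
  then show ?thesis
    using assms(2) tamari_cover_height_take[OF assms(1)] unfolding prime_dyck_take
    by (metis length_0_conv less_le_trans)
qed

section \<open>The generated order and its invariants\<close>

lemma tamari_le_refl [simp]: "tamari_le m w w"
  by (simp add: tamari_le_def)

lemma tamari_le_step: "tamari_le m u v \<Longrightarrow> tamari_cover m v w \<Longrightarrow> tamari_le m u w"
  by (simp add: tamari_le_def)

lemma tamari_le_trans: "tamari_le m u v \<Longrightarrow> tamari_le m v w \<Longrightarrow> tamari_le m u w"
  by (simp add: tamari_le_def)

lemma tamari_cover_le: "tamari_cover m u v \<Longrightarrow> tamari_le m u v"
  by (simp add: tamari_le_def)

lemma tamari_le_induct [consumes 1, case_names refl step]: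
  assumes "tamari_le m v w" "P v" "\<And>u w. tamari_le m v u \<Longrightarrow> tamari_cover m u w \<Longrightarrow> P u \<Longrightarrow> P w"
  shows "P w"
  using assms unfolding tamari_le_def by (rule rtranclp_induct)

lemma tamari_le_is_dyck: "tamari_le m v w \<Longrightarrow> is_dyck m v \<Longrightarrow> is_dyck m w"
  by (induction rule: tamari_le_induct) (auto dest: tamari_cover_is_dyck)

lemma tamari_le_prime: "tamari_le m v w \<Longrightarrow> prime_dyck m v \<Longrightarrow> prime_dyck m w"
  by (induction rule: tamari_le_induct) (auto dest: tamari_cover_prime)

lemma tamari_le_count: "tamari_le m v w \<Longrightarrow> count_list w c = count_list v c"
  by (induction rule: tamari_le_induct) (auto simp: tamari_cover_count(1))

text \<open>A Dyck factor starts and ends on one level and stays weakly above it, so the heights of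
  all other prefixes are unaffected.\<close>

lemma is_dyck_insert:
  assumes "is_dyck m p"
  shows "is_dyck m (a @ p @ b) \<longleftrightarrow> is_dyck m (a @ b)"
proof
  assume "is_dyck m (a @ b)"
  show "is_dyck m (a @ p @ b)"
    unfolding is_dyck_iff
  proof (intro conjI allI impI)
    show "height m (a @ p @ b) = 0"
      using is_dyckD(1)[OF assms] is_dyckD(1)[OF \<open>is_dyck m (a @ b)\<close>] by simp
    fix r s assume "a @ p @ b = r @ s"
    then consider d where "a = r @ d" | d e where "r = a @ d" "p = d @ e" | d e where "r = a @ p @ d" "b = d @ e"
      by (auto simp: append_eq_append_conv2)
    then show "0 \<le> height m r"
    proof cases
      case 1
      then show ?thesis using \<open>is_dyck m (a @ b)\<close> is_dyckD(2)[of m r "d @ b"] by simp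
    next
      case 2
      then show ?thesis using is_dyckD(2)[of m a b] is_dyckD(2)[of m d e] assms \<open>is_dyck m (a @ b)\<close> by simp
    next
      case 3
      then show ?thesis using is_dyckD(2)[of m "a @ d" e] is_dyckD(1)[of m p] assms \<open>is_dyck m (a @ b)\<close> by simp
    qed
  qed
next
  assume *: "is_dyck m (a @ p @ b)"
  show "is_dyck m (a @ b)"
    unfolding is_dyck_iff
  proof (intro conjI allI impI)
    show "height m (a @ b) = 0"
      using is_dyckD(1)[OF assms] is_dyckD(1)[OF *] by simp
    fix r s assume "a @ b = r @ s"
    then consider d where "a = r @ d" | d e where "r = a @ d" "b = d @ e"
      by (auto simp: append_eq_append_conv2)
    then show "0 \<le> height m r"
    proof cases
      case 1
      then show ?thesis using * is_dyckD(2)[of m r "d @ p @ b"] by simp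
    next
      case 2
      then show ?thesis using is_dyckD(2)[of m "a @ p @ d" e] is_dyckD(1)[of m p] assms * by simp
    qed
  qed
qed

lemma tamari_cover_congruence:
  assumes "tamari_cover m p p'" "is_dyck m (a @ p @ b)"
  shows "tamari_cover m (a @ p @ b) (a @ p' @ b)"
proof -
  obtain c s d where "p = c @ [Down] @ s @ d" "prime_dyck m s" "p' = c @ s @ [Down] @ d"
    using assms(1) unfolding tamari_cover_iff by blast
  then have "a @ p @ b = (a @ c) @ [Down] @ s @ (d @ b)" "prime_dyck m s"
    "a @ p' @ b = (a @ c) @ s @ [Down] @ (d @ b)" by simp_all
  then show ?thesis using assms(2) unfolding tamari_cover_iff by blast
qed

lemma tamari_le_congruence:
  assumes "tamari_le m p p'" "is_dyck m p" "is_dyck m (a @ b)"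
  shows "tamari_le m (a @ p @ b) (a @ p' @ b)"
  using assms(1)
proof (induction rule: tamari_le_induct)
  case (step u w)
  have "is_dyck m (a @ u @ b)"
    using is_dyck_insert assms(2,3) tamari_le_is_dyck step.hyps(1) by blast
  then show ?case using step tamari_cover_congruence tamari_le_step by blast
qed simp

text \<open>For \<open>r \<le> m\<close> these are the words \<open>D_word [v1, ..., vi]\<close>
  with \<open>i = m + 1 - r\<close> Dyck components (\<open>stem_D_word\<close>,
  \<open>stem_D_word_ex\<close>). Stated through heights, the notion can be followed along covers
  without looking at the components.\<close>

definition stem :: "nat \<Rightarrow> nat \<Rightarrow> step list \<Rightarrow> bool" where
  "stem m r a \<longleftrightarrow> a \<noteq> [] \<and> height m a = int r \<and>
     (\<forall>p s. a = p @ s \<longrightarrow> p \<noteq> [] \<longrightarrow> int r \<le> height m p)"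

lemma stemD:
  assumes "stem m r a"
  shows "a \<noteq> []" "height m a = int r" "\<And>p s. a = p @ s \<Longrightarrow> p \<noteq> [] \<Longrightarrow> int r \<le> height m p"
  using assms unfolding stem_def by blast+

section \<open>Covers of paths that end with a run of Downs\<close>

lemma append_eq_appendE:
  assumes "a @ b = c @ d"
  obtains e where "e \<noteq> []" "a @ e = c" "b = e @ d" | e where "a = c @ e" "e @ b = d"
  using assms unfolding append_eq_append_conv2 by (metis append_Nil append_Nil2)

lemma height_prefix_Downs:
  assumes "replicate r Down = d @ e"
  shows "height m d = - int (length d)" "length d \<le> r"
proof -
  have "d = take (length d) (replicate r Down)" using assms by simp
  moreover show "length d \<le> r" using assms by (metis length_append length_replicate le_add1)
  ultimately show "height m d = - int (length d)"
    by (metis height_replicate_Down min.absorb1 take_replicate)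
qed

lemma stem_is_dyck:
  assumes "stem m r a"
  shows "is_dyck m (a @ replicate r Down)"
  unfolding is_dyck_iff
proof (intro conjI allI impI)
  show "height m (a @ replicate r Down) = 0" using stemD(2)[OF assms] by simp
  fix p s assume "a @ replicate r Down = p @ s"
  then consider d where "a = p @ d" | d e where "p = a @ d" "replicate r Down = d @ e"
    by (auto simp: append_eq_append_conv2)
  then show "0 \<le> height m p"
  proof cases
    case 1
    then show ?thesis using stemD(3)[OF assms 1] by (cases "p = []") auto
  next
    case 2
    then show ?thesis using stemD(2)[OF assms] height_prefix_Downs(1)[OF 2(2), of m] height_prefix_Downs(2)[OF 2(2)] by simp
  qed
qed

text \<open>The swap takes place inside \<open>a\<close>. Its prime factor begins with
  \<open>Up\<close>, hence not among the final Downs, and cannot reach into them: it starts at a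
  height of at least \<open>r\<close> and stays above its start, whereas \<open>a\<close> ends at
  height exactly \<open>r\<close>. So the same swap is available with any Dyck path put between
  \<open>a\<close> and the final Downs.\<close>

lemma stem_cover_lift:
  assumes "stem m r a" "tamari_cover m (a @ replicate r Down) u"
  shows "\<exists>a'. stem m r a' \<and> u = a' @ replicate r Down \<and>
    (\<forall>p. is_dyck m p \<longrightarrow> tamari_cover m (a @ p @ replicate r Down) (a' @ p @ replicate r Down))"
proof -
  let ?z = "replicate r Down"
  obtain c s b where eq: "a @ ?z = c @ [Down] @ s @ b" and s: "prime_dyck m s"
    and u: "u = c @ s @ [Down] @ b"
    using assms(2) unfolding tamari_cover_iff by blast
  have "\<nexists>d. a @ d = c @ [Down]"
  proof
    assume "\<exists>d. a @ d = c @ [Down]"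
    then obtain d where "c @ [Down] = a @ d" by metis
    then have "a @ ?z = a @ d @ s @ b" using eq by (metis append_assoc)
    then have "?z = d @ s @ b" by simp
    then show False using not_prime_prefix_Downs[OF s] by blast
  qed
  moreover have "a @ ?z = (c @ [Down]) @ (s @ b)" using eq by simp
  ultimately obtain a2 where "a = (c @ [Down]) @ a2" "a2 @ ?z = s @ b"
    unfolding append_eq_append_conv2[of a ?z "c @ [Down]" "s @ b"] by blast
  then have a: "a = c @ [Down] @ a2" "a2 @ ?z = s @ b" by simp_all
  have "\<exists>d. a2 = s @ d"
  proof (rule ccontr)
    assume "\<nexists>d. a2 = s @ d"
    then obtain d where d: "s = a2 @ d" "?z = d @ b" 
      using a(2) unfolding append_eq_append_conv2 by auto
    have "a2 \<noteq> []"
      using not_prime_prefix_Downs[OF s, of r "[]" b] a(2) by auto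
    moreover have "d \<noteq> []" using \<open>\<nexists>d. a2 = s @ d\<close> d(1) by auto
    ultimately have "0 < height m a2" using prime_dyckD(3)[OF s d(1)] by simp
    moreover have "int r \<le> height m (c @ [Down])" using stemD(3)[OF assms(1), of "c @ [Down]" a2] a(1) by simp
    ultimately show False using stemD(2)[OF assms(1)] a(1) by simp
  qed
  then obtain d where d: "a2 = s @ d" "b = d @ ?z" using a(2) by auto
  let ?a' = "c @ s @ [Down] @ d"
  have u': "u = ?a' @ ?z" using u d by simp
  have len: "length ?a' = length a" using a d by simp
  have "stem m r ?a'"
    unfolding stem_def
  proof (intro conjI allI impI)
    show "height m ?a' = int r" using stemD(2)[OF assms(1)] a d by simp
    fix p' s' assume p': "?a' = p' @ s'" "p' \<noteq> []"
    let ?k = "length p'"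
    have "?k \<le> length a" using len p' by (metis length_append le_add1)
    then have "take ?k (a @ ?z) = take ?k a" by simp
    moreover have "take ?k u = p'" unfolding u' p'(1) by simp
    ultimately have "height m (take ?k a) \<le> height m p'"
      using tamari_cover_height_take[OF assms(2), of ?k] by simp
    moreover have "take ?k a \<noteq> []" using p'(2) stemD(1)[OF assms(1)] by simp
    then have "int r \<le> height m (take ?k a)"
      using stemD(3)[OF assms(1), of "take ?k a" "drop ?k a"] by simp
    ultimately show "int r \<le> height m p'" by simp
  qed simp
  moreover have "tamari_cover m (a @ p @ ?z) (?a' @ p @ ?z)" if "is_dyck m p" for p
    unfolding tamari_cover_iff
  proof (intro conjI exI)
    show "is_dyck m (a @ p @ ?z)"
      using is_dyck_insert that stem_is_dyck[OF assms(1)] by blast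
    show "a @ p @ ?z = c @ [Down] @ s @ (d @ p @ ?z)" using a d by simp
  qed (use s in auto)
  ultimately show ?thesis using u' by blast
qed

lemma stem_le_lift:
  assumes "tamari_le m (a @ replicate r Down) w" "stem m r a" "is_dyck m p"
  shows "\<exists>c. stem m r c \<and> w = c @ replicate r Down \<and>
    tamari_le m (a @ p @ replicate r Down) (c @ p @ replicate r Down)"
  using assms(1)
proof (induction rule: tamari_le_induct)
  case refl
  then show ?case using assms(2) by auto
next
  case (step u w)
  then obtain c where c: "stem m r c" "u = c @ replicate r Down"
    "tamari_le m (a @ p @ replicate r Down) (c @ p @ replicate r Down)" by blast
  then show ?case
    using stem_cover_lift[OF c(1), of w] step.hyps(2) assms(3) tamari_le_step by blast
qed

text \<open>Each of the \<open>k\<close> Downs in front of \<open>p\<close> crosses it in one cover,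
  the last one first; \<open>r\<close> grows along the induction.\<close>

lemma tamari_le_move_Downs:
  assumes "prime_dyck m p" "is_dyck m (c @ replicate (k + r) Down)"
  shows "tamari_le m (c @ replicate k Down @ p @ replicate r Down) (c @ p @ replicate (k + r) Down)"
  using assms(2)
proof (induction k arbitrary: r)
  case (Suc k)
  have rep: "replicate (Suc k) Down = replicate k Down @ [Down]"
    by (simp add: replicate_append_same)
  have "is_dyck m (c @ replicate (Suc k) Down @ replicate r Down)"
    using Suc.prems by (simp add: replicate_add)
  then have "is_dyck m (c @ replicate (Suc k) Down @ p @ replicate r Down)"
    using is_dyck_insert[OF prime_dyck_is_dyck[OF assms(1)], of "c @ replicate (Suc k) Down" "replicate r Down"] by simp
  moreover have "c @ replicate (Suc k) Down @ p @ replicate r Down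
      = (c @ replicate k Down) @ [Down] @ p @ replicate r Down" unfolding rep by simp
  moreover have "(c @ replicate k Down) @ p @ [Down] @ replicate r Down
      = c @ replicate k Down @ p @ replicate (Suc r) Down" by simp
  ultimately have "tamari_cover m (c @ replicate (Suc k) Down @ p @ replicate r Down)
     (c @ replicate k Down @ p @ replicate (Suc r) Down)"
    unfolding tamari_cover_iff using assms(1) by metis
  moreover have "tamari_le m (c @ replicate k Down @ p @ replicate (Suc r) Down) (c @ p @ replicate (k + Suc r) Down)"
    by (rule Suc.IH) (use Suc.prems in simp)
  ultimately show ?case using tamari_cover_le tamari_le_trans by fastforce
qed simp

text \<open>Deleting \<open>p\<close> from both sides of a cover leaves a cover or an equality, and
  \<open>p\<close> itself stays or is covered, according to the place of the valley and the extent
  of its prime factor. At most one \<open>Down\<close> joins the final run.\<close>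

lemma cover_project:
  assumes "tamari_cover m (c @ p @ replicate h Down) u" "prime_dyck m p"
  shows "\<exists>c' p' h'. u = c' @ p' @ replicate h' Down \<and> h \<le> h' \<and> tamari_le m p p' \<and>
    tamari_le m (c @ replicate h Down) (c' @ replicate h' Down)"
proof -
  let ?z = "replicate h Down"
  obtain a s b where eq: "c @ p @ ?z = a @ [Down] @ s @ b" and s: "prime_dyck m s"
    and u: "u = a @ s @ [Down] @ b" and dy: "is_dyck m (c @ p @ ?z)"
    using assms(1) unfolding tamari_cover_iff by blast
  have pd: "is_dyck m p" using assms(2) by (rule prime_dyck_is_dyck)
  have dy': "is_dyck m (c @ ?z)" using dy is_dyck_insert[OF pd] by blast
  have eq': "c @ (p @ ?z) = (a @ [Down]) @ (s @ b)" using eq by simp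
  consider d where "c = a @ [Down] @ d" "d @ p @ ?z = s @ b"
    | d where "c @ d = a @ [Down]" "d \<noteq> []" "p @ ?z = d @ s @ b"
    by (rule append_eq_appendE[OF eq']) simp_all
  then show ?thesis
  proof cases
    case 1
    note c = this(1)
    consider e where "d = s @ e" "b = e @ p @ ?z"
      | e where "d \<noteq> []" "d @ e = s" "e \<noteq> []" "p @ ?z = e @ b" | "d = []" "p @ ?z = s @ b"
      by (cases "d = []"; rule append_eq_appendE[OF 1(2)]) simp_all
    then show ?thesis
    proof cases
      case (1 e)
      have "tamari_cover m (c @ ?z) ((a @ s @ [Down] @ e) @ ?z)"
        unfolding tamari_cover_iff
      proof (intro conjI exI)
        show "c @ ?z = a @ [Down] @ s @ (e @ ?z)" using c 1 by simp
      qed (use s dy' in auto)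
      then show ?thesis using u 1 tamari_cover_le by (intro exI[of _ "a @ s @ [Down] @ e"] exI[of _ p] exI[of _ h]) auto
    next
      \<comment> \<open>The factor starts in \<open>c\<close>, contains all of \<open>p\<close> and
        ends among the final Downs: it cannot end inside \<open>p\<close>, being at positive height
        when \<open>p\<close> begins. Without \<open>p\<close> it is still prime, and the swapped
        \<open>Down\<close> joins the final run.\<close>
      case (2 e)
      have d0: "0 < height m d" using prime_dyckD(3)[OF s 2(2)[symmetric] 2(1,3)] .
      have "\<exists>f. e = p @ f"
      proof (rule ccontr)
        assume "\<nexists>f. e = p @ f"
        then obtain f where "p = e @ f" using 2(4) unfolding append_eq_append_conv2 by blast
        then have "0 \<le> height m e" using is_dyckD(2)[of m e f] pd by simp
        then show False using d0 prime_dyckD(2)[OF s] 2(2)[symmetric] by simp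
      qed
      then obtain f where f: "e = p @ f" "?z = f @ b" using 2(4) by auto
      have fr: "f = replicate (length f) Down" "b = replicate (length b) Down" "length f + length b = h"
        using f(2) by (metis append_eq_conv_conj drop_replicate length_append length_replicate take_replicate
            min.absorb1 le_add1 add_diff_cancel_left')+
      have fb: "f @ [Down] @ b = replicate (Suc h) Down"
        by (metis fr replicate_add replicate_Suc append_Cons append_Nil add_Suc_right)
      have "prime_dyck m (d @ f)"
        unfolding prime_dyck_def
      proof (intro conjI allI impI)
        show "d @ f \<noteq> []" using 2(1) by simp
        show "height m (d @ f) = 0" using prime_dyckD(2)[OF s] 2(2)[symmetric] f(1) is_dyckD(1)[OF pd] by simp
        fix p1 s1 assume h1: "d @ f = p1 @ s1" "p1 \<noteq> []" "s1 \<noteq> []"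
        from h1(1) consider g where "d = p1 @ g" | g where "p1 = d @ g" "f = g @ s1"
          by (auto simp: append_eq_append_conv2)
        then show "0 < height m p1"
        proof cases
          case 1
          then show ?thesis using prime_dyckD(3)[OF s, of p1 "g @ e"] 2(2,3) h1 by simp
        next
          case 2
          then show ?thesis using prime_dyckD(3)[OF s, of "d @ p @ g" s1] \<open>d @ e = s\<close>[symmetric] f h1 is_dyckD(1)[OF pd] \<open>d \<noteq> []\<close> by simp
        qed
      qed
      moreover have "c @ ?z = a @ [Down] @ (d @ f) @ b" using c f by simp
      ultimately have "tamari_cover m (c @ ?z) (a @ (d @ f) @ [Down] @ b)"
        unfolding tamari_cover_iff using dy' by blast
      moreover have "a @ (d @ f) @ [Down] @ b = (a @ d) @ replicate (Suc h) Down" using fb by simp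
      ultimately have "tamari_le m (c @ ?z) ((a @ d) @ replicate (Suc h) Down)"
        using tamari_cover_le by metis
      moreover have "u = (a @ d) @ p @ replicate (Suc h) Down"
        using u fb 2(2)[symmetric] f(1) by simp
      ultimately show ?thesis
        by (intro exI[of _ "a @ d"] exI[of _ p] exI[of _ "Suc h"]) auto
    next
      \<comment> \<open>The factor is \<open>p\<close> itself: a \<open>Down\<close> crosses it, and
        deleting \<open>p\<close> leaves the path unchanged.\<close>
      case 3
      then have "p = s" "b = ?z" using prime_dyck_prefix_unique[OF assms(2) s] by auto
      then have "u = a @ p @ replicate (Suc h) Down" "c @ ?z = a @ replicate (Suc h) Down"
        using u c 3 by auto
      then show ?thesis
        by (intro exI[of _ a] exI[of _ p] exI[of _ "Suc h"]) auto
    qed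
  next
    \<comment> \<open>The valley lies in \<open>p\<close>. What remains of \<open>p\<close> after
      the \<open>Down\<close> of the valley has negative height, so the prime factor ends before
      \<open>p\<close> does.\<close>
    case (2 d)
    from 2(1,2) obtain a' where d: "d = a' @ [Down]" "a = c @ a'"
      by (metis append.assoc append_butlast_last_id append_same_eq last.simps last_appendR append1_eq_conv)
    have "\<nexists>e. d = p @ e"
    proof
      assume "\<exists>e. d = p @ e"
      then obtain e where "?z = e @ s @ b" using 2(3) by auto
      then show False using not_prime_prefix_Downs[OF s] by blast
    qed
    then obtain p2 where p2: "p = d @ p2" "p2 @ ?z = s @ b" "p2 \<noteq> []"
      by (metis append_Nil2 append_eq_appendE[OF 2(3)])
    have "0 < height m d" using prime_dyckD(3)[OF assms(2) p2(1) 2(2) p2(3)] .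
    then have "height m p2 < 0" using prime_dyckD(2)[OF assms(2)] p2(1) by simp
    have "\<exists>e. p2 = s @ e"
    proof (rule ccontr)
      assume "\<nexists>e. p2 = s @ e"
      then obtain e where "s = p2 @ e" using p2(2) unfolding append_eq_append_conv2 by blast
      then have "0 \<le> height m p2" using is_dyckD(2)[of m p2 e] prime_dyck_is_dyck[OF s] by simp
      then show False using \<open>height m p2 < 0\<close> by simp
    qed
    then obtain e where e: "p2 = s @ e" "b = e @ ?z" using p2(2) by auto
    have "tamari_cover m p (a' @ s @ [Down] @ e)"
      unfolding tamari_cover_iff
    proof (intro conjI exI)
      show "p = a' @ [Down] @ s @ e" using p2 d e by simp
    qed (use s pd in auto)
    moreover have "u = c @ (a' @ s @ [Down] @ e) @ ?z" using u d e by simp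
    ultimately show ?thesis
      using tamari_cover_le by (intro exI[of _ c] exI[of _ "a' @ s @ [Down] @ e"] exI[of _ h]) auto
  qed
qed

text \<open>From left to right, iterate \<open>cover_project\<close>. Conversely the target is
  reached in three stages: raise \<open>q\<close> to \<open>p\<close>, carry out the chain from
  \<open>a 0^r\<close> to \<open>c 0^h\<close> around \<open>p\<close>, then let the surplus Downs
  cross \<open>p\<close>.\<close>

lemma tamari_le_insert_iff:
  assumes "stem m r a" "prime_dyck m q"
  shows "tamari_le m (a @ q @ replicate r Down) w \<longleftrightarrow>
    (\<exists>c p h. w = c @ p @ replicate h Down \<and> r \<le> h \<and> tamari_le m q p \<and>
       tamari_le m (a @ replicate r Down) (c @ replicate h Down))" (is "?L \<longleftrightarrow> ?R w")
proof
  assume ?L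
  then show "?R w"
  proof (induction rule: tamari_le_induct)
    case refl
    show ?case by (intro exI[of _ a] exI[of _ q] exI[of _ r]) simp
  next
    case (step u w)
    then obtain c p h where u: "u = c @ p @ replicate h Down" "r \<le> h" "tamari_le m q p"
       "tamari_le m (a @ replicate r Down) (c @ replicate h Down)" by blast
    have "prime_dyck m p" using tamari_le_prime[OF u(3) assms(2)] .
    then obtain c' p' h' where "w = c' @ p' @ replicate h' Down \<and> h \<le> h' \<and> tamari_le m p p' \<and>
      tamari_le m (c @ replicate h Down) (c' @ replicate h' Down)"
      using cover_project[of m c p h w] step.hyps(2) u(1) by blast
    then show ?case using u tamari_le_trans order_trans by blast
  qed
next
  assume "?R w"
  then obtain c p h where w: "w = c @ p @ replicate h Down" and h: "r \<le> h" and qp: "tamari_le m q p"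
    and le: "tamari_le m (a @ replicate r Down) (c @ replicate h Down)" by blast
  have p: "prime_dyck m p" using tamari_le_prime[OF qp assms(2)] .
  have dy: "is_dyck m (a @ replicate r Down)" using stem_is_dyck[OF assms(1)] .
  obtain c' where c': "c @ replicate h Down = c' @ replicate r Down"
    "tamari_le m (a @ p @ replicate r Down) (c' @ p @ replicate r Down)"
    using stem_le_lift[OF le assms(1) prime_dyck_is_dyck[OF p]] by blast
  have rep: "replicate h Down = replicate (h - r) Down @ replicate r Down"
    using h by (metis le_add_diff_inverse2 replicate_add)
  \<comment> \<open>The lifted chain leaves only \<open>r\<close> Downs behind \<open>p\<close>; the
    other \<open>h - r\<close> still precede it.\<close>
  have "c' = c @ replicate (h - r) Down" using c'(1) unfolding rep by simp
  then have "tamari_le m (c' @ p @ replicate r Down) w"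
    using tamari_le_move_Downs[OF p, of c "h - r" r] tamari_le_is_dyck[OF le dy] w h by simp
  moreover have "tamari_le m (a @ q @ replicate r Down) (a @ p @ replicate r Down)"
    using tamari_le_congruence[OF qp prime_dyck_is_dyck[OF assms(2)] dy] .
  ultimately show ?L using c'(2) tamari_le_trans by blast
qed

section \<open>Paths with trailing empty components\<close>

definition truncated :: "nat \<Rightarrow> nat \<Rightarrow> step list \<Rightarrow> bool" where
  "truncated m i v \<longleftrightarrow> (\<exists>vs. length vs = i \<and> (\<forall>u\<in>set vs. is_dyck m u) \<and>
     v = D_word (vs @ replicate (m + 1 - i) []))"

lemma D_word_single: "D_word [x] = Up # x"
  by (simp add: D_word_def)

lemma D_word_snoc:
  assumes "ws \<noteq> []"
  shows "D_word (ws @ [x]) = D_word ws @ Down # x"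
proof -
  have "concat (map (\<lambda>u. u @ [Down]) ws) = concat (map (\<lambda>u. u @ [Down]) (butlast ws)) @ last ws @ [Down]"
    using assms by (induction ws rule: rev_induct) auto
  then show ?thesis by (simp add: D_word_def)
qed

lemma D_word_append_replicate:
  assumes "ws \<noteq> []"
  shows "D_word (ws @ replicate k []) = D_word ws @ replicate k Down"
proof (induction k)
  case (Suc k)
  have "ws @ replicate (Suc k) [] = (ws @ replicate k []) @ [[]]"
    by (simp add: replicate_append_same)
  then show ?case using assms Suc D_word_snoc[of "ws @ replicate k []" "[]"]
    by (simp add: replicate_append_same[symmetric] del: replicate_Suc) (simp add: replicate_append_same)
qed simp

lemma stem_append_dyck:
  assumes "stem m r a" "is_dyck m y"
  shows "stem m r (a @ y)"
  unfolding stem_def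
proof (intro conjI allI impI)
  show "a @ y \<noteq> []" "height m (a @ y) = int r"
    using stemD[OF assms(1)] is_dyckD(1)[OF assms(2)] by auto
  fix p s assume "a @ y = p @ s" "p \<noteq> []"
  then consider d where "a = p @ d" | d where "p = a @ d" "y = d @ s"
    by (auto simp: append_eq_append_conv2)
  then show "int r \<le> height m p"
    by cases (use stemD[OF assms(1)] is_dyckD(2) assms(2) \<open>p \<noteq> []\<close> in auto)
qed

lemma stem_append_Down:
  assumes "stem m (Suc r) a"
  shows "stem m r (a @ [Down])"
  unfolding stem_def
proof (intro conjI allI impI)
  show "a @ [Down] \<noteq> []" "height m (a @ [Down]) = int r"
    using stemD[OF assms(1)] by auto
  fix p s assume "a @ [Down] = p @ s" "p \<noteq> []"
  then consider d where "a = p @ d" | "p = a @ [Down]"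
    by (cases s rule: rev_cases) auto
  then show "int r \<le> height m p"
    by cases (use stemD[OF assms(1)] \<open>p \<noteq> []\<close> in fastforce)+
qed

lemma stem_D_word:
  assumes "vs \<noteq> []" "length vs \<le> m + 1" "\<forall>u\<in>set vs. is_dyck m u"
  shows "stem m (m + 1 - length vs) (D_word vs)"
  using assms
proof (induction vs rule: rev_induct)
  case (snoc y vs)
  show ?case
  proof (cases "vs = []")
    case True
    have "stem m m [Up]"
      unfolding stem_def by (auto simp: Cons_eq_append_conv)
    then show ?thesis using stem_append_dyck[of m m "[Up]" y] snoc.prems True by (simp add: D_word_single)
  next
    case False
    have "stem m (m + 1 - length vs) (D_word vs)" using snoc False by simp
    moreover have "m + 1 - length vs = Suc (m + 1 - length (vs @ [y]))" using snoc.prems by simp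
    ultimately have "stem m (m + 1 - length (vs @ [y])) (D_word vs @ [Down])" using stem_append_Down by metis
    then have "stem m (m + 1 - length (vs @ [y])) ((D_word vs @ [Down]) @ y)"
      using stem_append_dyck[of m _ "D_word vs @ [Down]" y] snoc.prems by simp
    then show ?thesis using D_word_snoc[OF False] by simp
  qed
qed simp

lemma stem_starts_Up:
  assumes "stem m r a"
  obtains y where "a = Up # y"
proof (cases a)
  case (Cons x y)
  then have "int r \<le> height m [x]" using stemD(3)[OF assms, of "[x]" y] by simp
  then have "x = Up" by (cases x) auto
  then show ?thesis using that Cons by simp
qed (use stemD(1)[OF assms] in simp)

text \<open>First-passage decomposition, by descending induction from \<open>r = m\<close>, where a
  stem is \<open>Up\<close> followed by a Dyck path. For smaller \<open>r\<close>, cutting at the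
  first later visit to height \<open>r\<close> leaves a stem for \<open>r + 1\<close>, a
  \<open>Down\<close>, and a Dyck path as last component.\<close>

lemma stem_D_word_ex:
  assumes "stem m r a" "r \<le> m"
  shows "\<exists>vs. length vs = m + 1 - r \<and> (\<forall>u\<in>set vs. is_dyck m u) \<and> a = D_word vs"
  using assms(2,1)
proof (induction r arbitrary: a rule: inc_induct)
  case base
  obtain y where a: "a = Up # y" using stem_starts_Up[OF base] by blast
  have "is_dyck m y"
    unfolding is_dyck_iff
  proof (intro conjI allI impI)
    show "height m y = 0" using stemD(2)[OF base] a by simp
    fix p s assume "y = p @ s"
    then show "0 \<le> height m p" using stemD(3)[OF base, of "Up # p" s] a by simp
  qed
  then show ?case using a by (intro exI[of _ "[y]"]) (simp add: D_word_single)
next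
  case (step r)
  define P where "P k \<longleftrightarrow> 0 < k \<and> k \<le> length a \<and> height m (take k a) = int r" for k
  have "P (length a)" using stemD[OF step.prems] by (simp add: P_def)
  then obtain k where k: "P k" and min: "\<And>j. j < k \<Longrightarrow> \<not> P j"
    using exists_least_iff[of P] by blast
  obtain y where y: "a = Up # y" using stem_starts_Up[OF step.prems] by blast
  define b where "b = take (k - 1) a"
  have take_k: "take k a = b @ [a ! (k - 1)]"
    using k unfolding b_def P_def by (metis Suc_pred' Suc_le_lessD take_Suc_conv_app_nth)
  have "k \<noteq> 1" using k y step.hyps unfolding P_def by auto
  then have k2: "1 < k" using k unfolding P_def by simp
  have gt: "int (Suc r) \<le> height m p" if "b = p @ s" "p \<noteq> []" for p s
  proof -
    have len: "length p < k" "0 < length p" using that k k2 unfolding b_def P_def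
      by (metis Suc_pred' add_leD1 length_append length_take less_Suc_eq_le min.bounded_iff order.refl, simp)
    have p: "p = take (length p) a"
      using that(1) unfolding b_def by (metis append_eq_conv_conj append_take_drop_id append_assoc)
    then have "int r \<le> height m p" using stemD(3)[OF step.prems _ that(2)] by (metis append_take_drop_id)
    moreover have "height m p \<noteq> int r" using min[OF len(1)] len k p unfolding P_def by auto
    ultimately show ?thesis by simp
  qed
  have bne: "b \<noteq> []" using k2 y unfolding b_def by auto
  then have hb: "int (Suc r) \<le> height m b" using gt[of b "[]"] by simp
  have hk: "height m (take k a) = int r" using k unfolding P_def by simp
  have last: "a ! (k - 1) = Down"
    using hk hb unfolding take_k by (cases "a ! (k - 1)") auto
  then have "stem m (Suc r) b"
    unfolding stem_def using bne gt hk unfolding take_k by simp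
  then obtain vs where vs: "length vs = m + 1 - Suc r" "\<forall>u\<in>set vs. is_dyck m u" "b = D_word vs"
    using step.IH by blast
  let ?z = "drop k a"
  have a: "a = b @ Down # ?z" using take_k last by (metis append_take_drop_id append_assoc append_Cons append_Nil)
  have "is_dyck m ?z"
    unfolding is_dyck_iff
  proof (intro conjI allI impI)
    have "height m a = height m (take k a) + height m ?z" by (metis append_take_drop_id height_append)
    then show "height m ?z = 0" using stemD(2)[OF step.prems] hk by simp
    fix p s assume p: "?z = p @ s"
    then have eq: "a = (take k a @ p) @ s" by (metis append_take_drop_id append_assoc)
    have "take k a @ p \<noteq> []" using k2 y by simp
    then have "int r \<le> height m (take k a @ p)" by (rule stemD(3)[OF step.prems eq])
    then show "0 \<le> height m p" using hk by simp
  qed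
  moreover have "vs \<noteq> []" using vs(1) step.hyps by auto
  ultimately show ?case using vs a D_word_snoc[of vs ?z] step.hyps
    by (intro exI[of _ "vs @ [?z]"]) auto
qed

lemma truncated_iff_stem:
  assumes "1 \<le> i" "i \<le> m + 1"
  shows "truncated m i v \<longleftrightarrow> (\<exists>a. stem m (m + 1 - i) a \<and> v = a @ replicate (m + 1 - i) Down)"
proof
  assume "truncated m i v"
  then obtain vs where vs: "length vs = i" "\<forall>u\<in>set vs. is_dyck m u" "v = D_word (vs @ replicate (m + 1 - i) [])"
    unfolding truncated_def by blast
  moreover have "vs \<noteq> []" using vs(1) assms by auto
  ultimately show "\<exists>a. stem m (m + 1 - i) a \<and> v = a @ replicate (m + 1 - i) Down"
    using stem_D_word[of vs m] D_word_append_replicate assms by blast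
next
  assume "\<exists>a. stem m (m + 1 - i) a \<and> v = a @ replicate (m + 1 - i) Down"
  then obtain a where a: "stem m (m + 1 - i) a" "v = a @ replicate (m + 1 - i) Down" by blast
  have "m + 1 - i \<le> m" using assms by simp
  then obtain vs where vs: "length vs = i" "\<forall>u\<in>set vs. is_dyck m u" "a = D_word vs"
    using stem_D_word_ex[OF a(1)] assms by auto
  moreover have "vs \<noteq> []" using vs(1) assms by auto
  ultimately show "truncated m i v"
    unfolding truncated_def using a(2) D_word_append_replicate by metis
qed

lemma truncated_0_iff: "truncated m 0 v \<longleftrightarrow> v = Up # replicate m Down"
proof -
  have "D_word (replicate (Suc m) []) = Up # replicate m Down"
    using D_word_append_replicate[of "[[]]" m] by (simp add: D_word_single)
  then show ?thesis unfolding truncated_def by simp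
qed

lemma truncated_mono:
  assumes "1 \<le> i" "i \<le> m + 1" "truncated m (i - 1) v"
  shows "truncated m i v"
proof -
  obtain vs where vs: "length vs = i - 1" "\<forall>u\<in>set vs. is_dyck m u"
    "v = D_word (vs @ replicate (m + 1 - (i - 1)) [])"
    using assms(3) unfolding truncated_def by blast
  have "m + 1 - (i - 1) = Suc (m + 1 - i)" using assms by simp
  then have "v = D_word ((vs @ [[]]) @ replicate (m + 1 - i) [])" using vs(3) by simp
  moreover have "length (vs @ [[]]) = i" using vs(1) assms by simp
  ultimately show ?thesis unfolding truncated_def using vs(2)
    by (intro exI[of _ "vs @ [[]]"]) simp
qed

lemma truncated_last_iff: "truncated m (m + 1) v \<longleftrightarrow> is_dyck m v \<and> v \<noteq> []"
proof -
  have "stem m 0 v \<longleftrightarrow> is_dyck m v \<and> v \<noteq> []"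
    unfolding stem_def is_dyck_iff using height_Nil by (metis of_nat_0 order.refl)
  then show ?thesis using truncated_iff_stem[of "m + 1" m v] by simp
qed

text \<open>Here \<open>r = 1\<close>: a single \<open>Down\<close> follows a stem that never falls
  below height 1, so 0 is reached only at the end. This makes \<open>J_bar m m\<close> the series of
  the inserted factor.\<close>

lemma truncated_prime_iff:
  assumes "1 \<le> m"
  shows "truncated m m v \<longleftrightarrow> prime_dyck m v"
proof -
  have "prime_dyck m v" if a: "stem m 1 a" "v = a @ [Down]" for a
    unfolding prime_dyck_def
  proof (intro conjI allI impI)
    show "v \<noteq> []" "height m v = 0" using a stemD(2)[OF a(1)] by auto
    fix p s assume "v = p @ s" "p \<noteq> []" "s \<noteq> []"
    then obtain s' where "a = p @ s'" using a(2) by (cases s rule: rev_cases) auto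
    then show "0 < height m p" using stemD(3)[OF a(1)] \<open>p \<noteq> []\<close> by force
  qed
  moreover have "\<exists>a. stem m 1 a \<and> v = a @ [Down]" if v: "prime_dyck m v"
  proof -
    obtain a x where a: "v = a @ [x]" using prime_dyckD(1)[OF v] by (cases v rule: rev_cases) auto
    have "a \<noteq> []"
      using v a assms by (cases x) (auto simp: prime_dyck_def)
    then have "0 < height m a" using prime_dyckD(3)[OF v a] by simp
    then have x: "x = Down" using prime_dyckD(2)[OF v] a by (cases x) auto
    have "stem m 1 a"
      unfolding stem_def
    proof (intro conjI allI impI)
      show "height m a = int 1" using prime_dyckD(2)[OF v] a x by simp
      fix p s assume "a = p @ s" "p \<noteq> []"
      then show "int 1 \<le> height m p" using prime_dyckD(3)[OF v, of p "s @ [x]"] a by simp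
    qed fact
    then show ?thesis using a x by blast
  qed
  moreover have "m + 1 - m = Suc 0" by simp
  ultimately show ?thesis
    using truncated_iff_stem[of m m v] assms by (auto simp: numeral_eq_Suc)
qed

text \<open>The last prime factor is the shortest suffix that starts on level \<open>r\<close> after
  a non-empty prefix. If there is none, level \<open>r\<close> is met only at the very end.\<close>

lemma stem_split_last:
  assumes "stem m r a"
  shows "(\<exists>b q. stem m r b \<and> prime_dyck m q \<and> a = b @ q) \<or>
    (\<forall>p s. a = p @ s \<longrightarrow> p \<noteq> [] \<longrightarrow> s \<noteq> [] \<longrightarrow> int r < height m p)"
proof (rule disjCI)
  define P where "P s \<longleftrightarrow> s \<noteq> [] \<and> (\<exists>p. a = p @ s \<and> p \<noteq> [] \<and> height m p = int r)" for s
  assume "\<not> (\<forall>p s. a = p @ s \<longrightarrow> p \<noteq> [] \<longrightarrow> s \<noteq> [] \<longrightarrow> int r < height m p)"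
  then obtain p s where "a = p @ s" "p \<noteq> []" "s \<noteq> []" "height m p = int r"
    using stemD(3)[OF assms] by force
  then have "P s" unfolding P_def by blast
  then obtain q where q: "P q" and min: "\<And>s. P s \<Longrightarrow> length q \<le> length s"
    using ex_has_least_nat[of P s length] by blast
  then obtain b where b: "a = b @ q" "b \<noteq> []" "height m b = int r" unfolding P_def by blast
  have "stem m r b"
    unfolding stem_def using b stemD(3)[OF assms] by (metis append_assoc)
  moreover have "prime_dyck m q"
    unfolding prime_dyck_def
  proof (intro conjI allI impI)
    show "q \<noteq> []" using q by (simp add: P_def)
    show "height m q = 0" using stemD(2)[OF assms] b by simp
    fix p s assume p: "q = p @ s" "p \<noteq> []" "s \<noteq> []"
    then have "int r \<le> height m (b @ p)" using stemD(3)[OF assms, of "b @ p" s] b by simp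
    moreover have "height m (b @ p) \<noteq> int r"
    proof
      assume "height m (b @ p) = int r"
      then have "P s" unfolding P_def using p b by (metis append_assoc append_is_Nil_conv)
      then show False using min[of s] p by simp
    qed
    ultimately show "0 < height m p" using b by simp
  qed
  ultimately show "\<exists>b q. stem m r b \<and> prime_dyck m q \<and> a = b @ q" using b by blast
qed

text \<open>The paths new at index \<open>i\<close> are those whose \<open>i\<close>-th component is
  non-empty, and \<open>q\<close> is the last prime factor of that component.\<close>

lemma truncated_diff_iff:
  assumes "1 \<le> i" "i \<le> m + 1" "r = m + 1 - i"
  shows "truncated m i v \<and> \<not> truncated m (i - 1) v \<longleftrightarrow>
    (\<exists>a q. stem m r a \<and> prime_dyck m q \<and> v = a @ q @ replicate r Down)"
proof
  assume L: "truncated m i v \<and> \<not> truncated m (i - 1) v"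
  then obtain b where b: "stem m r b" "v = b @ replicate r Down"
    using truncated_iff_stem assms by blast
  \<comment> \<open>With nothing to split off, level \<open>r\<close> is met only at the end of the
    stem. Then the stem is \<open>Up\<close> alone, or its last letter is a \<open>Down\<close>
    after a stem for \<open>r + 1\<close>; both belong to index \<open>i - 1\<close>.\<close>
  have False if gt: "\<forall>p s. b = p @ s \<longrightarrow> p \<noteq> [] \<longrightarrow> s \<noteq> [] \<longrightarrow> int r < height m p"
  proof -
    obtain y where y: "b = Up # y" using stem_starts_Up[OF b(1)] by blast
    show False
    proof (cases "y = []")
      case True
      then have "r = m" using stemD(2)[OF b(1)] y by simp
      then have "truncated m (i - 1) v" using b y True assms by (auto simp: truncated_0_iff)
      then show False using L by blast
    next
      case False
      then have "int r < height m [Up]" using gt y by (metis append_Cons append_Nil list.distinct(1))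
      then have rm: "Suc r \<le> m" by simp
      obtain b' x where "b = b' @ [x]" using y by (metis rev_exhaust list.distinct(1))
      then have b': "b = b' @ [x]" "b' \<noteq> []" using y False by auto
      have "int r < height m b'" using gt b' by blast
      then have x: "x = Down" using stemD(2)[OF b(1)] b' by (cases x) auto
      have "stem m (Suc r) b'"
        unfolding stem_def
      proof (intro conjI allI impI)
        show "height m b' = int (Suc r)" using stemD(2)[OF b(1)] b' x by simp
        fix p s assume "b' = p @ s" "p \<noteq> []"
        then show "int (Suc r) \<le> height m p" using gt[rule_format, of p "s @ [x]"] b' by simp
      qed fact
      moreover have "v = b' @ replicate (Suc r) Down" using b b' x by simp
      moreover have "Suc r = m + 1 - (i - 1)" "1 \<le> i - 1" "i - 1 \<le> m + 1" using assms rm by auto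
      ultimately have "truncated m (i - 1) v" using truncated_iff_stem[of "i - 1" m v] by auto
      then show False using L by blast
    qed
  qed
  then show "\<exists>a q. stem m r a \<and> prime_dyck m q \<and> v = a @ q @ replicate r Down"
    using stem_split_last[OF b(1)] b(2) by auto
next
  assume "\<exists>a q. stem m r a \<and> prime_dyck m q \<and> v = a @ q @ replicate r Down"
  then obtain a q where a: "stem m r a" and q: "prime_dyck m q" and v: "v = a @ q @ replicate r Down" by blast
  have "stem m r (a @ q)" using stem_append_dyck[OF a] prime_dyck_is_dyck[OF q] by simp
  then have "truncated m i v" using truncated_iff_stem[OF assms(1,2)] v assms(3) by (metis append_assoc)
  moreover have "\<not> truncated m (i - 1) v"
  proof
    assume t: "truncated m (i - 1) v"
    show False
    proof (cases "i = 1")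
      case True
      then have "a @ q = [Up]" using t v assms by (auto simp: truncated_0_iff Cons_eq_append_conv append_eq_Cons_conv)
      then show False using stemD(1)[OF a] prime_dyckD(1)[OF q] by (auto simp: append_eq_Cons_conv)
    next
      case False
      then have "Suc r = m + 1 - (i - 1)" "1 \<le> i - 1" "i - 1 \<le> m + 1" using assms by auto
      then obtain a' where a': "stem m (Suc r) a'" "v = a' @ replicate (Suc r) Down"
        using truncated_iff_stem[of "i - 1" m v] t by auto
      have "replicate (Suc r) Down = [Down] @ replicate r Down" by simp
      then have eq: "a' @ [Down] = a @ q" using a'(2) v by (metis append_assoc append_same_eq)
      obtain q' x where "q = q' @ [x]" using prime_dyckD(1)[OF q] by (cases q rule: rev_cases) auto
      then have "a' = a @ q'" using eq by simp
      \<comment> \<open>Here \<open>a\<close> is a non-empty prefix of a stem for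
        \<open>r + 1\<close>, yet its height is \<open>r\<close>.\<close>
      then have "int (Suc r) \<le> height m a" using stemD(3)[OF a'(1)] stemD(1)[OF a] by blast
      then show False using stemD(2)[OF a] by simp
    qed
  qed
  ultimately show "truncated m i v \<and> \<not> truncated m (i - 1) v" by blast
qed

section \<open>The polynomials \<open>H\<^sub>i\<close>\<close>

text \<open>The coefficient of \<open>(- z)\<^sup>k u\<^sup>l\<close> in \<open>H\<^sub>i(z; u) / u\<^sup>i\<^sup>+\<^sup>1\<close>. At \<open>l = m - i\<close>
  the two binomial formulas agree. For \<open>i = m + 1\<close>, \<open>k = 1\<close> the truncated \<open>m + k - i - 1 = 0\<close> is intended.\<close>

definition H_coeff :: "nat \<Rightarrow> nat \<Rightarrow> nat \<Rightarrow> nat \<Rightarrow> nat" where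
  "H_coeff m i k l =
     (if k = 0 then (if l = 0 then 1 else 0)
      else if l + i \<le> m then ((i + 1) choose k) * ((l + k - 1) choose l)
      else ((m + k - i - 1) choose (k - 1)) * ((m + 1 - l) choose k))"

text \<open>The quotient \<open>H_i / u^(i+1)\<close>. The ranges of \<open>k\<close> and
  \<open>l\<close> do not depend on \<open>i\<close>, the surplus coefficients being 0, so
  consecutive indices can be compared coefficient by coefficient.\<close>

definition H_red :: "nat \<Rightarrow> nat \<Rightarrow> 'a::comm_ring_1 \<Rightarrow> 'a \<Rightarrow> 'a" where
  "H_red m i z u = (\<Sum>k=0..m + 2. (- z) ^ k * (\<Sum>l=0..m. of_nat (H_coeff m i k l) * u ^ l))"

lemma H_coeff_sum_0 [simp]:
  "(\<Sum>l=0..m. of_nat (H_coeff m i 0 l) * u ^ l) = (1 :: 'a::comm_ring_1)"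
proof -
  have "(\<Sum>l=0..m. of_nat (H_coeff m i 0 l) * u ^ l) = (\<Sum>l\<in>{0}. of_nat (H_coeff m i 0 l) * u ^ l)"
    by (rule sum.mono_neutral_right) (auto simp: H_coeff_def)
  then show ?thesis by (simp add: H_coeff_def)
qed

lemma H_coeff_eq_0:
  assumes "i \<le> m + 1" "i + 1 < k" "l \<le> m"
  shows "H_coeff m i k l = 0"
proof -
  have "(m + 1 - l) choose k = 0" if "m < l + i"
    using that assms by (intro binomial_eq_0) simp
  then show ?thesis using assms by (auto simp: H_coeff_def)
qed

text \<open>This is the factor in the equation of \<open>U\<close>, which reads
  \<open>U h_0 = x (1 - Z)^(m+2)\<close>.\<close>

lemma H_red_0: "H_red m 0 z u = 1 - z * (\<Sum>l=0..m. u ^ l)"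
proof -
  have "H_red m 0 z u = (\<Sum>k\<in>{0, 1}. (- z) ^ k * (\<Sum>l=0..m. of_nat (H_coeff m 0 k l) * u ^ l))"
    unfolding H_red_def by (rule sum.mono_neutral_right) (auto simp: H_coeff_eq_0)
  also have "\<dots> = 1 - z * (\<Sum>l=0..m. u ^ l)"
    by (simp add: H_coeff_def[of _ _ "Suc 0"])
  finally show ?thesis .
qed

text \<open>For \<open>i = m + 1\<close> and \<open>k \<ge> 2\<close> the first binomial of the
  coefficient is \<open>(k - 2) choose (k - 1) = 0\<close>.\<close>

lemma H_red_last: "H_red m (m + 1) z u = 1 - z * (\<Sum>l=0..m. u ^ l * of_nat (m + 1 - l))"
proof -
  have "H_red m (m + 1) z u = (\<Sum>k\<in>{0, 1}. (- z) ^ k * (\<Sum>l=0..m. of_nat (H_coeff m (m + 1) k l) * u ^ l))"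
  proof -
    have "H_coeff m (m + 1) k l = 0" if "k \<notin> {0, 1}" for k l
      using that by (simp add: H_coeff_def) arith
    then show ?thesis
      unfolding H_red_def by (intro sum.mono_neutral_right) auto
  qed
  also have "\<dots> = 1 - z * (\<Sum>l=0..m. u ^ l * of_nat (m + 1 - l))"
    by (simp add: H_coeff_def[of _ _ "Suc 0"]) (simp add: mult.commute)
  finally show ?thesis .
qed

lemma H_poly_eq_H_red:
  assumes "i \<le> m + 1"
  shows "H_poly m i z u = u ^ (i + 1) * H_red m i z u"
proof (cases "i = m + 1")
  case True
  then show ?thesis using H_red_last[of m z u] by (simp add: H_poly_def)
next
  case False
  then have im: "i \<le> m" using assms by simp
  let ?c = "\<lambda>k l. of_nat (H_coeff m i k l) * u ^ l"
  \<comment> \<open>The two double sums of \<open>H_poly\<close> are the low part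
    \<open>l \<le> m - i\<close> and the high part, with \<open>l = m + 1 - k - e\<close>
    there.\<close>
  have split: "(\<Sum>l=0..m. ?c k l) = (\<Sum>l=0..m - i. ?c k l) + (\<Sum>l=m - i + 1..m. ?c k l)" for k
    using sum.ub_add_nat[of 0 "m - i" "?c k" i] im by simp
  have "H_red m i z u = (\<Sum>k\<in>insert 0 {1..m + 2}. (- z) ^ k * (\<Sum>l=0..m. ?c k l))"
    unfolding H_red_def by (rule sum.cong) auto
  also have "\<dots> = 1 + (\<Sum>k=1..m + 2. (- z) ^ k * (\<Sum>l=0..m. ?c k l))"
    by simp
  also have "(\<Sum>k=1..m + 2. (- z) ^ k * (\<Sum>l=0..m. ?c k l)) =
      (\<Sum>k=1..m + 2. (- z) ^ k * (\<Sum>l=0..m - i. ?c k l)) +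
      (\<Sum>k=1..m + 2. (- z) ^ k * (\<Sum>l=m - i + 1..m. ?c k l))"
    unfolding split by (simp add: sum.distrib distrib_left)
  also have "(\<Sum>k=1..m + 2. (- z) ^ k * (\<Sum>l=0..m - i. ?c k l)) =
      (\<Sum>k=1..i + 1. (- z) ^ k * of_nat ((i + 1) choose k) *
          (\<Sum>e=0..m - i. of_nat ((e + k - 1) choose e) * u ^ e))"
  proof (rule sum.mono_neutral_cong_right)
    show "\<forall>k\<in>{1..m + 2} - {1..i + 1}. (- z) ^ k * (\<Sum>l=0..m - i. ?c k l) = 0"
      using im by (auto intro!: sum.neutral simp: H_coeff_eq_0)
    fix k assume "k \<in> {1..i + 1}"
    then have "?c k l = of_nat ((i + 1) choose k) * (of_nat ((l + k - 1) choose l) * u ^ l)"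
      if "l \<in> {0..m - i}" for l
    proof -
      have "l + i \<le> m" using that im by auto
      then show ?thesis using \<open>k \<in> {1..i + 1}\<close> by (simp add: H_coeff_def)
    qed
    then have "(\<Sum>l=0..m - i. ?c k l) = of_nat ((i + 1) choose k) * (\<Sum>e=0..m - i. of_nat ((e + k - 1) choose e) * u ^ e)"
      unfolding sum_distrib_left by (rule sum.cong[OF refl])
    then show "(- z) ^ k * (\<Sum>l=0..m - i. ?c k l) = (- z) ^ k * of_nat ((i + 1) choose k) *
          (\<Sum>e=0..m - i. of_nat ((e + k - 1) choose e) * u ^ e)"
      by (simp only: mult.assoc)
  qed (use im in auto)
  also have "(\<Sum>k=1..m + 2. (- z) ^ k * (\<Sum>l=m - i + 1..m. ?c k l)) =
      (\<Sum>k=1..i. (- z) ^ k * of_nat ((m + k - i - 1) choose (k - 1)) *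
          (\<Sum>e=0..i - k. of_nat ((e + k) choose e) * u ^ (m + 1 - k - e)))"
  proof (rule sum.mono_neutral_cong_right)
    have "?c k l = 0" if "k \<in> {1..m + 2} - {1..i}" "l \<in> {m - i + 1..m}" for k l
    proof -
      have "(m + 1 - l) choose k = 0" "\<not> l + i \<le> m" "k \<noteq> 0"
        using that im by (auto intro!: binomial_eq_0)
      then show ?thesis unfolding H_coeff_def by (simp del: binomial_eq_0_iff)
    qed
    then show "\<forall>k\<in>{1..m + 2} - {1..i}. (- z) ^ k * (\<Sum>l=m - i + 1..m. ?c k l) = 0"
      by (simp add: sum.neutral)
    fix k assume k: "k \<in> {1..i}"
    have "(\<Sum>l=m - i + 1..m. ?c k l) = (\<Sum>l=m - i + 1..m + 1 - k. ?c k l)"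
    proof (rule sum.mono_neutral_right)
      have "(m + 1 - l) choose k = 0" if "l \<in> {m - i + 1..m} - {m - i + 1..m + 1 - k}" for l
        using that by (auto intro!: binomial_eq_0)
      moreover have "\<not> l + i \<le> m" if "l \<in> {m - i + 1..m}" for l using that by auto
      ultimately show "\<forall>l\<in>{m - i + 1..m} - {m - i + 1..m + 1 - k}. ?c k l = 0"
        using k unfolding H_coeff_def by (simp del: binomial_eq_0_iff)
    qed (use k in auto)
    also have "\<dots> = (\<Sum>e=0..i - k. of_nat ((m + k - i - 1) choose (k - 1)) *
        (of_nat ((e + k) choose e) * u ^ (m + 1 - k - e)))"
    proof (rule sum.reindex_bij_witness[of _ "\<lambda>e. m + 1 - k - e" "\<lambda>l. m + 1 - k - l"])
      fix l assume l: "l \<in> {m - i + 1..m + 1 - k}"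
      then have nl: "\<not> l + i \<le> m" using im by auto
      from l have "k \<le> m + 1 - l" using k im by auto
      then have "(m + 1 - l) choose k = (m + 1 - l) choose (m + 1 - k - l)"
        using binomial_symmetric[of k "m + 1 - l"] by (simp add: diff_right_commute add.commute)
      moreover have "m + 1 - k - l + k = m + 1 - l" using l k im by auto
      moreover have "m + 1 - k - (m + 1 - k - l) = l" using l by auto
      ultimately show "of_nat ((m + k - i - 1) choose (k - 1)) *
        (of_nat ((m + 1 - k - l + k) choose (m + 1 - k - l)) * u ^ (m + 1 - k - (m + 1 - k - l))) = ?c k l"
        using nl k by (simp add: H_coeff_def)
    qed (use k im in auto)
    finally show "(- z) ^ k * (\<Sum>l=m - i + 1..m. ?c k l) =
      (- z) ^ k * of_nat ((m + k - i - 1) choose (k - 1)) *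
          (\<Sum>e=0..i - k. of_nat ((e + k) choose e) * u ^ (m + 1 - k - e))"
      by (simp only: mult.assoc sum_distrib_left)
  qed (use im in auto)
  finally show ?thesis using False by (simp add: H_poly_def add.assoc)
qed

text \<open>Pascal's rule in \<open>i\<close> on the left; on the right
  \<open>i choose (k - 1)\<close> factors out and a hockey-stick sum remains.\<close>

lemma H_coeff_diff_low:
  assumes "1 \<le> i" "l + i \<le> m" "1 \<le> k"
  shows "int (H_coeff m i k l) - int (H_coeff m (i - 1) k l) = (\<Sum>j=0..l. int (H_coeff m (i - 1) (k - 1) j))"
proof -
  have "(\<Sum>j=0..l. H_coeff m (i - 1) (k - 1) j) = (i choose (k - 1)) * ((l + k - 1) choose l)"
  proof (cases "k = 1")
    case True
    have "(\<Sum>j=0..l. H_coeff m (i - 1) 0 j) = (\<Sum>j\<in>{0}. H_coeff m (i - 1) 0 j)"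
      by (rule sum.mono_neutral_right) (auto simp: H_coeff_def)
    with True show ?thesis by (simp add: H_coeff_def)
  next
    case False
    define n where "n = k - 2"
    have k: "k = n + 2" using False assms by (simp add: n_def)
    have "(\<Sum>j=0..l. H_coeff m (i - 1) (k - 1) j) = (\<Sum>j=0..l. (i choose (k - 1)) * ((n + j) choose j))"
      by (rule sum.cong) (use assms k in \<open>auto simp: H_coeff_def add.commute\<close>)
    also have "\<dots> = (i choose (k - 1)) * ((l + k - 1) choose l)"
      using sum_choose_lower[of n l] k by (simp add: sum_distrib_left[symmetric] atMost_atLeast0 add.commute)
    finally show ?thesis .
  qed
  moreover have "(i + 1) choose k = (i choose (k - 1)) + (i choose k)"
    using assms(3) by (cases k) auto
  moreover have "H_coeff m i k l = ((i + 1) choose k) * ((l + k - 1) choose l)"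
    "H_coeff m (i - 1) k l = (i choose k) * ((l + k - 1) choose l)"
    using assms by (auto simp: H_coeff_def)
  ultimately have "H_coeff m i k l = H_coeff m (i - 1) k l + (\<Sum>j=0..l. H_coeff m (i - 1) (k - 1) j)"
    by (simp only: distrib_right add.commute)
  then show ?thesis by simp
qed

text \<open>Mirror image of the low case: a hockey-stick sum in \<open>m + 1 - j\<close> and
  Pascal's rule for the other factor, which decreases with \<open>i\<close>; hence the sign.\<close>

lemma H_coeff_diff_high:
  assumes "1 \<le> i" "i \<le> m + 1" "m < l + i" "l \<le> m" "1 \<le> k"
  shows "int (H_coeff m i k l) - int (H_coeff m (i - 1) k l) = - (\<Sum>j=l + 1..m. int (H_coeff m (i - 1) (k - 1) j))"
proof -
  have prev: "H_coeff m (i - 1) k l = ((m + k - i) choose (k - 1)) * ((m + 1 - l) choose k)"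
  proof (cases "l + i = m + 1")
    \<comment> \<open>On the boundary \<open>l = m + 1 - i\<close> the index \<open>i - 1\<close>
      still falls under the low formula; symmetry of binomials converts it.\<close>
    case True
    have "(m + k - i) choose (k - 1) = (m + k - i) choose (m + k - i - (k - 1))"
      using assms by (intro binomial_symmetric) simp
    moreover have "m + k - i - (k - 1) = l" "l + k - 1 = m + k - i" "m + 1 - l = i"
      using True assms by auto
    ultimately show ?thesis using True assms by (simp add: H_coeff_def)
  next
    case False
    then have "\<not> l + (i - 1) \<le> m" "m + k - (i - 1) - 1 = m + k - i" using assms by auto
    then show ?thesis using assms by (simp add: H_coeff_def)
  qed
  have cur: "H_coeff m i k l = ((m + k - i - 1) choose (k - 1)) * ((m + 1 - l) choose k)"
    using assms by (simp add: H_coeff_def)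
  show ?thesis
  proof (cases "k = 1")
    case True
    then show ?thesis unfolding prev cur by (auto simp: H_coeff_def intro!: sum.neutral)
  next
    case False
    define n where "n = k - 2"
    have k: "k = n + 2" using False assms by (simp add: n_def)
    have "(\<Sum>j=l + 1..m. H_coeff m (i - 1) (k - 1) j)
        = (\<Sum>j=l + 1..m. ((m + k - i - 1) choose (k - 2)) * ((m + 1 - j) choose (k - 1)))"
      by (rule sum.cong) (use assms k in \<open>auto simp: H_coeff_def\<close>)
    also have "\<dots> = ((m + k - i - 1) choose (k - 2)) * (\<Sum>j=l + 1..m. (m + 1 - j) choose (k - 1))"
      by (simp only: sum_distrib_left)
    also have "(\<Sum>j=l + 1..m. (m + 1 - j) choose (k - 1)) = (\<Sum>s=1..m - l. s choose (k - 1))"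
      by (rule sum.reindex_bij_witness[of _ "\<lambda>s. m + 1 - s" "\<lambda>j. m + 1 - j"]) (use assms in auto)
    also have "\<dots> = (\<Sum>s\<le>m - l. s choose (k - 1))"
      by (rule sum.mono_neutral_left) (use k in \<open>auto simp: not_le\<close>)
    also have "\<dots> = (m + 1 - l) choose k"
      using sum_choose_upper[of "k - 1" "m - l"] assms k by (simp add: Suc_diff_le)
    finally have "(\<Sum>j=l + 1..m. H_coeff m (i - 1) (k - 1) j) = ((m + k - i - 1) choose (k - 2)) * ((m + 1 - l) choose k)" .
    moreover have "(m + k - i) choose (k - 1) = ((m + k - i - 1) choose (k - 2)) + ((m + k - i - 1) choose (k - 1))"
    proof -
      have "m + k - i = Suc (m + n + 1 - i)" "k - 1 = Suc n" using assms k by auto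
      then show ?thesis using k by simp
    qed
    ultimately have "H_coeff m (i - 1) k l = H_coeff m i k l + (\<Sum>j=l + 1..m. H_coeff m (i - 1) (k - 1) j)"
      unfolding prev cur by (simp only: distrib_right add.commute)
    then show ?thesis by simp
  qed
qed

lemma sum_partial_sums_mult:
  fixes u :: "'a::comm_ring_1"
  shows "(u - 1) * (\<Sum>l=0..m. (\<Sum>j=0..l. f j) * u ^ l) = (\<Sum>j=0..m. f j) * u ^ Suc m - (\<Sum>l=0..m. f l * u ^ l)"
  by (induction m) (simp_all add: algebra_simps)

text \<open>Writing \<open>f(u)\<close> for the polynomial with coefficients \<open>f l\<close>, the
  \<open>d l\<close> are the coefficients of \<open>(f(1) u^r - f(u)) / (u - 1)\<close>: partial
  sums of \<open>f\<close> below degree \<open>r\<close>, partial sums minus the total from there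
  on.\<close>

lemma sum_truncated_partial_sums:
  fixes u :: "'a::comm_ring_1"
  assumes "r \<le> m + 1"
    and "\<And>l. l < r \<Longrightarrow> l \<le> m \<Longrightarrow> d l = (\<Sum>j=0..l. f j)"
    and "\<And>l. r \<le> l \<Longrightarrow> l \<le> m \<Longrightarrow> d l = - (\<Sum>j=l + 1..m. f j)"
  shows "(u - 1) * (\<Sum>l=0..m. d l * u ^ l) = (\<Sum>l=0..m. f l) * u ^ r - (\<Sum>l=0..m. f l * u ^ l)"
proof -
  let ?F = "\<lambda>l. \<Sum>j=0..l. f j"
  have d: "d l = ?F l - (if r \<le> l then ?F m else 0)" if "l \<le> m" for l
    using assms(2,3)[of l] that sum.ub_add_nat[of 0 l f "m - l"] by (cases "r \<le> l") auto
  have "(\<Sum>l=0..m. d l * u ^ l) = (\<Sum>l=0..m. ?F l * u ^ l - (if r \<le> l then ?F m * u ^ l else 0))"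
    by (rule sum.cong) (auto simp: d left_diff_distrib)
  also have "\<dots> = (\<Sum>l=0..m. ?F l * u ^ l) - ?F m * (\<Sum>l=r..m. u ^ l)"
  proof -
    have "(\<Sum>l=0..m. if r \<le> l then ?F m * u ^ l else 0) = (\<Sum>l=r..m. ?F m * u ^ l)"
      by (rule sum.mono_neutral_cong_right) auto
    then show ?thesis by (simp add: sum_subtractf sum_distrib_left)
  qed
  finally have "(u - 1) * (\<Sum>l=0..m. d l * u ^ l) =
    (u - 1) * (\<Sum>l=0..m. ?F l * u ^ l) - ?F m * ((u - 1) * (\<Sum>l=r..m. u ^ l))"
    by (simp only: right_diff_distrib mult.left_commute)
  moreover have "(u - 1) * (\<Sum>l=r..m. u ^ l) = u ^ Suc m - u ^ r"
  proof (cases "r = m + 1")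
    case False
    then have "r \<le> m" using assms(1) by simp
    then show ?thesis by (induction m rule: dec_induct) (simp_all add: algebra_simps)
  qed simp
  ultimately have "(u - 1) * (\<Sum>l=0..m. d l * u ^ l) =
    ?F m * u ^ Suc m - (\<Sum>l=0..m. f l * u ^ l) - ?F m * (u ^ Suc m - u ^ r)"
    by (simp only: sum_partial_sums_mult)
  then show ?thesis by (simp only: right_diff_distrib) simp
qed

text \<open>The coefficient of \<open>(- z)^(k+1)\<close> in \<open>h_i - h_(i-1)\<close> is the
  divided difference, in the sense of the previous lemma with \<open>r = m + 1 - i\<close>, of the
  coefficient of \<open>(- z)^k\<close> in \<open>h_(i-1)\<close>.\<close>

lemma H_red_step:
  fixes z u :: "'a::comm_ring_1"
  assumes "1 \<le> i" "i \<le> m + 1"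
  shows "(u - 1) * H_red m i z u = (u - 1 + z) * H_red m (i - 1) z u - z * u ^ (m + 1 - i) * H_red m (i - 1) z 1"
proof -
  let ?r = "m + 1 - i"
  let ?g = "\<lambda>i k u::'a. \<Sum>l=0..m. of_nat (H_coeff m i k l) * u ^ l"
  have step: "(u - 1) * (?g i (Suc k) u - ?g (i - 1) (Suc k) u) = ?g (i - 1) k 1 * u ^ ?r - ?g (i - 1) k u" for k
  proof -
    let ?d = "\<lambda>l. of_int (int (H_coeff m i (Suc k) l) - int (H_coeff m (i - 1) (Suc k) l)) :: 'a"
    let ?f = "\<lambda>l. of_int (int (H_coeff m (i - 1) k l)) :: 'a"
    have "(u - 1) * (\<Sum>l=0..m. ?d l * u ^ l) = (\<Sum>l=0..m. ?f l) * u ^ ?r - (\<Sum>l=0..m. ?f l * u ^ l)"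
    proof (rule sum_truncated_partial_sums)
      fix l assume "l < ?r" "l \<le> m"
      then show "?d l = (\<Sum>j=0..l. ?f j)"
        using H_coeff_diff_low[of i l m "Suc k", unfolded diff_Suc_1] assms by (simp only: flip: of_int_sum)
    next
      fix l assume "?r \<le> l" "l \<le> m"
      then show "?d l = - (\<Sum>j=l + 1..m. ?f j)"
        using H_coeff_diff_high[of i m l "Suc k", unfolded diff_Suc_1] assms
        by (simp only: flip: of_int_sum of_int_minus)
    qed simp
    then show ?thesis by (simp add: left_diff_distrib sum_subtractf)
  qed
  have split: "H_red m j z v = 1 + (\<Sum>k=0..m + 1. (- z) ^ Suc k * ?g j (Suc k) v)" for j and v :: 'a
    unfolding H_red_def using sum.atLeast0_atMost_Suc_shift[of "\<lambda>k. (- z) ^ k * ?g j k v" "m + 1"]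
    by simp
  have top: "H_red m (i - 1) z v = (\<Sum>k=0..m + 1. (- z) ^ k * ?g (i - 1) k v)" for v :: 'a
  proof -
    have "?g (i - 1) (m + 2) v = 0"
      using assms by (intro sum.neutral) (simp add: H_coeff_eq_0)
    then show ?thesis unfolding H_red_def by simp
  qed
  have "(u - 1) * (H_red m i z u - H_red m (i - 1) z u)
      = (\<Sum>k=0..m + 1. (- z) ^ Suc k * ((u - 1) * (?g i (Suc k) u - ?g (i - 1) (Suc k) u)))"
    unfolding split by (simp only: sum_distrib_left add_diff_cancel_left sum_subtractf[symmetric] right_diff_distrib mult.left_commute)
  also have "\<dots> = (\<Sum>k=0..m + 1. (- z) ^ Suc k * (?g (i - 1) k 1 * u ^ ?r - ?g (i - 1) k u))"
    unfolding step ..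
  also have "\<dots> = (\<Sum>k=0..m + 1. z * ((- z) ^ k * ?g (i - 1) k u) - z * u ^ ?r * ((- z) ^ k * ?g (i - 1) k 1))"
    by (rule sum.cong) (simp_all add: algebra_simps)
  also have "\<dots> = z * H_red m (i - 1) z u - z * u ^ ?r * H_red m (i - 1) z 1"
    unfolding top by (simp only: sum_subtractf sum_distrib_left)
  finally show ?thesis by (simp add: algebra_simps)
qed

text \<open>For \<open>i = m\<close> and \<open>k > 0\<close> the coefficient is
  \<open>(m + 1 - l) choose k\<close> throughout, so the sum over \<open>k\<close> is a binomial
  expansion in \<open>1 - z\<close> and the sum over \<open>l\<close> is geometric. The closed form
  yields \<open>J_m\<close> and, at \<open>u = 1\<close>, the number of all intervals.\<close>

lemma H_red_m:
  fixes z u :: "'a::comm_ring_1"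
  shows "(u - 1 + z) * H_red m m z u = u * H_red m 0 z u - (1 - z) ^ (m + 2)"
proof -
  define q where "q = 1 - z"
  let ?S = "\<Sum>l=0..m. u ^ l"
  have coeff: "H_coeff m m (Suc k) l = (m + 1 - l) choose Suc k" if "l \<le> m" for k l
    using that by (simp add: H_coeff_def)
  have "H_red m m z u = 1 + (\<Sum>k=0..m + 1. (- z) ^ Suc k * (\<Sum>l=0..m. of_nat (H_coeff m m (Suc k) l) * u ^ l))"
    unfolding H_red_def
    using sum.atLeast0_atMost_Suc_shift[of "\<lambda>k. (- z) ^ k * (\<Sum>l=0..m. of_nat (H_coeff m m k l) * u ^ l)" "m + 1"]
    by simp
  also have "\<dots> = 1 + (\<Sum>l=0..m. u ^ l * (\<Sum>k=0..m + 1. of_nat ((m + 1 - l) choose Suc k) * (- z) ^ Suc k))"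
    unfolding sum_distrib_left by (subst sum.swap) (simp add: coeff mult_ac)
  also have "\<dots> = 1 + (\<Sum>l=0..m. u ^ l * (q ^ (m + 1 - l) - 1))"
  proof -
    have "(\<Sum>k=0..m + 1. of_nat ((m + 1 - l) choose Suc k) * (- z) ^ Suc k) = q ^ (m + 1 - l) - 1" for l
    proof -
      have "q ^ (m + 1 - l) = (\<Sum>k\<le>m + 1 - l. of_nat ((m + 1 - l) choose k) * (- z) ^ k)"
        using binomial_ring[of "- z" 1 "m + 1 - l"] by (simp add: q_def)
      also have "\<dots> = (\<Sum>k=0..Suc (m + 1). of_nat ((m + 1 - l) choose k) * (- z) ^ k)"
        by (rule sum.mono_neutral_left) (auto simp: binomial_eq_0)
      also have "\<dots> = 1 + (\<Sum>k=0..m + 1. of_nat ((m + 1 - l) choose Suc k) * (- z) ^ Suc k)"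
        by (subst sum.atLeast0_atMost_Suc_shift) simp
      finally show ?thesis by simp
    qed
    then show ?thesis by simp
  qed
  also have "\<dots> = 1 + q * (\<Sum>l=0..m. u ^ l * q ^ (m - l)) - ?S"
  proof -
    have "(\<Sum>l=0..m. u ^ l * (q ^ (m + 1 - l) - 1)) = (\<Sum>l=0..m. q * (u ^ l * q ^ (m - l)) - u ^ l)"
      by (rule sum.cong) (auto simp: Suc_diff_le algebra_simps)
    then show ?thesis by (simp add: sum_subtractf sum_distrib_left)
  qed
  finally have H: "H_red m m z u = 1 + q * (\<Sum>l=0..m. u ^ l * q ^ (m - l)) - ?S" .
  have P: "(u - q) * (\<Sum>l=0..m. u ^ l * q ^ (m - l)) = u ^ Suc m - q ^ Suc m"
    using diff_power_eq_sum[of u m q] by (simp add: atLeast0AtMost lessThan_Suc_atMost)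
  have S: "(u - 1) * ?S = u ^ Suc m - 1"
    using diff_power_eq_sum[of u m 1] by (simp add: atLeast0AtMost lessThan_Suc_atMost)
  have "(u - q) * H_red m m z u = (u - q) + q * ((u - q) * (\<Sum>l=0..m. u ^ l * q ^ (m - l))) - (u - q) * ?S"
    unfolding H by (simp add: algebra_simps)
  also have "\<dots> = (u - q) + q * ((u - 1) * ?S + 1 - q ^ Suc m) - (u - q) * ?S"
    unfolding P S by simp
  also have "\<dots> = u * (1 - (1 - q) * ?S) - q ^ (m + 2)"
    by (simp add: algebra_simps)
  finally show ?thesis unfolding H_red_0 q_def by (simp add: algebra_simps)
qed

section \<open>The series \<open>Z\<close> and \<open>U\<close>\<close>

text \<open>The same identities are needed in \<open>Q[[t]]\<close>, \<open>Q[x][[t]]\<close> and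
  \<open>Q(x)[[t]]\<close> and after setting \<open>x = 1\<close>. The maps between these rings act
  on coefficients and carry \<open>H_red\<close> along.\<close>

locale comm_ring_hom =
  fixes hom :: "'a::comm_ring_1 \<Rightarrow> 'b::comm_ring_1"
  assumes hom_one: "hom 1 = 1"
    and hom_add: "hom (a + b) = hom a + hom b"
    and hom_mult: "hom (a * b) = hom a * hom b"
begin

lemma hom_zero: "hom 0 = 0"
  using hom_add[of 0 0] by simp

lemma hom_uminus: "hom (- a) = - hom a"
  using hom_add[of a "- a"] hom_zero by (simp add: eq_neg_iff_add_eq_0 add.commute)

lemma hom_diff: "hom (a - b) = hom a - hom b"
  using hom_add[of a "- b"] hom_uminus by simp

lemma hom_power: "hom (a ^ n) = hom a ^ n"
  by (induction n) (simp_all add: hom_one hom_mult)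

lemma hom_sum: "hom (sum f A) = (\<Sum>x\<in>A. hom (f x))"
  by (induction A rule: infinite_finite_induct) (simp_all add: hom_zero hom_add)

lemma hom_of_nat: "hom (of_nat n) = of_nat n"
  by (induction n) (simp_all add: hom_zero hom_one hom_add)

lemmas hom_simps = hom_zero hom_one hom_add hom_mult hom_uminus hom_diff hom_power hom_sum hom_of_nat

lemma hom_H_red: "hom (H_red m i z u) = H_red m i (hom z) (hom u)"
  by (simp add: H_red_def hom_simps)

end

lemma fps_map_hom:
  assumes "comm_ring_hom \<phi>"
  shows "comm_ring_hom (\<lambda>F. Abs_fps (\<lambda>n. \<phi> (F $ n)))"
proof -
  interpret comm_ring_hom \<phi> by fact
  show ?thesis
    by unfold_locales (simp_all add: fps_eq_iff fps_mult_nth hom_simps fps_one_def)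
qed

definition const_x :: "rat fps \<Rightarrow> rat poly fps" where
  "const_x F = Abs_fps (\<lambda>n. [:F $ n:])"

interpretation const_x: comm_ring_hom const_x
proof -
  have "comm_ring_hom (\<lambda>a::rat. [:a:])"
    by unfold_locales (simp_all add: one_pCons)
  then show "comm_ring_hom const_x"
    using fps_map_hom unfolding const_x_def[abs_def] by blast
qed

interpretation at_x_1: comm_ring_hom at_x_1
proof -
  have "comm_ring_hom (\<lambda>p::rat poly. poly p 1)"
    by unfold_locales simp_all
  then show "comm_ring_hom at_x_1"
    using fps_map_hom unfolding at_x_1_def[abs_def] by blast
qed

interpretation emb_poly: comm_ring_hom emb_poly
proof -
  have "comm_ring_hom (to_fract :: rat poly \<Rightarrow> _)"
    by unfold_locales simp_all
  then show "comm_ring_hom emb_poly"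
    using fps_map_hom unfolding emb_poly_def[abs_def] by blast
qed

lemma at_x_1_const_x [simp]: "at_x_1 (const_x F) = F"
  by (simp add: at_x_1_def const_x_def fps_eq_iff)

lemma emb_poly_const_x: "emb_poly (const_x F) = emb_rat F"
  by (simp add: emb_poly_def const_x_def emb_rat_def)

lemma emb_poly_eq_iff: "emb_poly F = emb_poly G \<longleftrightarrow> F = G"
  by (simp add: emb_poly_def fps_eq_iff)

lemma const_x_fps_X: "const_x fps_X = fps_X"
  by (simp add: const_x_def fps_X_def fps_eq_iff)

lemma at_x_1_fps_X: "at_x_1 fps_X = fps_X"
  by (simp add: at_x_1_def fps_X_def fps_eq_iff)

lemma emb_poly_fps_X: "emb_poly fps_X = fps_X"
  by (simp add: emb_poly_def fps_X_def fps_eq_iff)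

text \<open>Contraction principle for the t-adic topology: iteration from 0 settles one more
  coefficient at each step.\<close>

lemma fps_fixpoint_ex1:
  fixes \<Phi> :: "'a::zero fps \<Rightarrow> 'a fps"
  assumes "\<And>f g n. (\<And>k. k < n \<Longrightarrow> f $ k = g $ k) \<Longrightarrow> \<Phi> f $ n = \<Phi> g $ n"
  shows "\<exists>!f. f = \<Phi> f"
proof (rule ex_ex1I)
  define F where "F n = (\<Phi> ^^ n) 0" for n
  \<comment> \<open>\<open>F n\<close> is final only below degree \<open>n\<close>, so degree
    \<open>n\<close> is read from \<open>F (Suc n)\<close>.\<close>
  define f where "f = Abs_fps (\<lambda>n. F (Suc n) $ n)"
  have stable: "k < n \<Longrightarrow> F n $ k = F (Suc n) $ k" for n k
  proof (induction n arbitrary: k)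
    case (Suc n)
    have "\<Phi> (F n) $ k = \<Phi> (F (Suc n)) $ k"
      by (rule assms) (use Suc in auto)
    then show ?case by (simp add: F_def)
  qed simp
  have F: "F (Suc k + d) $ k = f $ k" for k d
  proof (induction d)
    case (Suc d)
    then show ?case using stable[of k "Suc k + d"] by simp
  qed (simp add: f_def)
  have "f $ n = \<Phi> f $ n" for n
  proof -
    have "\<Phi> f $ n = \<Phi> (F n) $ n"
    proof (rule assms)
      fix k assume "k < n"
      then show "f $ k = F n $ k" using F[of k "n - Suc k"] by simp
    qed
    then show ?thesis by (simp add: f_def F_def)
  qed
  then show "\<exists>f. f = \<Phi> f" by (metis fps_ext)
next
  fix f g assume fg: "f = \<Phi> f" "g = \<Phi> g"
  have "f $ n = g $ n" for n
  proof (induction n rule: less_induct)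
    case (less n)
    then show ?case using assms[of n f g] fg by metis
  qed
  then show "f = g" by (rule fps_ext)
qed

lemma fps_mult_nth_cong:
  assumes "\<And>k. k \<le> n \<Longrightarrow> f $ k = f' $ k" "\<And>k. k \<le> n \<Longrightarrow> g $ k = g' $ k"
  shows "(f * g) $ n = (f' * g' :: 'a::comm_ring_1 fps) $ n"
  unfolding fps_mult_nth by (rule sum.cong) (use assms in auto)

lemma fps_power_nth_cong:
  assumes "\<And>k. k \<le> n \<Longrightarrow> f $ k = f' $ k"
  shows "(f ^ e) $ n = (f' ^ e :: 'a::comm_ring_1 fps) $ n"
  using assms
proof (induction e arbitrary: n)
  case (Suc e)
  then show ?case using fps_mult_nth_cong[of n f f' "f ^ e" "f' ^ e"] by simp
qed simp

text \<open>With \<open>y = 1\<close> this is the equation of \<open>U\<close>; with \<open>y = x\<close>, that of \<open>U / x\<close>.\<close>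

lemma kernel_fixpoint_ex1:
  fixes z y c :: "'a::comm_ring_1 fps"
  assumes "z $ 0 = 0"
  shows "\<exists>!f. f = c + z * (f * (\<Sum>e=0..m. (y * f) ^ e))"
proof (rule fps_fixpoint_ex1)
  fix f g :: "'a fps" and n
  assume fg: "\<And>k. k < n \<Longrightarrow> f $ k = g $ k"
  have eq: "(f * (\<Sum>e=0..m. (y * f) ^ e)) $ k = (g * (\<Sum>e=0..m. (y * g) ^ e)) $ k" if "k < n" for k
  proof (rule fps_mult_nth_cong)
    fix j assume j: "j \<le> k"
    then show "f $ j = g $ j" using fg that by simp
    have "((y * f) ^ e) $ j = ((y * g) ^ e) $ j" for e
    proof (rule fps_power_nth_cong)
      fix i assume "i \<le> j"
      then show "(y * f) $ i = (y * g) $ i"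
        using fg j that by (intro fps_mult_nth_cong) auto
    qed
    then show "(\<Sum>e=0..m. (y * f) ^ e) $ j = (\<Sum>e=0..m. (y * g) ^ e) $ j"
      by (simp add: fps_sum_nth)
  qed
  have "(z * (f * (\<Sum>e=0..m. (y * f) ^ e))) $ n = (z * (g * (\<Sum>e=0..m. (y * g) ^ e))) $ n"
    unfolding fps_mult_nth[of z]
  proof (rule sum.cong[OF refl])
    fix i assume "i \<in> {0..n}"
    then show "z $ i * (f * (\<Sum>e=0..m. (y * f) ^ e)) $ (n - i) = z $ i * (g * (\<Sum>e=0..m. (y * g) ^ e)) $ (n - i)"
      using assms eq[of "n - i"] by (cases "i = 0") auto
  qed
  then show "(c + z * (f * (\<Sum>e=0..m. (y * f) ^ e))) $ n = (c + z * (g * (\<Sum>e=0..m. (y * g) ^ e))) $ n"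
    by simp
qed

text \<open>\<open>Z\<close> is the compositional inverse of \<open>X (1 - X)^(m^2 + 2m)\<close>,
  whose linear coefficient is 1.\<close>

lemma Z_eqn_ex1: "\<exists>!Z. Z_eqn m Z"
proof -
  let ?f = "fps_X * (1 - fps_X) ^ (m\<^sup>2 + 2 * m) :: rat fps"
  have f: "?f $ 0 = 0" "?f $ 1 \<noteq> 0" by (simp_all add: fps_power_zeroth)
  have comp: "?f oo Z = Z * (1 - Z) ^ (m\<^sup>2 + 2 * m)" if "Z $ 0 = 0" for Z :: "rat fps"
    using that by (simp add: fps_compose_mult_distrib fps_compose_power[symmetric] fps_compose_sub_distrib)
  have inv0: "fps_inv ?f $ 0 = 0" by (simp add: fps_inv_def)
  show ?thesis
  proof (rule ex1I[of _ "fps_inv ?f"])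
    show "Z_eqn m (fps_inv ?f)"
      using fps_inv_right[OF f] comp[OF inv0] inv0 by (simp add: Z_eqn_def)
    fix Z assume "Z_eqn m Z"
    then have Z: "Z $ 0 = 0" "?f oo Z = fps_X" using comp by (auto simp: Z_eqn_def)
    have "fps_inv ?f oo (?f oo Z) = (fps_inv ?f oo ?f) oo Z"
      using fps_compose_assoc[OF Z(1) f(1)] .
    then show "Z = fps_inv ?f" using Z fps_inv[OF f] by simp
  qed
qed

text \<open>The equation of \<open>U\<close> without denominators. It makes sense over polynomials
  in \<open>x\<close> and is contracting, because every \<open>U\<close> on the right is multiplied
  by \<open>Z\<close>.\<close>

definition U_fixpoint :: "nat \<Rightarrow> rat fps \<Rightarrow> rat poly fps \<Rightarrow> bool" where
  "U_fixpoint m Z U \<longleftrightarrow>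
     U = fps_const [:0, 1:] * (1 - const_x Z) ^ (m + 2) + const_x Z * (U * (\<Sum>e=0..m. U ^ e))"

lemma U_fixpoint_nth_0:
  assumes "Z $ 0 = 0" "U_fixpoint m Z U"
  shows "U $ 0 = [:0, 1:]"
proof -
  have "U $ 0 = (fps_const [:0, 1:] * (1 - const_x Z) ^ (m + 2) + const_x Z * (U * (\<Sum>e=0..m. U ^ e))) $ 0"
    using assms(2) unfolding U_fixpoint_def by (rule arg_cong)
  also have "\<dots> = [:0, 1:]" using assms(1) by (simp add: fps_power_zeroth const_x_def)
  finally show ?thesis .
qed

lemma fps_eq_divide_unit:
  fixes g :: "'a::field fps"
  assumes "g $ 0 \<noteq> 0"
  shows "a = b / g * t \<longleftrightarrow> a * g = b * t"
proof -
  have inv: "inverse g * g = 1" using inverse_mult_eq_1[OF assms] .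
  have "b * inverse g * t * g = b * t * (inverse g * g)" "a = a * g * inverse g \<longleftrightarrow> a = a * (inverse g * g)"
    by (simp_all only: mult_ac)
  then have 1: "b * inverse g * t * g = b * t" and 2: "a * g * inverse g = a" using inv by simp_all
  have 3: "b * t * inverse g = b * inverse g * t" by (simp only: mult_ac)
  show ?thesis unfolding fps_divide_unit[OF assms] using 1 2 3 by metis
qed

lemma U_eqn_iff_fixpoint:
  assumes "Z $ 0 = 0"
  shows "U_eqn m Z U \<longleftrightarrow> U_fixpoint m Z U"
proof -
  let ?z = "emb_rat Z" and ?u = "emb_poly U"
  have z0: "?z $ 0 = 0" using assms by (simp add: emb_rat_def)
  have unit: "(1 - ?z) ^ (m + 2) $ 0 \<noteq> 0" using z0 by (simp add: fps_power_zeroth)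
  have x: "var_x = emb_poly (fps_const [:0, 1:])"
    by (simp add: var_x_def emb_poly_def fps_eq_iff)
  have ne1: "to_fract [:0, 1::rat:] \<noteq> 1"
    by (metis to_fract_1 to_fract_eq_iff one_pCons pCons_eq_iff zero_neq_one)
  have "U_fixpoint m Z U \<longleftrightarrow> ?u = var_x * (1 - ?z) ^ (m + 2) + ?z * (?u * (\<Sum>e=0..m. ?u ^ e))"
    unfolding U_fixpoint_def x
    by (subst emb_poly_eq_iff[symmetric]) (simp add: emb_poly.hom_simps emb_poly_const_x)
  also have "\<dots> \<longleftrightarrow> var_x * (1 - ?z) ^ (m + 2) = ?u * (1 - ?z * (\<Sum>e=0..m. ?u ^ e))"
    by (auto simp: algebra_simps)
  finally have fixp: "U_fixpoint m Z U \<longleftrightarrow> \<dots>" .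
  have eqn: "U_eqn m Z U \<longleftrightarrow> var_x * (1 - ?z) ^ (m + 2) = ?u * (1 - ?z * ((?u ^ (m + 1) - 1) / (?u - 1)))"
  proof -
    have "var_x = ?u / (1 - ?z) ^ (m + 2) * t \<longleftrightarrow> var_x * (1 - ?z) ^ (m + 2) = ?u * t" for t
      by (rule fps_eq_divide_unit[OF unit])
    then show ?thesis by (simp add: U_eqn_def Let_def)
  qed
  show ?thesis
  proof (cases "?u = 1")
    \<comment> \<open>With the quotient equal to 0 the equation reads
      \<open>x (1 - z)^(m+2) = 1\<close>, which fails at \<open>t = 0\<close>.\<close>
    case True
    then have "U $ 0 = 1"
      by (metis emb_poly.hom_one emb_poly_eq_iff fps_one_nth)
    then have "\<not> U_fixpoint m Z U" using U_fixpoint_nth_0[OF assms, of m U] by (auto simp: one_pCons)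
    moreover have "\<not> U_eqn m Z U"
    proof
      assume "U_eqn m Z U"
      then have "var_x * (1 - ?z) ^ (m + 2) = 1" unfolding eqn using True by simp
      then have "(var_x * (1 - ?z) ^ (m + 2)) $ 0 = 1" by simp
      then show False using z0 ne1 by (simp add: var_x_def fps_power_zeroth)
    qed
    ultimately show ?thesis by simp
  next
    case False
    have "?u ^ (m + 1) - 1 = (?u - 1) * (\<Sum>e=0..m. ?u ^ e)"
      using diff_power_eq_sum[of ?u m 1] by (simp add: atLeast0AtMost lessThan_Suc_atMost)
    then have "(?u ^ (m + 1) - 1) / (?u - 1) = (\<Sum>e=0..m. ?u ^ e)"
      using False by simp
    then show ?thesis using eqn fixp by simp
  qed
qed

lemma U_fixpoint_ex1:
  assumes "Z $ 0 = 0"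
  shows "\<exists>!U. U_fixpoint m Z U"
  using kernel_fixpoint_ex1[where z = "const_x Z" and c = "fps_const [:0, 1:] * (1 - const_x Z) ^ (m + 2)" and m = m and y = 1] assms
  unfolding U_fixpoint_def by (simp add: const_x_def)

text \<open>Divisibility of \<open>U\<close> by \<open>x\<close>: the quotient \<open>V\<close> is
  built from its own fixed-point equation, and then \<open>x V\<close> is \<open>U\<close> by
  uniqueness.\<close>

lemma U_fixpoint_factor:
  assumes "Z $ 0 = 0" "U_fixpoint m Z U"
  obtains V where "U = fps_const [:0, 1:] * V"
    "V * (1 - const_x Z * (\<Sum>e=0..m. U ^ e)) = (1 - const_x Z) ^ (m + 2)"
proof -
  let ?x = "fps_const [:0, 1::rat:]"
  obtain V where V: "V = (1 - const_x Z) ^ (m + 2) + const_x Z * (V * (\<Sum>e=0..m. (?x * V) ^ e))"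
    using kernel_fixpoint_ex1[where z = "const_x Z" and c = "(1 - const_x Z) ^ (m + 2)" and m = m and y = ?x] assms by (auto simp: const_x_def)
  then have "?x * V = ?x * ((1 - const_x Z) ^ (m + 2) + const_x Z * (V * (\<Sum>e=0..m. (?x * V) ^ e)))"
    by (rule arg_cong)
  also have "\<dots> = ?x * (1 - const_x Z) ^ (m + 2) + const_x Z * ((?x * V) * (\<Sum>e=0..m. (?x * V) ^ e))"
    by (simp only: distrib_left mult_ac)
  finally have "U_fixpoint m Z (?x * V)" unfolding U_fixpoint_def .
  then have U: "U = ?x * V" using assms U_fixpoint_ex1 by blast
  have "V * (1 - const_x Z * (\<Sum>e=0..m. U ^ e)) = V - const_x Z * (V * (\<Sum>e=0..m. (?x * V) ^ e))"
    unfolding U by (simp only: right_diff_distrib mult_ac mult_1_left)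
  also have "\<dots> = (1 - const_x Z) ^ (m + 2)" using V by (metis add_diff_cancel_right')
  finally show thesis using that U by blast
qed

text \<open>At \<open>x = 1\<close> the fixed-point equation has the explicit solution
  \<open>1 - Z\<close>, because \<open>Z\<close> times the geometric sum collapses to
  \<open>1 - (1 - Z)^(m+1)\<close>.\<close>

lemma at_x_1_U:
  assumes "Z $ 0 = 0" "U_fixpoint m Z U"
  shows "at_x_1 U = 1 - Z"
proof -
  let ?P = "\<lambda>f. f = (1 - Z) ^ (m + 2) + Z * (f * (\<Sum>e=0..m. (1 * f) ^ e))"
  have x: "at_x_1 (fps_const [:0, 1:]) = 1" by (simp add: at_x_1_def fps_eq_iff)
  have "at_x_1 U = at_x_1 (fps_const [:0, 1:] * (1 - const_x Z) ^ (m + 2) + const_x Z * (U * (\<Sum>e=0..m. U ^ e)))"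
    using assms(2) unfolding U_fixpoint_def by (rule arg_cong)
  then have "?P (at_x_1 U)" by (simp add: at_x_1.hom_simps x)
  moreover have "?P (1 - Z)"
  proof -
    have "Z * (\<Sum>e=0..m. (1 - Z) ^ e) = 1 - (1 - Z) ^ (m + 1)"
      using diff_power_eq_sum[of "1 - Z" m 1] by (simp add: atLeast0AtMost lessThan_Suc_atMost algebra_simps)
    then have "Z * ((1 - Z) * (\<Sum>e=0..m. (1 * (1 - Z)) ^ e)) = (1 - Z) * (1 - (1 - Z) ^ (m + 1))"
      by (simp only: mult_1_left mult.left_commute[of Z "1 - Z"])
    then show ?thesis by (simp add: algebra_simps)
  qed
  ultimately show ?thesis using kernel_fixpoint_ex1[OF assms(1), where c = "(1 - Z) ^ (m + 2)" and m = m and y = 1] by blast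
qed

section \<open>Decomposition of intervals\<close>

definition trunc_intervals :: "nat \<Rightarrow> nat \<Rightarrow> nat \<Rightarrow> (step list \<times> step list) set" where
  "trunc_intervals m i n = {(v, w) \<in> tamari_intervals m n. truncated m i v}"

lemma length_eq_counts: "length w = count_list w Up + count_list w Down"
proof (induction w)
  case (Cons x w)
  then show ?case by (cases x) auto
qed simp

lemma finite_dyck_paths: "finite (dyck_paths m n)"
proof -
  have "dyck_paths m n \<subseteq> {w. set w \<subseteq> {Up, Down} \<and> length w = n + m * n}"
    unfolding dyck_paths_def by (auto simp: length_eq_counts intro: step.exhaust)
  then show ?thesis
    by (rule finite_subset) (rule finite_lists_length_eq, simp)
qed

lemma finite_tamari_intervals: "finite (tamari_intervals m n)"
  by (rule finite_subset[of _ "dyck_paths m n \<times> dyck_paths m n"])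
     (auto simp: tamari_intervals_def finite_dyck_paths)

lemma finite_trunc_intervals: "finite (trunc_intervals m i n)"
  by (rule finite_subset[OF _ finite_tamari_intervals]) (auto simp: trunc_intervals_def)

lemma trunc_intervals_iff:
  "(v, w) \<in> trunc_intervals m i n \<longleftrightarrow>
    is_dyck m v \<and> count_list v Up = n \<and> tamari_le m v w \<and> truncated m i v"
  unfolding trunc_intervals_def tamari_intervals_def dyck_paths_eq
  using tamari_le_is_dyck tamari_le_count by auto

lemma truncated_starts_Up:
  assumes "truncated m i v"
  shows "\<exists>c. v = Up # c"
  using assms unfolding truncated_def D_word_def by auto

lemma J_bar_nth: "J_bar m i $ n = (\<Sum>(v, w)\<in>trunc_intervals m i n. monom 1 (final_descent w))"
proof (cases "n = 0")
  case True
  have "trunc_intervals m i 0 = {}"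
    using truncated_starts_Up by (fastforce simp: trunc_intervals_iff)
  then show ?thesis using True by (simp add: J_bar_def)
next
  case False
  then show ?thesis by (simp add: J_bar_def trunc_intervals_def truncated_def)
qed

lemma J_bar_nth_0: "J_bar m i $ 0 = 0"
  by (simp add: J_bar_def)

lemma J_bar_last: "J_bar m (m + 1) = I_bar m"
proof (rule fps_ext)
  fix n
  show "J_bar m (m + 1) $ n = I_bar m $ n"
  proof (cases "n = 0")
    case False
    then have "trunc_intervals m (m + 1) n = tamari_intervals m n"
      unfolding trunc_intervals_def truncated_last_iff tamari_intervals_def dyck_paths_eq by auto
    then show ?thesis using False J_bar_nth[of m "m + 1" n] by (simp add: I_bar_def)
  qed (simp add: J_bar_def I_bar_def)
qed

section \<open>Final descents and uniqueness of the decomposition\<close>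

lemma final_descent_append_Downs:
  "final_descent (a @ replicate h Down) = h + final_descent a"
  by (simp add: final_descent_def takeWhile_append)

lemma final_descent_append:
  assumes "Up \<in> set p"
  shows "final_descent (a @ p) = final_descent p"
  using assms takeWhile_append1[of Up "rev p" "\<lambda>s. s = Down" "rev a"] by (simp add: final_descent_def)

lemma final_descent_split:
  assumes "h \<le> final_descent w"
  shows "\<exists>c. w = c @ replicate h Down"
proof -
  let ?d = "final_descent w"
  have "takeWhile (\<lambda>s. s = Down) (rev w) = replicate ?d Down"
    unfolding final_descent_def by (rule replicate_length_same[symmetric]) (auto dest: set_takeWhileD)
  then have "rev w = replicate ?d Down @ dropWhile (\<lambda>s. s = Down) (rev w)"
    by (metis takeWhile_dropWhile_id)
  then have "w = rev (dropWhile (\<lambda>s. s = Down) (rev w)) @ replicate ?d Down"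
    by (metis rev_append rev_replicate rev_rev_ident)
  moreover have "replicate ?d Down = replicate (?d - h) Down @ replicate h Down"
    using assms by (metis le_add_diff_inverse2 replicate_add)
  ultimately show ?thesis by (metis append_assoc)
qed

lemma Up_in_prime_dyck: "prime_dyck m p \<Longrightarrow> Up \<in> set p"
  by (metis list.set_intros(1) prime_dyck_Cons)

lemma length_is_dyck:
  assumes "is_dyck m w"
  shows "length w = (m + 1) * count_list w Up"
proof -
  have "int (count_list w Down) = int (m * count_list w Up)"
    using is_dyckD(1)[OF assms] by (simp add: height_def)
  then show ?thesis unfolding length_eq_counts by (simp only: of_nat_eq_iff) simp
qed

text \<open>Equal sizes give equal lengths. If \<open>e > 0\<close>, the suffix \<open>p\<close>
  would fit into what follows the initial \<open>Up\<close> of \<open>p'\<close> and so contain too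
  few letters \<open>Up\<close>.\<close>

lemma prime_dyck_shift_Downs:
  assumes "prime_dyck m p" "prime_dyck m p'" "count_list p Up = count_list p' Up"
    "c @ p = c' @ p' @ replicate e Down"
  shows "e = 0"
proof (rule ccontr)
  assume "e \<noteq> 0"
  obtain y where y: "p' = Up # y" using prime_dyck_Cons[OF assms(2)] .
  have "length p = length p'"
    using length_is_dyck assms(1-3) prime_dyck_is_dyck by metis
  then have len: "length p \<le> length (y @ replicate e Down)" using y \<open>e \<noteq> 0\<close> by simp
  have eq: "c @ p = (c' @ [Up]) @ (y @ replicate e Down)" using assms(4) y by simp
  have "\<exists>f. y @ replicate e Down = f @ p"
  proof (rule append_eq_appendE[OF eq])
    fix f assume "f \<noteq> []" "p = f @ y @ replicate e Down"
    then show ?thesis using len by simp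
  next
    fix f assume "f @ p = y @ replicate e Down"
    then show ?thesis by metis
  qed
  then obtain f where "y @ replicate e Down = f @ p" by blast
  then have "count_list (y @ replicate e Down) Up = count_list (f @ p) Up" by simp
  then have "count_list y Up + count_list (replicate e Down) Up = count_list f Up + count_list p Up"
    by simp
  moreover have "count_list (replicate e Down) Up = 0" by (induction e) auto
  ultimately show False using assms(3) y by simp
qed

text \<open>A word may split as \<open>c p 0^h\<close> with primes of several sizes, but in only one
  way for a given size. The size of \<open>p\<close> is that of \<open>q\<close>, which the lower
  path reveals.\<close>

lemma prime_dyck_Downs_unique:
  assumes "prime_dyck m p" "prime_dyck m p'" "count_list p Up = count_list p' Up"
    "c @ p @ replicate h Down = c' @ p' @ replicate h' Down"
  shows "c = c'" "p = p'" "h = h'"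
proof -
  have aux: "h = h'" if "prime_dyck m p" "prime_dyck m p'" "count_list p Up = count_list p' Up"
    "c @ p @ replicate h Down = c' @ p' @ replicate h' Down" "h \<le> h'" for p p' c c' h h'
  proof -
    have "replicate h' Down = replicate (h' - h) Down @ replicate h Down"
      using that(5) by (metis le_add_diff_inverse2 replicate_add)
    then have "c @ p = c' @ p' @ replicate (h' - h) Down" using that(4) by simp
    then show ?thesis using prime_dyck_shift_Downs[OF that(1-3)] that(5) by force
  qed
  show "h = h'"
  proof (cases "h \<le> h'")
    case False
    then show ?thesis using aux[OF assms(2,1) assms(3)[symmetric] assms(4)[symmetric]] by simp
  qed (use aux[OF assms] in simp)
  then have "c @ p = c' @ p'" using assms(4) by simp
  from prime_dyck_suffix_unique[OF assms(1,2) this] show "c = c'" "p = p'" by auto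
qed

text \<open>Cutting by length makes the result a function of \<open>w\<close> and \<open>h\<close>;
  it is meant for \<open>w\<close> ending with \<open>h\<close> Downs.\<close>

definition insert_before :: "nat \<Rightarrow> step list \<Rightarrow> step list \<Rightarrow> step list" where
  "insert_before h w p = take (length w - h) w @ p @ replicate h Down"

lemma insert_before_eq [simp]:
  "insert_before h (c @ replicate h Down) p = c @ p @ replicate h Down"
  by (simp add: insert_before_def)

lemma trunc_interval_stem:
  assumes "1 \<le> i" "i \<le> m + 1" "r = m + 1 - i" "(v, w) \<in> trunc_intervals m i n"
  obtains a c where "stem m r a" "v = a @ replicate r Down" "w = c @ replicate r Down" "r \<le> final_descent w"
    "tamari_le m v w" "count_list v Up = n"
proof -
  have vw: "tamari_le m v w" "count_list v Up = n" "truncated m i v"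
    using assms(4) unfolding trunc_intervals_iff by auto
  then obtain a where a: "stem m r a" "v = a @ replicate r Down"
    using truncated_iff_stem assms(1-3) by blast
  obtain c where "w = c @ replicate r Down"
    using stem_le_lift[of m a r w "[]"] a vw(1) by auto
  then show thesis using that a vw final_descent_append_Downs by simp
qed

text \<open>Here \<open>k\<close> is the size of the inserted factor, \<open>A\<close> and
  \<open>B\<close> are the two smaller intervals, and \<open>h\<close> tells how many final Downs of
  the upper path of \<open>A\<close> stand behind the inserted \<open>p\<close>. The set difference
  removes the paths whose \<open>i\<close>-th component is empty.\<close>

lemma trunc_intervals_bij:
  assumes "1 \<le> m" "1 \<le> i" "i \<le> m + 1" "r = m + 1 - i"
  shows "bij_betw (\<lambda>(k, (v, w), (q, p), h). (insert_before r v q, insert_before h w p))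
    (SIGMA k:{0..n}. SIGMA A:trunc_intervals m i (n - k). SIGMA B:trunc_intervals m m k. {r..final_descent (snd A)})
    (trunc_intervals m i n - trunc_intervals m (i - 1) n)" (is "bij_betw ?f ?A ?B")
proof (rule bij_betwI')
  fix x y assume "x \<in> ?A" "y \<in> ?A"
  obtain k v w q p h where x: "x = (k, (v, w), (q, p), h)" by (metis prod.exhaust)
  obtain k' v' w' q' p' h' where y: "y = (k', (v', w'), (q', p'), h')" by (metis prod.exhaust)
  have vw: "(v, w) \<in> trunc_intervals m i (n - k)" "(q, p) \<in> trunc_intervals m m k" "r \<le> h" "h \<le> final_descent w"
    using \<open>x \<in> ?A\<close> x by auto
  have vw': "(v', w') \<in> trunc_intervals m i (n - k')" "(q', p') \<in> trunc_intervals m m k'" "r \<le> h'" "h' \<le> final_descent w'"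
    using \<open>y \<in> ?A\<close> y by auto
  obtain a where a: "v = a @ replicate r Down" using trunc_interval_stem[OF assms(2-4) vw(1)] by blast
  obtain a' where a': "v' = a' @ replicate r Down" using trunc_interval_stem[OF assms(2-4) vw'(1)] by blast
  obtain c where c: "w = c @ replicate h Down" using final_descent_split[OF vw(4)] by blast
  obtain c' where c': "w' = c' @ replicate h' Down" using final_descent_split[OF vw'(4)] by blast
  have q: "prime_dyck m q" "prime_dyck m q'" "count_list q Up = k" "count_list q' Up = k'"
    "tamari_le m q p" "tamari_le m q' p'"
    using vw(2) vw'(2) truncated_prime_iff[OF assms(1)] by (auto simp: trunc_intervals_iff)
  have p: "prime_dyck m p" "prime_dyck m p'" "count_list p Up = k" "count_list p' Up = k'"
    using q tamari_le_prime tamari_le_count by metis+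
  show "(?f x = ?f y) = (x = y)"
  proof
    assume "?f x = ?f y"
    then have e1: "a @ q @ replicate r Down = a' @ q' @ replicate r Down"
      and e2: "c @ p @ replicate h Down = c' @ p' @ replicate h' Down"
      unfolding x y a a' c c' by simp_all
    \<comment> \<open>The lower paths determine \<open>q\<close>, hence the size \<open>k\<close>
      that makes the upper decomposition unique.\<close>
    from e1 have "a @ q = a' @ q'" by simp
    then have 1: "a = a'" "q = q'" using prime_dyck_suffix_unique[OF q(1,2)] by auto
    then have "k = k'" using q by simp
    then have "c = c'" "p = p'" "h = h'" using prime_dyck_Downs_unique[OF p(1,2) _ e2] p by auto
    then show "x = y" using 1 \<open>k = k'\<close> by (simp add: x y a a' c c')
  qed simp
next
  fix x assume "x \<in> ?A"
  obtain k v w q p h where x: "x = (k, (v, w), (q, p), h)" by (metis prod.exhaust)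
  have vw: "(v, w) \<in> trunc_intervals m i (n - k)" "(q, p) \<in> trunc_intervals m m k" "r \<le> h" "h \<le> final_descent w" "k \<le> n"
    using \<open>x \<in> ?A\<close> x by auto
  obtain a where a: "stem m r a" "v = a @ replicate r Down" "tamari_le m v w" "count_list v Up = n - k"
    using trunc_interval_stem[OF assms(2-4) vw(1)] by metis
  obtain c where c: "w = c @ replicate h Down" using final_descent_split[OF vw(4)] by blast
  have q: "prime_dyck m q" "count_list q Up = k" "tamari_le m q p"
    using vw(2) truncated_prime_iff[OF assms(1)] by (auto simp: trunc_intervals_iff)
  let ?v = "a @ q @ replicate r Down"
  have "tamari_le m ?v (c @ p @ replicate h Down)"
    using tamari_le_insert_iff[OF a(1) q(1)] vw(3) q(3) a(2,3) c by blast
  moreover have "is_dyck m ?v"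
    using is_dyck_insert prime_dyck_is_dyck[OF q(1)] stem_is_dyck[OF a(1)] by blast
  moreover have "count_list ?v Up = n"
    using a(2,4) q(2) vw(5) by simp
  moreover have "truncated m i ?v \<and> \<not> truncated m (i - 1) ?v"
    using truncated_diff_iff[OF assms(2-4)] a(1) q(1) by blast
  ultimately have "(?v, c @ p @ replicate h Down) \<in> ?B"
    by (simp add: trunc_intervals_iff)
  then show "?f x \<in> ?B" unfolding x a(2) c by simp
next
  fix y assume "y \<in> ?B"
  obtain v w where y: "y = (v, w)" by fastforce
  have vw: "is_dyck m v" "count_list v Up = n" "tamari_le m v w" "truncated m i v \<and> \<not> truncated m (i - 1) v"
    using \<open>y \<in> ?B\<close> unfolding y by (auto simp: trunc_intervals_iff)
  obtain a q where a: "stem m r a" and q: "prime_dyck m q" and v: "v = a @ q @ replicate r Down"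
    using vw(4) unfolding truncated_diff_iff[OF assms(2-4)] by blast
  obtain c p h where w: "w = c @ p @ replicate h Down" "r \<le> h" "tamari_le m q p"
    "tamari_le m (a @ replicate r Down) (c @ replicate h Down)"
    using vw(3) unfolding v tamari_le_insert_iff[OF a q] by blast
  let ?k = "count_list q Up" and ?v = "a @ replicate r Down" and ?w = "c @ replicate h Down"
  have "truncated m i ?v" using truncated_iff_stem assms a by blast
  then have "(?v, ?w) \<in> trunc_intervals m i (n - ?k)"
    using stem_is_dyck[OF a] w(4) vw(2) v by (simp add: trunc_intervals_iff)
  moreover have "(q, p) \<in> trunc_intervals m m ?k"
    using q w(3) truncated_prime_iff[OF assms(1)] prime_dyck_is_dyck by (simp add: trunc_intervals_iff)
  moreover have "?k \<le> n" using vw(2) v by simp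
  moreover have "h \<le> final_descent ?w" by (simp add: final_descent_append_Downs)
  ultimately have "(?k, (?v, ?w), (q, p), h) \<in> ?A" using w(2) by simp
  moreover have "y = ?f (?k, (?v, ?w), (q, p), h)" using y v w by simp
  ultimately show "\<exists>x\<in>?A. y = ?f x" by blast
qed

lemma monom_one: "monom 1 n = [:0, 1::rat:] ^ n"
  by (simp add: monom_altdef)

lemma geometric_sum_interval:
  fixes x :: "'a::comm_ring_1"
  assumes "r \<le> d"
  shows "(x - 1) * (\<Sum>h=r..d. x ^ h) = x ^ Suc d - x ^ r"
  using assms
proof (induction d rule: dec_induct)
  case (step d)
  then show ?case by (simp add: algebra_simps)
qed (simp add: algebra_simps)

text \<open>The difference on the left counts the new paths. Each pair of smaller intervals
  contributes \<open>x^d(p)\<close> times the sum of \<open>x^h\<close> for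
  \<open>r \<le> h \<le> d(w)\<close>; multiplying by \<open>x - 1\<close> gives
  \<open>x^(d(w)+1) - x^r\<close>, and the summand \<open>x^r\<close>, the same for all intervals,
  produces the value at 1.\<close>

lemma J_bar_step:
  fixes m i r :: nat
  defines "x \<equiv> fps_const [:0, 1:]"
  assumes "1 \<le> m" "1 \<le> i" "i \<le> m + 1" "r = m + 1 - i"
  shows "(x - 1) * (J_bar m i - J_bar m (i - 1)) = J_bar m m * (x * J_bar m i - x ^ r * const_x (at_x_1 (J_bar m i)))"
proof (rule fps_ext)
  fix n
  let ?X = "[:0, 1::rat:]"
  let ?T = "trunc_intervals m"
  let ?F = "\<lambda>n. \<Sum>(v, w)\<in>?T i n. \<Sum>h=r..final_descent w. ?X ^ h"
  have sub: "?T (i - 1) n \<subseteq> ?T i n"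
    using truncated_mono[OF assms(3,4)] unfolding trunc_intervals_def by auto
  have "J_bar m i $ n - J_bar m (i - 1) $ n = (\<Sum>(v, w)\<in>?T i n - ?T (i - 1) n. ?X ^ final_descent w)"
    unfolding J_bar_nth monom_one
    by (subst sum_diff[OF finite_trunc_intervals sub]) simp
  also have "\<dots> = (\<Sum>(k, (v, w), (q, p), h)\<in>(SIGMA k:{0..n}. SIGMA A:?T i (n - k). SIGMA B:?T m k. {r..final_descent (snd A)}).
      ?X ^ final_descent (insert_before h w p))"
    using sum.reindex_bij_betw[OF trunc_intervals_bij[OF assms(2-5)],
        of "\<lambda>(v, w). ?X ^ final_descent w" n, symmetric]
    by (simp add: case_prod_unfold)
  also have "\<dots> = (\<Sum>k=0..n. \<Sum>A\<in>?T i (n - k). \<Sum>B\<in>?T m k. \<Sum>h=r..final_descent (snd A).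
      ?X ^ final_descent (insert_before h (snd A) (snd B)))"
    by (simp add: sum.Sigma finite_trunc_intervals case_prod_unfold)
  also have "\<dots> = (\<Sum>k=0..n. \<Sum>A\<in>?T i (n - k). \<Sum>B\<in>?T m k. \<Sum>h=r..final_descent (snd A).
      ?X ^ final_descent (snd B) * ?X ^ h)"
  proof (intro sum.cong refl)
    fix k A B h assume B: "B \<in> ?T m k" and h: "h \<in> {r..final_descent (snd A)}"
    obtain q p where qp: "B = (q, p)" by fastforce
    have "prime_dyck m q" "tamari_le m q p"
      using B truncated_prime_iff[OF assms(2)] by (auto simp: trunc_intervals_iff qp)
    \<comment> \<open>The letter \<open>Up\<close> inside \<open>p\<close> stops the final descent,
      which is therefore \<open>h + d(p)\<close> whatever \<open>c\<close> is.\<close>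
    then have "Up \<in> set p" using tamari_le_prime Up_in_prime_dyck by blast
    moreover obtain c where "snd A = c @ replicate h Down" using final_descent_split h by (metis atLeastAtMost_iff)
    ultimately have "final_descent (insert_before h (snd A) (snd B)) = h + final_descent (snd B)"
      using final_descent_append_Downs[of "c @ p" h] by (simp add: qp final_descent_append)
    then show "?X ^ final_descent (insert_before h (snd A) (snd B)) = ?X ^ final_descent (snd B) * ?X ^ h"
      by (simp only: power_add mult.commute)
  qed
  also have "\<dots> = (\<Sum>k=0..n. J_bar m m $ k * ?F (n - k))"
    unfolding J_bar_nth monom_one case_prod_unfold
    by (simp only: sum_distrib_left[symmetric] sum_distrib_right[symmetric])
  finally have *: "J_bar m i $ n - J_bar m (i - 1) $ n = (\<Sum>k=0..n. J_bar m m $ k * ?F (n - k))" .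
  have F: "(?X - 1) * ?F j = ?X * J_bar m i $ j - ?X ^ r * [:poly (J_bar m i $ j) 1:]" for j
  proof -
    have "[:poly (J_bar m i $ j) 1:] = (\<Sum>(v, w)\<in>?T i j. 1)"
      unfolding J_bar_nth by (simp add: poly_sum case_prod_unfold poly_monom of_nat_poly)
    then have R: "?X * J_bar m i $ j - ?X ^ r * [:poly (J_bar m i $ j) 1:]
      = (\<Sum>(v, w)\<in>?T i j. ?X ^ Suc (final_descent w) - ?X ^ r)"
      unfolding J_bar_nth monom_one case_prod_unfold by (simp only: sum_distrib_left sum_subtractf power_Suc mult_1_right)
    have "(?X - 1) * ?F j = (\<Sum>(v, w)\<in>?T i j. (?X - 1) * (\<Sum>h=r..final_descent w. ?X ^ h))"
      by (simp only: sum_distrib_left case_prod_unfold)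
    also have "\<dots> = (\<Sum>(v, w)\<in>?T i j. ?X ^ Suc (final_descent w) - ?X ^ r)"
    proof (intro sum.cong refl, clarify)
      fix v w assume "(v, w) \<in> ?T i j"
      then have "r \<le> final_descent w" using trunc_interval_stem[OF assms(3-5)] by blast
      then show "(?X - 1) * (\<Sum>h=r..final_descent w. ?X ^ h) = ?X ^ Suc (final_descent w) - ?X ^ r"
        by (rule geometric_sum_interval)
    qed
    finally show ?thesis using R by simp
  qed
  have xr: "x ^ r = fps_const (?X ^ r)" unfolding x_def by (simp only: fps_const_power)
  have x1: "x - 1 = fps_const (?X - 1)" unfolding x_def by (simp only: fps_const_1_eq_1[symmetric] fps_const_sub)
  have "((x - 1) * (J_bar m i - J_bar m (i - 1))) $ n = (?X - 1) * (J_bar m i $ n - J_bar m (i - 1) $ n)"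
    unfolding x1 by (simp only: fps_mult_left_const_nth fps_sub_nth)
  also have "\<dots> = (\<Sum>k=0..n. J_bar m m $ k * ((?X - 1) * ?F (n - k)))"
    unfolding * by (simp only: sum_distrib_left mult.left_commute)
  also have "\<dots> = (J_bar m m * (x * J_bar m i - x ^ r * const_x (at_x_1 (J_bar m i)))) $ n"
    unfolding fps_mult_nth F xr
    unfolding x_def fps_mult_left_const_nth fps_sub_nth by (simp add: const_x_def at_x_1_def)
  finally show "((x - 1) * (J_bar m i - J_bar m (i - 1))) $ n
    = (J_bar m m * (x * J_bar m i - x ^ r * const_x (at_x_1 (J_bar m i)))) $ n" .
qed

text \<open>The only lower path is \<open>1 0^m\<close>; it has no valley, so nothing else lies
  above it.\<close>

lemma J_bar_0: "J_bar m 0 = fps_const ([:0, 1:] ^ m) * fps_X"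
proof (rule fps_ext)
  fix n
  let ?v = "Up # replicate m Down"
  have le: "w = ?v" if "tamari_le m ?v w" for w
    using that
  proof (induction rule: tamari_le_induct)
    case (step u w)
    then have "tamari_cover m ?v w" by simp
    then obtain a s b where s: "?v = a @ [Down] @ s @ b" "prime_dyck m s"
      unfolding tamari_cover_iff by blast
    then obtain a' where "replicate m Down = a' @ [Down] @ s @ b" by (cases a) auto
    then show ?case using not_prime_prefix_Downs[OF s(2), of m "a' @ [Down]" b] by simp
  qed simp
  have dy: "is_dyck m ?v" using stem_is_dyck[of m m "[Up]"] by (auto simp: stem_def Cons_eq_append_conv)
  have "count_list (replicate m Down) Up = 0" by (induction m) auto
  then have "trunc_intervals m 0 n = (if n = 1 then {(?v, ?v)} else {})"
    using le dy by (auto simp: trunc_intervals_iff truncated_0_iff)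
  moreover have "final_descent ?v = m"
    using final_descent_append_Downs[of "[Up]" m] by (simp add: final_descent_def)
  ultimately show "J_bar m 0 $ n = (fps_const ([:0, 1:] ^ m) * fps_X) $ n"
    unfolding J_bar_nth by (simp add: monom_one)
qed

section \<open>Solution of the functional equations\<close>

text \<open>The equations in abstract form, to be met by the counted series and by the candidate
  alike. The vanishing constant terms are what lets them determine their solution.\<close>

definition tamari_system :: "nat \<Rightarrow> (nat \<Rightarrow> rat poly fps) \<Rightarrow> bool" where
  "tamari_system m F \<longleftrightarrow>
     (\<forall>i. F i $ 0 = 0) \<and> F 0 = fps_const ([:0, 1:] ^ m) * fps_X \<and>
     (\<forall>i. 1 \<le> i \<longrightarrow> i \<le> m + 1 \<longrightarrow>
        (fps_const [:0, 1:] - 1) * (F i - F (i - 1)) =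
        F m * (fps_const [:0, 1:] * F i - fps_const [:0, 1:] ^ (m + 1 - i) * const_x (at_x_1 (F i))))"

text \<open>Induction on the degree \<open>n\<close>, with one on \<open>i\<close> inside. In the
  product the terms with \<open>k = 0\<close> and \<open>k = n\<close> vanish, the others agree by
  the outer hypothesis, and \<open>x - 1\<close> cancels because polynomials form a domain.\<close>

lemma tamari_system_unique:
  assumes "tamari_system m F" "tamari_system m G" "i \<le> m + 1"
  shows "F i = G i"
proof -
  define R where "R F i = fps_const [:0, 1:] * F i - fps_const [:0, 1:] ^ (m + 1 - i) * const_x (at_x_1 (F i))"
    for F :: "nat \<Rightarrow> rat poly fps" and i
  have R_nth: "R F i $ j = [:0, 1:] * F i $ j - [:0, 1:] ^ (m + 1 - i) * [:poly (F i $ j) 1:]" for F i j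
    by (simp add: R_def const_x_def at_x_1_def)
  have "\<forall>i\<le>m + 1. F i $ n = G i $ n" for n
  proof (induction n rule: less_induct)
    case (less n)
    have "F i $ n = G i $ n" if "i \<le> m + 1" for i
      using that
    proof (induction i)
      case 0
      then show ?case using assms(1,2) by (simp add: tamari_system_def)
    next
      case (Suc i)
      have step: "([:0, 1:] - 1) * (S (Suc i) $ n - S i $ n) = (\<Sum>k=0..n. S m $ k * R S (Suc i) $ (n - k))"
        if "tamari_system m S" for S
      proof -
        have "(fps_const [:0, 1:] - 1) * (S (Suc i) - S i) = S m * R S (Suc i)"
          using that Suc.prems unfolding tamari_system_def R_def by (metis diff_Suc_1 le_add1 plus_1_eq_Suc)
        then have "((fps_const [:0, 1:] - 1) * (S (Suc i) - S i)) $ n = (S m * R S (Suc i)) $ n"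
          by (rule arg_cong)
        moreover have "fps_const [:0, 1:] - 1 = fps_const ([:0, 1:] - 1 :: rat poly)"
          by (simp only: fps_const_1_eq_1[symmetric] fps_const_sub)
        ultimately show ?thesis by (simp only: fps_mult_left_const_nth fps_sub_nth fps_mult_nth[of "S m"])
      qed
      have "(\<Sum>k=0..n. F m $ k * R F (Suc i) $ (n - k)) = (\<Sum>k=0..n. G m $ k * R G (Suc i) $ (n - k))"
      proof (rule sum.cong[OF refl])
        fix k assume "k \<in> {0..n}"
        then consider "k = 0" | "k = n" | "0 < k" "k < n" by fastforce
        then show "F m $ k * R F (Suc i) $ (n - k) = G m $ k * R G (Suc i) $ (n - k)"
        proof cases
          case 3
          then have "F m $ k = G m $ k" "F (Suc i) $ (n - k) = G (Suc i) $ (n - k)"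
            using less Suc.prems by auto
          then show ?thesis unfolding R_nth by simp
        qed (use assms(1,2) in \<open>auto simp: tamari_system_def R_nth\<close>)
      qed
      then have "([:0, 1:] - 1) * (F (Suc i) $ n - F i $ n) = ([:0, 1:] - 1) * (G (Suc i) $ n - G i $ n)"
        using step[OF assms(1)] step[OF assms(2)] by simp
      moreover have "[:0, 1:] - 1 \<noteq> (0 :: rat poly)" by (simp add: one_pCons)
      ultimately have "F (Suc i) $ n - F i $ n = G (Suc i) $ n - G i $ n"
        by (simp only: mult_cancel_left) simp
      then show ?case using Suc by simp
    qed
    then show ?case by blast
  qed
  then show ?thesis using assms(3) by (simp add: fps_eq_iff)
qed

text \<open>\<open>Y\<close> is \<open>U\<close> stripped of \<open>x\<close> and of
  \<open>(1 - Z)^(m+2)\<close>; it turns out to be the inverse of \<open>h 0\<close>.\<close>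

locale parametrisation =
  fixes m :: nat and Z :: "rat fps" and U Y :: "rat poly fps"
  assumes Z: "Z_eqn m Z" and U: "U_fixpoint m Z U"
    and UY: "U = fps_const [:0, 1:] * Y * (1 - const_x Z) ^ (m + 2)"
begin

definition x :: "rat poly fps" where "x = fps_const [:0, 1:]"
definition z :: "rat poly fps" where "z = const_x Z"
definition q :: "rat poly fps" where "q = 1 - z"
definition h :: "nat \<Rightarrow> rat poly fps" where "h i = H_red m i z U"
definition h1 :: "nat \<Rightarrow> rat fps" where "h1 i = H_red m i Z 1"

text \<open>The claimed \<open>J_i\<close>, rewritten with \<open>t = Z (1 - Z)^(m(m+2))\<close> and
  \<open>U = x Y (1 - Z)^(m+2)\<close>: all negative powers cancel, so \<open>at_x_1\<close>
  applies.\<close>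

definition sol :: "nat \<Rightarrow> rat poly fps" where "sol i = fps_X * x ^ m * Y ^ (i + 1) * h i"

lemma Z0: "Z $ 0 = 0" and XZ: "fps_X = Z * (1 - Z) ^ (m\<^sup>2 + 2 * m)"
  using Z by (auto simp: Z_eqn_def)

lemma Z_nz: "Z \<noteq> 0"
  using XZ by (metis fps_X_neq_zero mult_zero_left)

lemma x_nz: "x \<noteq> 0"
  by (simp add: x_def)

lemma z0: "z $ 0 = 0"
  using Z0 by (simp add: z_def const_x_def)

lemma q_nz: "q \<noteq> 0"
proof -
  have "q $ 0 \<noteq> 0" by (simp add: q_def z0)
  then show ?thesis by auto
qed

lemma U_eq: "U = x * Y * q ^ (m + 2)"
  using UY by (simp add: x_def q_def z_def)

lemma X_eq: "fps_X = z * q ^ (m\<^sup>2 + 2 * m)"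
proof -
  have "const_x fps_X = const_x (Z * (1 - Z) ^ (m\<^sup>2 + 2 * m))" using XZ by (rule arg_cong)
  then show ?thesis by (simp add: const_x_fps_X const_x.hom_simps z_def q_def)
qed

lemma Y_h0: "Y * h 0 = 1"
proof -
  have "U = x * q ^ (m + 2) + z * (U * (\<Sum>e=0..m. U ^ e))"
    using U unfolding U_fixpoint_def x_def q_def z_def .
  then have "U * h 0 = x * q ^ (m + 2)"
    unfolding h_def H_red_0 by (simp add: algebra_simps)
  moreover have "(x * q ^ (m + 2)) * (Y * h 0) = (x * Y * q ^ (m + 2)) * h 0"
    by (simp only: mult_ac)
  ultimately have "(x * q ^ (m + 2)) * (Y * h 0) = (x * q ^ (m + 2)) * 1"
    unfolding U_eq[symmetric] by simp
  moreover have "x * q ^ (m + 2) \<noteq> 0" using x_nz q_nz by simp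
  ultimately show ?thesis by (simp only: mult_cancel_left) simp
qed

lemma D_nz: "U - 1 + z \<noteq> 0"
proof -
  have "(U - 1 + z) $ 0 \<noteq> 0"
    using U_fixpoint_nth_0[OF Z0 U] z0 by (simp add: one_pCons)
  then show ?thesis by (metis fps_zero_nth)
qed

text \<open>Multiply \<open>H_red_m\<close> by \<open>x Y\<close>. By \<open>Y * h 0 = 1\<close> its
  right side becomes \<open>x U - U\<close>, whence the factor \<open>x - 1\<close>.\<close>

lemma sol_m: "(U - 1 + z) * x * sol m = z * U ^ (m + 1) * (x - 1)"
proof -
  have "Y * ((U - 1 + z) * h m) = U * (Y * h 0) - Y * q ^ (m + 2)"
    unfolding h_def H_red_m q_def by (simp add: algebra_simps)
  then have "x * (Y * ((U - 1 + z) * h m)) = x * U - x * Y * q ^ (m + 2)"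
    unfolding Y_h0 by (simp add: right_diff_distrib mult.assoc)
  then have "x * (Y * ((U - 1 + z) * h m)) = x * U - U"
    unfolding U_eq[symmetric] .
  then have "(U - 1 + z) * x * sol m = fps_X * x ^ m * Y ^ m * (x * U - U)"
    unfolding sol_def by (simp add: mult_ac)
  also have "\<dots> = z * (x * Y * q ^ (m + 2)) ^ m * (x * U - U)"
  proof -
    have "m\<^sup>2 + 2 * m = (m + 2) * m" by (simp add: power2_eq_square)
    then have "q ^ (m\<^sup>2 + 2 * m) = (q ^ (m + 2)) ^ m" by (simp only: power_mult)
    then show ?thesis unfolding X_eq by (simp only: power_mult_distrib mult_ac)
  qed
  also have "\<dots> = z * U ^ (m + 1) * (x - 1)"
    unfolding U_eq[symmetric] by (simp add: algebra_simps)
  finally show ?thesis .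
qed

section \<open>Specialisation at x = 1 and the functional equations\<close>

lemma at_x_1_x: "at_x_1 x = 1"
  by (simp add: x_def at_x_1_def fps_eq_iff)

lemma at_x_1_z: "at_x_1 z = Z"
  by (simp add: z_def)

lemma Q_nz: "1 - Z \<noteq> 0"
proof -
  have "(1 - Z) $ 0 \<noteq> 0" using Z0 by simp
  then show ?thesis by auto
qed

lemma at_x_1_Y: "at_x_1 Y * (1 - Z) ^ (m + 1) = 1"
proof -
  have "at_x_1 U = at_x_1 Y * (1 - Z) ^ (m + 2)"
    by (subst U_eq) (simp add: at_x_1.hom_simps at_x_1_x q_def at_x_1_z)
  then have "(1 - Z) * (at_x_1 Y * (1 - Z) ^ (m + 1)) = (1 - Z) * 1"
    using at_x_1_U[OF Z0 U] by (simp add: mult_ac)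
  then show ?thesis using Q_nz by (simp only: mult_cancel_left) simp
qed

text \<open>At \<open>u = 1 - Z\<close> the factor \<open>u - 1 + Z\<close> vanishes and
  \<open>H_red_step\<close> keeps only its last term. So the specialised series is expressed by
  exactly the value at 1 that the recursion contains.\<close>

lemma H_red_at_1:
  assumes "1 \<le> i" "i \<le> m + 1"
  shows "H_red m i Z (1 - Z) = (1 - Z) ^ (m + 1 - i) * h1 (i - 1)"
proof -
  have "Z * H_red m i Z (1 - Z) = Z * ((1 - Z) ^ (m + 1 - i) * h1 (i - 1))"
    using H_red_step[OF assms, of "1 - Z" Z] by (simp add: h1_def mult_ac)
  then show ?thesis using Z_nz by simp
qed

lemma at_x_1_sol:
  assumes "1 \<le> i" "i \<le> m + 1"
  shows "at_x_1 (sol i) = fps_X * at_x_1 Y ^ (i + 1) * (1 - Z) ^ (m + 1 - i) * h1 (i - 1)"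
  using H_red_at_1[OF assms]
  by (simp add: sol_def h_def at_x_1.hom_simps at_x_1_x at_x_1.hom_H_red at_x_1_z at_x_1_U[OF Z0 U] at_x_1_fps_X mult.assoc)

text \<open>Multiplied by \<open>(U - 1 + z) * x\<close>, the equation becomes linear, since
  \<open>sol_m\<close> eliminates \<open>sol m\<close>. The terms in \<open>sol i\<close> then share
  the factor \<open>(U - 1) * h 0\<close>; one \<open>Y\<close> cancels against \<open>h 0\<close>,
  and \<open>H_red_step\<close> is left.\<close>

lemma sol_step:
  assumes "1 \<le> i" "i \<le> m + 1"
  shows "(x - 1) * (sol i - sol (i - 1)) = sol m * (x * sol i - x ^ (m + 1 - i) * const_x (at_x_1 (sol i)))"
proof -
  let ?r = "m + 1 - i" and ?D = "U - 1 + z"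
  let ?y1 = "const_x (at_x_1 Y)" and ?k = "const_x (at_x_1 (sol i))" and ?g = "H_red m (i - 1) z 1"
  have "const_x (at_x_1 Y * (1 - Z) ^ (m + 1)) = 1" unfolding at_x_1_Y by (rule const_x.hom_one)
  then have y1: "?y1 * q ^ (m + 1) = 1" by (simp add: const_x.hom_simps q_def z_def)
  have k: "?k = fps_X * ?y1 ^ (i + 1) * q ^ ?r * ?g"
    unfolding at_x_1_sol[OF assms] h1_def
    by (simp only: const_x.hom_simps const_x.hom_H_red const_x_fps_X q_def z_def)
  have D: "?D - z * U ^ (m + 1) = (U - 1) * h 0"
  proof -
    have "(U - 1) * (\<Sum>e=0..m. U ^ e) = U ^ (m + 1) - 1"
      using diff_power_eq_sum[of U m 1] by (simp add: atLeast0AtMost lessThan_Suc_atMost)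
    then have "z * ((U - 1) * (\<Sum>e=0..m. U ^ e)) = z * (U ^ (m + 1) - 1)" by (rule arg_cong)
    then show ?thesis unfolding h_def H_red_0 by (simp add: algebra_simps)
  qed
  \<comment> \<open>Matching the specialised term: the powers of \<open>q\<close> in
    \<open>U^i\<close>, together with \<open>q^r\<close>, cancel \<open>at_x_1 Y ^ (i + 1)\<close>,
    by the count \<open>(m + 1) (i + 1) = (m + 2) i + r\<close>.\<close>
  have "x ^ (m + 1) * Y ^ i * U ^ ?r = U ^ (m + 1) * x ^ ?r * ?y1 ^ (i + 1) * q ^ ?r"
  proof -
    have e: "(m + 1) * (i + 1) = (m + 2) * i + ?r" "m + 1 = ?r + i"
      using assms by (auto simp: algebra_simps)
    have "U ^ (m + 1) * x ^ ?r * ?y1 ^ (i + 1) * q ^ ?r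
        = U ^ ?r * (x * Y * q ^ (m + 2)) ^ i * x ^ ?r * ?y1 ^ (i + 1) * q ^ ?r"
      unfolding U_eq[symmetric] by (subst (1) e(2)) (simp only: power_add)
    also have "\<dots> = x ^ (?r + i) * Y ^ i * U ^ ?r * (?y1 ^ (i + 1) * ((q ^ (m + 2)) ^ i * q ^ ?r))"
      by (simp only: power_add power_mult_distrib mult_ac)
    also have "(q ^ (m + 2)) ^ i * q ^ ?r = (q ^ (m + 1)) ^ (i + 1)"
      unfolding power_mult[symmetric] power_add[symmetric] e(1) ..
    also have "?y1 ^ (i + 1) * (q ^ (m + 1)) ^ (i + 1) = 1"
      unfolding power_mult_distrib[symmetric] y1 by simp
    finally show ?thesis using e(2) by simp
  qed
  then have "fps_X * z * ?g * (x ^ (m + 1) * Y ^ i * U ^ ?r) = fps_X * z * ?g * (U ^ (m + 1) * x ^ ?r * ?y1 ^ (i + 1) * q ^ ?r)"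
    by (rule arg_cong)
  then have K: "x * fps_X * x ^ m * Y ^ i * (z * U ^ ?r * ?g) = z * U ^ (m + 1) * x ^ ?r * ?k"
    unfolding k by (simp add: mult_ac)
  have "x * sol i * (?D - z * U ^ (m + 1)) = x * fps_X * x ^ m * Y ^ i * (Y * h 0) * ((U - 1) * h i)"
    unfolding D sol_def by (simp add: mult_ac)
  also have "\<dots> = x * fps_X * x ^ m * Y ^ i * (?D * h (i - 1) - z * U ^ ?r * ?g)"
  proof -
    have "(U - 1) * h i = ?D * h (i - 1) - z * U ^ ?r * ?g"
      unfolding h_def by (rule H_red_step[OF assms])
    then show ?thesis unfolding Y_h0 by simp
  qed
  also have "\<dots> = ?D * x * sol (i - 1) - z * U ^ (m + 1) * x ^ ?r * ?k"
    unfolding right_diff_distrib K using assms by (simp add: sol_def mult_ac)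
  finally have E: "?D * x * (sol i - sol (i - 1)) = z * U ^ (m + 1) * (x * sol i - x ^ ?r * ?k)"
    by (simp add: algebra_simps)
  have "(?D * x) * ((x - 1) * (sol i - sol (i - 1))) = (x - 1) * (?D * x * (sol i - sol (i - 1)))"
    by (simp only: mult_ac)
  also have "\<dots> = z * U ^ (m + 1) * (x - 1) * (x * sol i - x ^ ?r * ?k)"
    unfolding E by (simp only: mult_ac)
  also have "\<dots> = (?D * x) * (sol m * (x * sol i - x ^ ?r * ?k))"
    unfolding sol_m[symmetric] by (simp only: mult_ac)
  finally show ?thesis using D_nz x_nz by simp
qed

lemma sol_0: "sol 0 = x ^ m * fps_X"
  using Y_h0 by (simp add: sol_def mult_ac)

lemma tamari_system_sol: "tamari_system m sol"
  unfolding tamari_system_def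
proof (intro conjI allI impI)
  show "sol i $ 0 = 0" for i by (simp add: sol_def)
  show "sol 0 = fps_const ([:0, 1:] ^ m) * fps_X" by (simp add: sol_0 x_def fps_const_power)
qed (use sol_step in \<open>simp add: x_def\<close>)

text \<open>\<open>H_red_m\<close> at \<open>u = 1\<close> gives
  \<open>Z * h1 m = 1 - (m + 1) Z - (1 - Z)^(m+2)\<close>, and the subtracted power is what the
  added 1 contributes on the left.\<close>

lemma at_x_1_sol_last:
  "(1 + at_x_1 (sol (m + 1))) * (1 - Z) ^ (m + 2) = 1 - of_nat (m + 1) * Z"
proof -
  have "Z * h1 m = 1 - of_nat (m + 1) * Z - (1 - Z) ^ (m + 2)"
    using H_red_m[of 1 Z m] by (simp add: h1_def H_red_0 mult.commute)
  moreover have "at_x_1 (sol (m + 1)) * (1 - Z) ^ (m + 2) = Z * h1 m"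
  proof -
    have "(m\<^sup>2 + 2 * m) + (m + 2) = (m + 1) * (m + 2)" by (simp add: power2_eq_square algebra_simps)
    then have e: "(1 - Z) ^ (m\<^sup>2 + 2 * m) * (1 - Z) ^ (m + 2) = ((1 - Z) ^ (m + 1)) ^ (m + 2)"
      by (simp only: power_add[symmetric] power_mult[symmetric])
    have "at_x_1 (sol (m + 1)) = fps_X * at_x_1 Y ^ (m + 2) * h1 m"
      using at_x_1_sol[of "m + 1"] by simp
    then have "at_x_1 (sol (m + 1)) * (1 - Z) ^ (m + 2)
        = Z * h1 m * at_x_1 Y ^ (m + 2) * ((1 - Z) ^ (m\<^sup>2 + 2 * m) * (1 - Z) ^ (m + 2))"
      by (subst (asm) XZ) (simp only: mult_ac)
    also have "\<dots> = Z * h1 m * (at_x_1 Y * (1 - Z) ^ (m + 1)) ^ (m + 2)"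
      unfolding e power_mult_distrib by (simp only: mult_ac)
    finally show ?thesis unfolding at_x_1_Y by simp
  qed
  ultimately show ?thesis by (simp add: algebra_simps)
qed

end

lemma parametrisation_ex:
  assumes "Z_eqn m Z" "U_fixpoint m Z U"
  shows "\<exists>Y. parametrisation m Z U Y"
proof -
  let ?q = "1 - const_x Z" and ?w = "const_x (inverse (1 - Z))"
  have Z0: "Z $ 0 = 0" using assms(1) by (simp add: Z_eqn_def)
  have "?w * ?q = const_x (inverse (1 - Z) * (1 - Z))" by (simp add: const_x.hom_simps)
  also have "\<dots> = 1" using Z0 by (simp add: inverse_mult_eq_1 const_x.hom_one)
  finally have w: "?w * ?q = 1" .
  obtain V where V: "U = fps_const [:0, 1:] * V" using U_fixpoint_factor[OF Z0 assms(2)] by blast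
  have "fps_const [:0, 1:] * (V * ?w ^ (m + 2)) * ?q ^ (m + 2) = fps_const [:0, 1:] * V * (?w * ?q) ^ (m + 2)"
    by (simp only: power_mult_distrib mult_ac)
  then have "U = fps_const [:0, 1:] * (V * ?w ^ (m + 2)) * ?q ^ (m + 2)" using V w by simp
  then show ?thesis using assms by (intro exI[of _ "V * ?w ^ (m + 2)"]) unfold_locales
qed

section \<open>Lagrange inversion\<close>

lemma fps_compose_mult_nth:
  fixes f :: "'a::idom fps"
  assumes "f $ 0 = 0"
  shows "((A oo f) * H) $ N = (\<Sum>k=0..N. A $ k * (f ^ k * H) $ N)"
proof -
  have "(A oo f) $ i = (\<Sum>k=0..N. A $ k * f ^ k $ i)" if "i \<le> N" for i
    unfolding fps_compose_nth using that startsby_zero_power_prefix[OF assms]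
    by (intro sum.mono_neutral_left) auto
  then have "((A oo f) * H) $ N = (\<Sum>i=0..N. (\<Sum>k=0..N. A $ k * f ^ k $ i) * H $ (N - i))"
    unfolding fps_mult_nth by (intro sum.cong) auto
  also have "\<dots> = (\<Sum>k=0..N. \<Sum>i=0..N. A $ k * f ^ k $ i * H $ (N - i))"
    unfolding sum_distrib_right by (rule sum.swap)
  finally show ?thesis by (simp add: fps_mult_nth sum_distrib_left mult.assoc)
qed

text \<open>The residue of \<open>f' / f\<^sup>j\<^sup>+\<^sup>1\<close> for \<open>f = X \<psi>\<close>, in a form that avoids Laurent series.\<close>

lemma fps_deriv_mult_inverse_power_nth:
  fixes \<psi> :: "'a::field_char_0 fps"
  assumes "\<psi> $ 0 \<noteq> 0"
  shows "(fps_deriv (fps_X * \<psi>) * inverse \<psi> ^ Suc j) $ j = (if j = 0 then 1 else 0)"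
proof -
  let ?G = "inverse \<psi>"
  have inv: "\<psi> * ?G = 1" using inverse_mult_eq_1'[OF assms] .
  have "fps_deriv (fps_X * \<psi>) * ?G ^ Suc j = (\<psi> * ?G) * ?G ^ j + fps_X * (fps_deriv \<psi> * ?G ^ Suc j)"
    by (simp add: algebra_simps)
  then have eq: "fps_deriv (fps_X * \<psi>) * ?G ^ Suc j = ?G ^ j + fps_X * (fps_deriv \<psi> * ?G ^ Suc j)"
    unfolding inv by simp
  show ?thesis
  proof (cases j)
    case 0
    then show ?thesis unfolding eq by simp
  next
    case (Suc i)
    \<comment> \<open>A derivative has no residue: comparing coefficients of the derivative of
      \<open>\<psi>^(-j)\<close> in degree \<open>j - 1\<close> shows that the two summands
      cancel.\<close>
    have "fps_deriv (?G ^ j) = fps_const (- of_nat j) * (fps_deriv \<psi> * ?G ^ Suc j)"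
      unfolding fps_const_neg[symmetric] fps_of_nat fps_deriv_power' fps_inverse_deriv[OF assms] using Suc by (simp add: power2_eq_square algebra_simps)
    then have "fps_deriv (?G ^ j) $ i = (fps_const (- of_nat j) * (fps_deriv \<psi> * ?G ^ Suc j)) $ i" by (rule arg_cong)
    then have "of_nat j * ?G ^ j $ j = - of_nat j * (fps_deriv \<psi> * ?G ^ Suc j) $ i"
      using Suc by (simp only: fps_deriv_nth fps_mult_left_const_nth Suc_eq_plus1)
    then have "of_nat j * (?G ^ j $ j + (fps_deriv \<psi> * ?G ^ Suc j) $ i) = 0"
      by (simp only: distrib_left) simp
    then have "?G ^ j $ j + (fps_deriv \<psi> * ?G ^ Suc j) $ i = 0"
      using Suc by (simp only: mult_eq_0_iff of_nat_eq_0_iff) simp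
    then show ?thesis unfolding eq using Suc by simp
  qed
qed

text \<open>With \<open>f = X \<psi>\<close> inverse to \<open>Z\<close> and
  \<open>A = F oo Z\<close>, the chain rule gives \<open>F' = (A' oo f) f'\<close>. When
  \<open>A'\<close> is expanded in powers of \<open>f\<close>, only \<open>f^(n-1)\<close> survives
  the residue, and its coefficient is \<open>n A_n\<close>.\<close>

theorem fps_lagrange_inversion:
  fixes \<psi> Z F :: "'a::field_char_0 fps"
  assumes "\<psi> $ 0 \<noteq> 0" "Z $ 0 = 0" "fps_X = Z * (\<psi> oo Z)" "n \<ge> 1"
  shows "of_nat n * (F oo Z) $ n = (fps_deriv F * inverse \<psi> ^ n) $ (n - 1)"
proof -
  let ?f = "fps_X * \<psi>" and ?G = "inverse \<psi>"
  define A where "A = F oo Z"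
  have f: "?f $ 0 = 0" "?f $ 1 \<noteq> 0" using assms(1) by simp_all
  have fZ: "?f oo Z = fps_X" using assms(2,3) by (simp add: fps_compose_mult_distrib)
  have "fps_inv ?f oo (?f oo Z) = (fps_inv ?f oo ?f) oo Z"
    by (rule fps_compose_assoc[OF assms(2) f(1)])
  then have "Z = fps_inv ?f" using fZ assms(2) by (simp add: fps_inv[OF f])
  then have "Z oo ?f = fps_X" using fps_inv[OF f] by simp
  moreover have "A oo ?f = F oo (Z oo ?f)"
    unfolding A_def by (rule fps_compose_assoc[OF f(1) assms(2), symmetric])
  ultimately have "A oo ?f = F" by simp
  then have "fps_deriv F = (fps_deriv A oo ?f) * fps_deriv ?f"
    using fps_compose_deriv[OF f(1), of A] by simp
  then have "(fps_deriv F * ?G ^ n) $ (n - 1) = ((fps_deriv A oo ?f) * (fps_deriv ?f * ?G ^ n)) $ (n - 1)"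
    by (simp add: mult.assoc)
  also have "\<dots> = (\<Sum>k=0..n - 1. fps_deriv A $ k * (?f ^ k * (fps_deriv ?f * ?G ^ n)) $ (n - 1))"
    by (rule fps_compose_mult_nth[OF f(1)])
  also have "\<dots> = (\<Sum>k=0..n - 1. fps_deriv A $ k * (if k = n - 1 then 1 else 0))"
  proof (rule sum.cong[OF refl])
    fix k assume k: "k \<in> {0..n - 1}"
    define j where "j = n - 1 - k"
    have n: "n = k + Suc j" "n - 1 = k + j" using k assms(4) unfolding j_def by auto
    have inv: "\<psi> * ?G = 1" using inverse_mult_eq_1'[OF assms(1)] .
    have "?f ^ k * (fps_deriv ?f * ?G ^ n) = fps_X ^ k * (fps_deriv ?f * ?G ^ Suc j) * (\<psi> * ?G) ^ k"
      unfolding n(1) power_add power_mult_distrib by (simp only: mult_ac)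
    then have "?f ^ k * (fps_deriv ?f * ?G ^ n) = fps_X ^ k * (fps_deriv ?f * ?G ^ Suc j)"
      by (simp only: inv power_one mult_1_right)
    then have "(?f ^ k * (fps_deriv ?f * ?G ^ n)) $ (n - 1) = (fps_deriv ?f * ?G ^ Suc j) $ j"
      by (simp only: n(2) fps_X_power_mult_nth) simp
    also have "\<dots> = (if k = n - 1 then 1 else 0)"
      unfolding fps_deriv_mult_inverse_power_nth[OF assms(1)] n(2) by simp
    finally show "fps_deriv A $ k * (?f ^ k * (fps_deriv ?f * ?G ^ n)) $ (n - 1) = fps_deriv A $ k * (if k = n - 1 then 1 else 0)"
      by simp
  qed
  also have "\<dots> = of_nat n * A $ n"
    using assms(4) by (simp add: if_distrib cong: if_cong)
  finally show ?thesis by (simp add: A_def)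
qed

lemma inverse_one_minus_fps_X_power_nth:
  assumes "a > 0"
  shows "(inverse (1 - fps_X) ^ a) $ k = (of_nat ((a + k - 1) choose k) :: 'a::field_char_0)"
  using one_minus_const_fps_X_neg_power'[OF assms, where c = "1 :: 'a"] by (simp add: fps_inverse_power)

text \<open>Pascal's rule leaves \<open>B choose (n - 1)\<close> and
  \<open>B choose (n - 2)\<close>. Absorption relates them through the factor
  \<open>B - (n - 2) = (m + 2) (m n + 1)\<close>, the source of the denominator.\<close>

lemma binomial_count_identity:
  fixes m n :: nat
  assumes "n \<ge> 1"
  defines "B \<equiv> (m + 1)\<^sup>2 * n + m"
  shows "(of_nat (Suc B choose (n - 1)) - of_nat ((m + 1)\<^sup>2) * (if n = 1 then 0 else of_nat (B choose (n - 2))) :: rat)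
    = of_nat (m + 1) / of_nat (m * n + 1) * of_nat (B choose (n - 1))"
proof (cases "n = 1")
  case True
  then show ?thesis by (simp add: divide_simps)
next
  case False
  define k where "k = n - 2"
  have n: "n = k + 2" using False assms(1) by (simp add: k_def)
  have "k \<le> B" unfolding B_def n by (simp add: power2_eq_square)
  have "Suc k * (B choose Suc k) = (B - k) * (B choose k)"
    by (simp only: binomial_absorption binomial_absorb_comp)
  then have "of_nat (Suc k) * (of_nat (B choose Suc k) :: rat) = of_nat (B - k) * of_nat (B choose k)"
    by (simp only: of_nat_mult[symmetric])
  then have a: "(of_nat k + 1) * (of_nat (B choose Suc k) :: rat) = (of_nat B - of_nat k) * of_nat (B choose k)"
    using \<open>k \<le> B\<close> by (simp add: of_nat_diff algebra_simps)
  have B: "(of_nat B - of_nat k :: rat) = (of_nat m + 2) * (of_nat (m * n + 1))"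
    unfolding B_def n by (simp add: power2_eq_square algebra_simps)
  have pos: "(of_nat (m * n + 1) :: rat) \<noteq> 0" "(of_nat m + 2 :: rat) \<noteq> 0"
    by (simp_all only: of_nat_eq_0_iff)
  have nk: "n - 1 = Suc k" "n - 2 = k" by (simp_all add: n)
  have E1: "(of_nat (Suc B choose Suc k) - of_nat ((m + 1)\<^sup>2) * of_nat (B choose k) :: rat)
    = of_nat (B choose Suc k) + (1 - (of_nat m + 1)\<^sup>2) * of_nat (B choose k)"
    by (simp add: algebra_simps)
  have E2: "(of_nat m + 2) * of_nat (m * n + 1) * (of_nat (B choose Suc k) + (1 - (of_nat m + 1)\<^sup>2) * of_nat (B choose k))
    = (of_nat m + 2) * (of_nat (m + 1) * (of_nat (B choose Suc k) :: rat))"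
  proof -
    have "(of_nat m + 2) * of_nat (m * n + 1) * (of_nat (B choose Suc k) + (1 - (of_nat m + 1)\<^sup>2) * of_nat (B choose k) :: rat)
      = (of_nat m + 2) * of_nat (m * n + 1) * of_nat (B choose Suc k) + (1 - (of_nat m + 1)\<^sup>2) * ((of_nat B - of_nat k) * of_nat (B choose k))"
      unfolding B by (simp only: distrib_left mult_ac)
    also have "\<dots> = (of_nat m + 2) * of_nat (m * n + 1) * of_nat (B choose Suc k) + (1 - (of_nat m + 1)\<^sup>2) * ((of_nat k + 1) * of_nat (B choose Suc k))"
      unfolding a ..
    also have "\<dots> = (of_nat m + 2) * (of_nat (m + 1) * of_nat (B choose Suc k))"
      unfolding n by (simp add: power2_eq_square algebra_simps)
    finally show ?thesis .
  qed
  have divide: "L = a / d * b" if "d * L = a * b" "d \<noteq> 0" for L a b d :: rat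
    using that by (simp add: field_simps)
  have "of_nat (m * n + 1) * (of_nat (Suc B choose Suc k) - of_nat ((m + 1)\<^sup>2) * of_nat (B choose k) :: rat)
    = of_nat (m + 1) * of_nat (B choose Suc k)"
    unfolding E1 using E2 pos(2) by (simp only: mult.assoc mult_cancel_left) simp
  then show ?thesis
    unfolding nk if_not_P[OF False] by (rule divide[OF _ pos(1)])
qed

text \<open>Lagrange inversion for \<open>F = (1 - (m + 1) X) / (1 - X)^(m+2)\<close>. Its
  derivative is \<open>(1 - (m + 1)^2 X) / (1 - X)^(m+3)\<close>, so only two negative binomial
  coefficients remain.\<close>

lemma Z_coefficients:
  fixes m n :: nat and Z A :: "rat fps"
  assumes "Z_eqn m Z" "(1 + A) * (1 - Z) ^ (m + 2) = 1 - of_nat (m + 1) * Z" "n \<ge> 1"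
  shows "A $ n = of_nat (m + 1) / of_nat (n * (m * n + 1)) * of_nat (((m + 1)\<^sup>2 * n + m) choose (n - 1))"
proof -
  let ?N = "m\<^sup>2 + 2 * m" and ?B = "(m + 1)\<^sup>2 * n + m"
  let ?\<psi> = "(1 - fps_X) ^ ?N :: rat fps" and ?G = "inverse (1 - fps_X) :: rat fps"
  let ?c = "fps_const (of_nat (m + 1)) :: rat fps"
  define F where "F = (1 - ?c * fps_X) * ?G ^ (m + 2)"
  have Z0: "Z $ 0 = 0" and XZ: "fps_X = Z * (1 - Z) ^ ?N" using assms(1) by (auto simp: Z_eqn_def)
  have G: "(1 - fps_X) * ?G = 1" using inverse_mult_eq_1'[of "1 - fps_X :: rat fps"] by simp
  have "(?G oo Z) * (1 - Z) = (?G * (1 - fps_X)) oo Z"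
    using Z0 by (simp add: fps_compose_mult_distrib fps_compose_sub_distrib)
  then have GZ: "(?G oo Z) * (1 - Z) = 1" using G by (simp add: mult.commute)
  have "F oo Z = (1 - ?c * Z) * (?G oo Z) ^ (m + 2)"
    unfolding F_def using Z0 by (simp add: fps_compose_mult_distrib fps_compose_sub_distrib fps_compose_power[symmetric])
  also have "\<dots> = (1 + A) * (((?G oo Z) * (1 - Z)) ^ (m + 2))"
    unfolding power_mult_distrib fps_of_nat assms(2)[symmetric] by (simp only: mult_ac)
  finally have FZ: "F oo Z = 1 + A" unfolding GZ by simp
  have psi: "?\<psi> $ 0 \<noteq> 0" by (simp add: fps_power_zeroth)
  have "?\<psi> oo Z = (1 - Z) ^ ?N"
    using Z0 by (simp add: fps_compose_power[symmetric] fps_compose_sub_distrib)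
  then have XZ': "fps_X = Z * (?\<psi> oo Z)" using XZ by simp
  have "of_nat n * A $ n = of_nat n * (F oo Z) $ n" using FZ assms(3) by simp
  also have "\<dots> = (fps_deriv F * inverse ?\<psi> ^ n) $ (n - 1)"
    by (rule fps_lagrange_inversion[OF psi Z0 XZ' assms(3)])
  also have "fps_deriv F * inverse ?\<psi> ^ n = (1 - fps_const (of_nat ((m + 1)\<^sup>2)) * fps_X) * ?G ^ (?B - n + 3)"
  proof -
    have dG: "fps_deriv ?G = ?G\<^sup>2" by (subst fps_inverse_deriv) simp_all
    have "fps_deriv F = - ?c * ?G ^ (m + 2) + (1 - ?c * fps_X) * (of_nat (m + 2) * ?G ^ (m + 3))"
      unfolding F_def fps_deriv_mult fps_deriv_power' dG
      by (simp add: power2_eq_square mult_ac numeral_3_eq_3 add.commute)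
    also have "\<dots> = - ?c * ((1 - fps_X) * ?G) * ?G ^ (m + 2) + (1 - ?c * fps_X) * (of_nat (m + 2) * ?G ^ (m + 3))"
      unfolding G by simp
    also have "\<dots> = (- ?c * (1 - fps_X) + (1 - ?c * fps_X) * of_nat (m + 2)) * ?G ^ (m + 3)"
      by (simp add: algebra_simps numeral_3_eq_3)
    also have "- ?c * (1 - fps_X) + (1 - ?c * fps_X) * of_nat (m + 2) = 1 - fps_const (of_nat ((m + 1)\<^sup>2)) * fps_X"
      unfolding fps_of_nat by (simp add: power2_eq_square algebra_simps)
    finally have "fps_deriv F = (1 - fps_const (of_nat ((m + 1)\<^sup>2)) * fps_X) * ?G ^ (m + 3)" .
    moreover have "inverse ?\<psi> ^ n = ?G ^ (?N * n)" by (simp add: fps_inverse_power power_mult)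
    moreover have "m + 3 + ?N * n = ?B - n + 3" by (simp add: power2_eq_square algebra_simps)
    ultimately show ?thesis by (simp only: mult.assoc power_add[symmetric])
  qed
  also have "\<dots> $ (n - 1) = ?G ^ (?B - n + 3) $ (n - 1) -
      of_nat ((m + 1)\<^sup>2) * (if n = 1 then 0 else ?G ^ (?B - n + 3) $ (n - 2))"
    using assms(3) by (simp add: left_diff_distrib mult.assoc numeral_2_eq_2)
  also have "\<dots> = of_nat (Suc ?B choose (n - 1)) - of_nat ((m + 1)\<^sup>2) * (if n = 1 then 0 else of_nat (?B choose (n - 2)))"
  proof -
    have "n \<le> ?B" by (simp add: power2_eq_square)
    then have "?B - n + 3 + (n - 1) - 1 = Suc ?B" "n \<noteq> 1 \<Longrightarrow> ?B - n + 3 + (n - 2) - 1 = ?B"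
      using assms(3) by auto
    then show ?thesis by (simp add: inverse_one_minus_fps_X_power_nth)
  qed
  also have "\<dots> = of_nat (m + 1) / of_nat (m * n + 1) * of_nat (?B choose (n - 1))"
    by (rule binomial_count_identity[OF assms(3)])
  finally have eq: "of_nat n * A $ n = of_nat (m + 1) / of_nat (m * n + 1) * of_nat (?B choose (n - 1))" .
  have "A $ n = of_nat n * A $ n / of_nat n" using assms(3) by simp
  then show ?thesis
    unfolding eq of_nat_mult by (simp only: divide_divide_eq_left times_divide_eq_left mult.commute)
qed

section \<open>The interval series\<close>

lemma tamari_system_J_bar:
  assumes "1 \<le> m"
  shows "tamari_system m (J_bar m)"
  unfolding tamari_system_def
  using J_bar_nth_0 J_bar_0 J_bar_step[OF assms] by blast

lemma card_tamari_intervals: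
  assumes "n \<ge> 1"
  shows "of_nat (card (tamari_intervals m n)) = at_x_1 (I_bar m) $ n"
proof -
  have "poly (\<Sum>(v, w)\<in>tamari_intervals m n. monom 1 (final_descent w)) (1::rat)
      = (\<Sum>(v, w)\<in>tamari_intervals m n. 1)"
    by (simp add: poly_sum case_prod_unfold poly_monom)
  then show ?thesis using assms by (simp add: at_x_1_def I_bar_def)
qed

text \<open>The exponent \<open>m - i - 1\<close> in the theorem is negative for
  \<open>i = m\<close> and \<open>i = m + 1\<close>; a factor \<open>a^(i+1)\<close> makes all
  exponents natural.\<close>

lemma fps_power_int_diff:
  fixes a :: "'a::field fps"
  assumes "a $ 0 \<noteq> 0"
  shows "a powi (int k - int l) * a ^ l = a ^ k"
proof -
  have inv: "inverse a * a = 1" using inverse_mult_eq_1[OF assms] .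
  show ?thesis
  proof (cases "l \<le> k")
    case True
    then have "a powi (int k - int l) = a ^ (k - l)" by (simp add: power_int_def nat_diff_distrib)
    then show ?thesis using True by (simp add: power_add[symmetric])
  next
    case False
    then have "a powi (int k - int l) = inverse a ^ (l - k)"
      by (simp add: power_int_def nat_diff_distrib)
    moreover have "a ^ l = a ^ (l - k) * a ^ k" using False by (simp add: power_add[symmetric])
    ultimately have "a powi (int k - int l) * a ^ l = (inverse a * a) ^ (l - k) * a ^ k"
      by (simp only: power_mult_distrib mult_ac)
    then show ?thesis unfolding inv by simp
  qed
qed

lemma fps_power_int_nth_0:
  fixes a :: "'a::field fps"
  assumes "a $ 0 \<noteq> 0"
  shows "(a powi k) $ 0 \<noteq> 0"
  using assms by (simp add: power_int_def fps_power_zeroth)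

lemma fps_eq_divide_iff:
  fixes g :: "'a::field fps"
  assumes "g $ 0 \<noteq> 0"
  shows "a = b / g \<longleftrightarrow> a * g = b"
  using fps_eq_divide_unit[OF assms, of a b 1] by simp

section \<open>Transfer of the solution to \<open>Q(x)[[t]]\<close>\<close>

context parametrisation
begin

definition eu :: ratfun_fps where "eu = emb_poly U"
definition ez :: ratfun_fps where "ez = emb_rat Z"
definition ey :: ratfun_fps where "ey = emb_poly Y"

lemma emb_x: "emb_poly x = var_x"
  by (simp add: x_def emb_poly_def var_x_def fps_eq_iff)

lemma emb_z: "emb_poly z = ez"
  by (simp add: z_def ez_def emb_poly_const_x)

lemma eu_eq: "eu = var_x * ey * (1 - ez) ^ (m + 2)"
proof -
  have "emb_poly U = emb_poly (x * Y * q ^ (m + 2))" using U_eq by (rule arg_cong)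
  then show ?thesis by (simp add: eu_def ey_def emb_poly.hom_simps emb_x emb_z q_def)
qed

lemma emb_X_eq: "fps_X = ez * (1 - ez) ^ ((m + 2) * m)"
proof -
  have "emb_poly fps_X = emb_poly (z * q ^ (m\<^sup>2 + 2 * m))" using X_eq by (rule arg_cong)
  moreover have "m\<^sup>2 + 2 * m = (m + 2) * m" by (simp add: power2_eq_square)
  ultimately show ?thesis by (simp only: emb_poly.hom_simps emb_poly_fps_X emb_z q_def)
qed

lemma emb_sol: "emb_poly (sol i) = ez * (1 - ez) ^ ((m + 2) * m) * var_x ^ m * ey ^ (i + 1) * H_red m i ez eu"
  unfolding sol_def h_def
  by (simp only: emb_poly.hom_simps emb_poly.hom_H_red emb_poly_fps_X emb_x emb_z emb_X_eq eu_def ey_def)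

lemma var_x_nth_0: "var_x $ 0 \<noteq> 0"
  by (simp add: var_x_def)

lemma ez_nth_0: "ez $ 0 = 0"
  using Z0 by (simp add: ez_def emb_rat_def)

lemma q_nth_0: "(1 - ez) $ 0 \<noteq> 0"
  by (simp add: ez_nth_0)

text \<open>The constant term is \<open>x - 1\<close>, a unit in \<open>Q(x)\<close> but not in
  \<open>Q[x]\<close>; the formula for \<open>J_m\<close> therefore lives over fractions.\<close>

lemma D_nth_0: "(eu - 1 + ez) $ 0 \<noteq> 0"
proof -
  have "eu $ 0 = to_fract [:0, 1:]" using U_fixpoint_nth_0[OF Z0 U] by (simp add: eu_def emb_poly_def)
  moreover have "to_fract [:0, 1::rat:] \<noteq> to_fract 1"
    unfolding to_fract_eq_iff by (simp add: one_pCons)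
  ultimately show ?thesis using ez_nth_0 by simp
qed

lemma emb_sol_scaled:
  "emb_poly (sol i) * var_x ^ (i + 1) * (1 - ez) ^ ((m + 2) * (i + 1))
     = ez * (1 - ez) ^ ((m + 2) * m) * var_x ^ m * (eu ^ (i + 1) * H_red m i ez eu)"
proof -
  have "eu ^ (i + 1) = var_x ^ (i + 1) * ey ^ (i + 1) * (1 - ez) ^ ((m + 2) * (i + 1))"
    by (subst eu_eq) (simp only: power_mult_distrib power_mult)
  then show ?thesis unfolding emb_sol by (simp only: mult_ac)
qed

lemma emb_sol_eq_H_poly:
  assumes "i \<le> m + 1"
  shows "emb_poly (sol i) / var_x powi (int m - int i - 1) =
    ez * (1 - ez) powi ((int m + 2) * (int m - int i - 1)) * H_poly m i ez eu"
proof -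
  let ?xp = "var_x powi (int m - int i - 1)" and ?qp = "(1 - ez) powi ((int m + 2) * (int m - int i - 1))"
  let ?H = "H_poly m i ez eu"
  have x: "?xp * var_x ^ (i + 1) = var_x ^ m"
    using fps_power_int_diff[OF var_x_nth_0, of m "i + 1"] by (simp add: algebra_simps)
  have "(int m + 2) * (int m - int i - 1) = int ((m + 2) * m) - int ((m + 2) * (i + 1))"
    by (simp add: algebra_simps)
  then have q: "?qp * (1 - ez) ^ ((m + 2) * (i + 1)) = (1 - ez) ^ ((m + 2) * m)"
    using fps_power_int_diff[OF q_nth_0] by metis
  let ?s = "var_x ^ (i + 1) * (1 - ez) ^ ((m + 2) * (i + 1))"
  have "?s $ 0 \<noteq> 0" using var_x_nth_0 q_nth_0 by (simp add: fps_power_zeroth)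
  then have s: "?s \<noteq> 0" by (metis fps_zero_nth)
  have "emb_poly (sol i) * ?s = ez * ?H * (?xp * var_x ^ (i + 1)) * (?qp * (1 - ez) ^ ((m + 2) * (i + 1)))"
    using emb_sol_scaled[of i] unfolding x q H_poly_eq_H_red[OF assms] by (simp only: mult_ac)
  also have "\<dots> = (ez * ?qp * ?H * ?xp) * ?s" by (simp only: mult_ac)
  finally have "emb_poly (sol i) = ez * ?qp * ?H * ?xp" using s by (simp only: mult_cancel_right) simp
  then show ?thesis using fps_eq_divide_iff[OF fps_power_int_nth_0[OF var_x_nth_0]] by metis
qed

lemma emb_sol_last:
  "var_x\<^sup>2 * emb_poly (sol (m + 1)) = ez * eu ^ (m + 2) / (1 - ez) ^ (2 * m + 4) *
     (1 - ez * (\<Sum>e=0..m. eu ^ e * of_nat (m + 1 - e)))"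
proof -
  let ?H = "H_red m (m + 1) ez eu" and ?t = "var_x ^ m * (1 - ez) ^ ((m + 2) * m)"
  have u: "(1 - ez) ^ (2 * m + 4) $ 0 \<noteq> 0" using q_nth_0 by (simp add: fps_power_zeroth)
  have "?t $ 0 \<noteq> 0" using var_x_nth_0 q_nth_0 by (simp add: fps_power_zeroth)
  then have t: "?t \<noteq> 0" by (metis fps_zero_nth)
  have e: "(m + 2) * (m + 2) = (m + 2) * m + (2 * m + 4)" "m + 1 + 1 = m + 2" by simp_all
  have "?t * (var_x\<^sup>2 * emb_poly (sol (m + 1)) * (1 - ez) ^ (2 * m + 4)) = ?t * (ez * eu ^ (m + 2) * ?H)"
    using emb_sol_scaled[of "m + 1"] unfolding e(2) unfolding e(1) power_add[of _ "(m + 2) * m"] power_add[of _ m 2]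
    by (simp only: mult_ac)
  then have "var_x\<^sup>2 * emb_poly (sol (m + 1)) * (1 - ez) ^ (2 * m + 4) = ez * eu ^ (m + 2) * ?H"
    using t by (simp only: mult_cancel_left) simp
  then show ?thesis unfolding fps_eq_divide_unit[OF u] H_red_last .
qed

lemma emb_sol_m:
  "emb_poly (sol m) = (var_x - 1) / var_x * (ez * eu ^ (m + 1) / (eu - 1 + ez))"
proof -
  have "emb_poly ((U - 1 + z) * x * sol m) = emb_poly (z * U ^ (m + 1) * (x - 1))"
    using sol_m by (rule arg_cong)
  then have "(eu - 1 + ez) * var_x * emb_poly (sol m) = ez * eu ^ (m + 1) * (var_x - 1)"
    by (simp only: emb_poly.hom_simps emb_x emb_z eu_def)
  moreover define s where "s = ez * eu ^ (m + 1) / (eu - 1 + ez)"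
  then have s: "s * (eu - 1 + ez) = ez * eu ^ (m + 1)" using fps_eq_divide_iff[OF D_nth_0] by metis
  ultimately have "(eu - 1 + ez) * (emb_poly (sol m) * var_x) = (eu - 1 + ez) * ((var_x - 1) * s)"
    unfolding s[symmetric] by (simp only: mult_ac)
  moreover have "eu - 1 + ez \<noteq> 0" using D_nth_0 by (metis fps_zero_nth)
  ultimately have "emb_poly (sol m) * var_x = (var_x - 1) * s" by (simp only: mult_cancel_left) simp
  then show ?thesis using fps_eq_divide_unit[OF var_x_nth_0, of "emb_poly (sol m)" "var_x - 1" s] by (simp add: s_def)
qed

lemma J_bar_eq_sol:
  assumes "1 \<le> m" "i \<le> m + 1"
  shows "J_bar m i = sol i"
  using tamari_system_unique[OF tamari_system_J_bar[OF assms(1)] tamari_system_sol assms(2)] .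

end

theorem theorem5p4:
  fixes m :: nat
  assumes "m \<ge> 1"
  shows "(\<exists>!Z. Z_eqn m Z) \<and>
    (\<forall>Z. Z_eqn m Z \<longrightarrow>
      (\<exists>!U. U_eqn m Z U) \<and>
      (\<forall>U. U_eqn m Z U \<longrightarrow>
        (let z = emb_rat Z; u = emb_poly U; x = var_x in
          x\<^sup>2 * emb_poly (I_bar m) =
            z * u ^ (m + 2) / (1 - z) ^ (2 * m + 4) *
              (1 - z * (\<Sum>e=0..m. u ^ e * of_nat (m + 1 - e))) \<and>
          1 + at_x_1 (I_bar m) = (1 - of_nat (m + 1) * Z) / (1 - Z) ^ (m + 2) \<and>
          (\<forall>n\<ge>1. (of_nat (card (tamari_intervals m n)) :: rat) =
            of_nat (m + 1) / of_nat (n * (m * n + 1)) *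
              of_nat (((m + 1)\<^sup>2 * n + m) choose (n - 1))) \<and>
          emb_poly (J_bar m m) = (x - 1) / x * (z * u ^ (m + 1) / (u - 1 + z)) \<and>
          (\<forall>i\<le>m + 1.
            emb_poly (J_bar m i) / x powi (int m - int i - 1) =
              z * (1 - z) powi ((int m + 2) * (int m - int i - 1)) * H_poly m i z u))))"
proof (intro conjI allI impI)
  show "\<exists>!Z. Z_eqn m Z" by (rule Z_eqn_ex1)
  fix Z assume Z: "Z_eqn m Z"
  then have Z0: "Z $ 0 = 0" by (simp add: Z_eqn_def)
  show "\<exists>!U. U_eqn m Z U"
    unfolding U_eqn_iff_fixpoint[OF Z0] by (rule U_fixpoint_ex1[OF Z0])
  fix U assume "U_eqn m Z U"
  then obtain Y where "parametrisation m Z U Y"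
    using parametrisation_ex[OF Z] U_eqn_iff_fixpoint[OF Z0] by blast
  then interpret parametrisation m Z U Y .
  have I: "I_bar m = sol (m + 1)" using J_bar_eq_sol[OF assms, of "m + 1"] J_bar_last by simp
  have unit: "(1 - Z) ^ (m + 2) $ 0 \<noteq> 0" using Z0 by (simp add: fps_power_zeroth)
  show "let z = emb_rat Z; u = emb_poly U; x = var_x in
          x\<^sup>2 * emb_poly (I_bar m) =
            z * u ^ (m + 2) / (1 - z) ^ (2 * m + 4) *
              (1 - z * (\<Sum>e=0..m. u ^ e * of_nat (m + 1 - e))) \<and>
          1 + at_x_1 (I_bar m) = (1 - of_nat (m + 1) * Z) / (1 - Z) ^ (m + 2) \<and>
          (\<forall>n\<ge>1. (of_nat (card (tamari_intervals m n)) :: rat) =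
            of_nat (m + 1) / of_nat (n * (m * n + 1)) *
              of_nat (((m + 1)\<^sup>2 * n + m) choose (n - 1))) \<and>
          emb_poly (J_bar m m) = (x - 1) / x * (z * u ^ (m + 1) / (u - 1 + z)) \<and>
          (\<forall>i\<le>m + 1.
            emb_poly (J_bar m i) / x powi (int m - int i - 1) =
              z * (1 - z) powi ((int m + 2) * (int m - int i - 1)) * H_poly m i z u)"
    unfolding Let_def ez_def[symmetric] eu_def[symmetric]
  proof (intro conjI allI impI)
    show "var_x\<^sup>2 * emb_poly (I_bar m) = ez * eu ^ (m + 2) / (1 - ez) ^ (2 * m + 4) *
        (1 - ez * (\<Sum>e=0..m. eu ^ e * of_nat (m + 1 - e)))"
      unfolding I by (rule emb_sol_last)
    show "1 + at_x_1 (I_bar m) = (1 - of_nat (m + 1) * Z) / (1 - Z) ^ (m + 2)"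
      unfolding I fps_eq_divide_iff[OF unit] by (rule at_x_1_sol_last)
    show "of_nat (card (tamari_intervals m n)) = of_nat (m + 1) / of_nat (n * (m * n + 1)) *
        (of_nat (((m + 1)\<^sup>2 * n + m) choose (n - 1)) :: rat)" if "1 \<le> n" for n
      unfolding card_tamari_intervals[OF that] I
      by (rule Z_coefficients[OF Z at_x_1_sol_last that])
    show "emb_poly (J_bar m m) = (var_x - 1) / var_x * (ez * eu ^ (m + 1) / (eu - 1 + ez))"
      using J_bar_eq_sol[OF assms, of m] emb_sol_m by simp
    show "emb_poly (J_bar m i) / var_x powi (int m - int i - 1) =
        ez * (1 - ez) powi ((int m + 2) * (int m - int i - 1)) * H_poly m i ez eu" if "i \<le> m + 1" for i
      using J_bar_eq_sol[OF assms that] emb_sol_eq_H_poly[OF that] by simp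
  qed
qed

end
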